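(* Let $\varepsilon>0$ and consider an instance of 2GGK(R)-C. Let $OPT$ be an optimal packing and let $APX$ be a most profitable solution that is packed by a guillotine separable container packing. Then $p(APX)\ge(\frac45-O(\varepsilon))\,p(OPT)$.
   Context: 2GGK(R)-C: items are axis-aligned rectangles with integral width $w(i)$ and height $h(i)$, all of profit $1$; a feasible solution places a subset of items, each possibly rotated by 90 degrees, as pairwise disjoint open rectangles in $[0,N]^2$ such that the packing is guillotine separable (a packing in a rectangle $R$ is guillotine separable if it has at most one item or some horizontal/vertical segment spanning $R$ meets no item interior and splits $R$ into two rectangles whose packings are guillotine separable); $p(S)=|S|$. A container packing places all items into a number of containers bounded by a function of $\varepsilon$ only; containers are pairwise non-overlapping axis-aligned rectangles labeled large (one item), horizontal (items stacked on top of each other), vertical (items side by side) or area (a container of size $a\times b$ containing only items with $w(i)\le\varepsilon a$, $h(i)\le\varepsilon b$). $O(\varepsilon)\le c\varepsilon$ for an absolute constant $c$. *)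

theory Defs
  imports "HOL-Analysis.Analysis"
begin

text \<open>A rectangle is given by its lower left and its upper right corner.\<close>

type_synonym rect = "(real \<times> real) \<times> (real \<times> real)"

definition open_rect :: "rect \<Rightarrow> (real \<times> real) set" where
  "open_rect R = box (fst R) (snd R)"

definition closed_rect :: "rect \<Rightarrow> (real \<times> real) set" where
  "closed_rect R = cbox (fst R) (snd R)"

definition rect_width :: "rect \<Rightarrow> real" where
  "rect_width R = fst (snd R) - fst (fst R)"

definition rect_height :: "rect \<Rightarrow> real" where
  "rect_height R = snd (snd R) - snd (fst R)"

text \<open>A packing in \<open>((x0, y0), (x1, y1))\<close> is an index set \<open>S\<close> together with a rectangle \<open>r i\<close> for
  each \<open>i \<in> S\<close>.\<close>

inductive guillotine_separable :: "('i \<Rightarrow> rect) \<Rightarrow> rect \<Rightarrow> 'i set \<Rightarrow> bool"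
  for r :: "'i \<Rightarrow> rect" where
  at_most_one: "finite S \<Longrightarrow> card S \<le> 1 \<Longrightarrow> guillotine_separable r R S"
| vertical_cut:
    "x0 < x \<Longrightarrow> x < x1 \<Longrightarrow>
     (\<forall>i\<in>S. ({x} \<times> {y0..y1}) \<inter> open_rect (r i) = {}) \<Longrightarrow>
     guillotine_separable r ((x0, y0), (x, y1))
       {i\<in>S. open_rect (r i) \<subseteq> closed_rect ((x0, y0), (x, y1))} \<Longrightarrow>
     guillotine_separable r ((x, y0), (x1, y1))
       {i\<in>S. open_rect (r i) \<subseteq> closed_rect ((x, y0), (x1, y1))} \<Longrightarrow>
     guillotine_separable r ((x0, y0), (x1, y1)) S"
| horizontal_cut:
    "y0 < y \<Longrightarrow> y < y1 \<Longrightarrow>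
     (\<forall>i\<in>S. ({x0..x1} \<times> {y}) \<inter> open_rect (r i) = {}) \<Longrightarrow>
     guillotine_separable r ((x0, y0), (x1, y))
       {i\<in>S. open_rect (r i) \<subseteq> closed_rect ((x0, y0), (x1, y))} \<Longrightarrow>
     guillotine_separable r ((x0, y), (x1, y1))
       {i\<in>S. open_rect (r i) \<subseteq> closed_rect ((x0, y), (x1, y1))} \<Longrightarrow>
     guillotine_separable r ((x0, y0), (x1, y1)) S"

definition guillotine_packing :: "('i \<Rightarrow> rect) \<Rightarrow> rect \<Rightarrow> 'i set \<Rightarrow> bool" where
  "guillotine_packing r R S \<longleftrightarrow>
     (\<forall>i\<in>S. open_rect (r i) \<subseteq> closed_rect R) \<and>
     disjoint_family_on (\<lambda>i. open_rect (r i)) S \<and>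
     guillotine_separable r R S"

text \<open>Items are named by natural numbers; distinct items may have the same dimensions.\<close>

record knapsack_instance =
  side :: nat
  items :: "nat set"
  width :: "nat \<Rightarrow> nat"
  height :: "nat \<Rightarrow> nat"

definition valid_instance :: "knapsack_instance \<Rightarrow> bool" where
  "valid_instance G \<longleftrightarrow>
     side G > 0 \<and> finite (items G) \<and> (\<forall>i\<in>items G. width G i > 0 \<and> height G i > 0)"

definition knapsack :: "knapsack_instance \<Rightarrow> rect" where
  "knapsack G = ((0, 0), (real (side G), real (side G)))"

text \<open>A solution maps each selected item to its lower left corner and a flag telling whether the
  item is rotated by 90 degrees; the selected items are the domain of the map.\<close>

type_synonym solution = "nat \<rightharpoonup> (real \<times> real) \<times> bool"

definition placed_size :: "knapsack_instance \<Rightarrow> nat \<Rightarrow> bool \<Rightarrow> real \<times> real" where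
  "placed_size G i rotated =
     (if rotated then (real (height G i), real (width G i))
      else (real (width G i), real (height G i)))"

definition placed_rect :: "knapsack_instance \<Rightarrow> solution \<Rightarrow> nat \<Rightarrow> rect" where
  "placed_rect G P i =
     (let (corner, rotated) = the (P i) in (corner, corner + placed_size G i rotated))"

definition feasible :: "knapsack_instance \<Rightarrow> solution \<Rightarrow> bool" where
  "feasible G P \<longleftrightarrow>
     dom P \<subseteq> items G \<and> guillotine_packing (placed_rect G P) (knapsack G) (dom P)"

definition profit :: "solution \<Rightarrow> nat" where
  "profit P = card (dom P)"

datatype container_kind = Large | Horizontal | Vertical | Area

type_synonym container = "container_kind \<times> rect"

text \<open>\<open>fills \<epsilon> (k, B) r T\<close>: the items \<open>T\<close>, placed at the rectangles \<open>r i\<close>, are packed in the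
  container \<open>B\<close> in the way required by its label \<open>k\<close>. All dimensions are those of the placed,
  i.e. possibly rotated, items.\<close>

fun fills :: "real \<Rightarrow> container \<Rightarrow> ('i \<Rightarrow> rect) \<Rightarrow> 'i set \<Rightarrow> bool" where
  "fills \<epsilon> (k, B) r T \<longleftrightarrow>
     (\<forall>i\<in>T. open_rect (r i) \<subseteq> closed_rect B) \<and>
     (case k of
        Large \<Rightarrow> card T = 1
      | Horizontal \<Rightarrow> pairwise (\<lambda>i j. snd (snd (r i)) \<le> snd (fst (r j)) \<or>
                                     snd (snd (r j)) \<le> snd (fst (r i))) T
      | Vertical \<Rightarrow> pairwise (\<lambda>i j. fst (snd (r i)) \<le> fst (fst (r j)) \<or>
                                   fst (snd (r j)) \<le> fst (fst (r i))) T
      | Area \<Rightarrow> (\<forall>i\<in>T. rect_width (r i) \<le> \<epsilon> * rect_width B \<and>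
                         rect_height (r i) \<le> \<epsilon> * rect_height B))"

text \<open>The map \<open>f\<close> assigns to each packed item (the index of) its container. Feasibility of the
  solution makes the packing inside each container guillotine separable as well.\<close>

definition guillotine_container_packed ::
    "real \<Rightarrow> nat \<Rightarrow> knapsack_instance \<Rightarrow> solution \<Rightarrow> bool" where
  "guillotine_container_packed \<epsilon> k G P \<longleftrightarrow>
     feasible G P \<and>
     (\<exists>(cs :: container list) f.
        length cs \<le> k \<and>
        (\<forall>C\<in>set cs. rect_width (snd C) > 0 \<and> rect_height (snd C) > 0) \<and>
        guillotine_packing (\<lambda>j. snd (cs ! j)) (knapsack G) {..<length cs} \<and>
        (\<forall>i\<in>dom P. f i < length cs) \<and>
        (\<forall>j<length cs. fills \<epsilon> (cs ! j) (placed_rect G P) {i\<in>dom P. f i = j}))"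

end

theory Submission imports Defs begin

text \<open>
  A guillotine packing is a slicing tree, so it is enough to bound the two extents of trees. If there are
  few items, each gets its own container; otherwise constantly many items may be dropped, and by the
  pigeonhole principle also those of a suitable range of intermediate sizes. What remains are long thin
  items and items that are small in both directions.

  Follow the guillotine cuts of the long items as long as they peel off slabs containing items of one
  orientation only. The items peeled off at depth between \<open>e\<close> and \<open>f\<close>, for a scale chosen by the pigeonhole
  principle, are dropped, and those at depth less than \<open>e\<close> are set aside. Then the rest leaves a strip
  of width \<open>f\<close> free, horizontally or vertically, since a cut with long items across it on both sides frees
  a strip in one of the two directions as soon as both its sides do so in any direction. By linear
  grouping the lengths of the long items take only boundedly many values, and columns of equal contents
  can be merged within the tree, so that boundedly many containers suffice. Everything set aside is
  rotated into a small part of the free strip, and the small items are packed by area.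
\<close>

text \<open>Boundedly many containers are not free of charge: linear grouping leaves the group of
  longest items without a home, and every rectangle filled with small items wastes a little area. A
  rearrangement therefore needs spare room of a usable shape, and this room has to be paid for with
  few items. Unit profits make that cheap: a constant number of items and an \<epsilon>-share of
  them may be given up.

  The constants form a chain: \<epsilon>, then the length \<rho> from which an item is long, then
  the strip width \<open>f\<close>, and from these the depth \<open>e\<close>, the thickness bound
  \<delta> of long items and the size \<sigma> of small ones. Each is a function of its
  predecessors. The functions giving \<sigma> and \<open>e\<close> are iterated about 1/\<epsilon>
  times to produce disjoint ranges, of lengths and of depths, for the two pigeonhole arguments. All
  sizes are relative to the side of the knapsack, so no constant depends on the instance.

  The total loss is at most 4\<epsilon>: one share each for the dropped lengths, the dropped depths,
  the dropped small items and the additive constants.\<close>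

section \<open>Slicing trees of guillotine packings\<close>

text \<open>\<open>Cut True\<close> is a vertical and \<open>Cut False\<close> a horizontal cut; correspondingly, \<open>extent s True\<close> is the width and
  \<open>extent s False\<close> the height that a slicing needs.\<close>

datatype 'a slicing = Blank | Piece 'a | Cut bool "'a slicing" "'a slicing"

primrec pieces :: "'a slicing \<Rightarrow> 'a list" where
  "pieces Blank = []"
| "pieces (Piece a) = [a]"
| "pieces (Cut d A B) = pieces A @ pieces B"

primrec extent :: "(bool \<Rightarrow> 'a \<Rightarrow> real) \<Rightarrow> bool \<Rightarrow> 'a slicing \<Rightarrow> real" where
  "extent s d Blank = 0"
| "extent s d (Piece a) = s d a"
| "extent s d (Cut c A B) =
     (if c = d then extent s d A + extent s d B else max (extent s d A) (extent s d B))"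

text \<open>Discarded pieces become \<open>Blank\<close> and every cut stays, so filtering does not
  disturb inductions that follow a tree node by node.\<close>

primrec keep :: "('a \<Rightarrow> bool) \<Rightarrow> 'a slicing \<Rightarrow> 'a slicing" where
  "keep P Blank = Blank"
| "keep P (Piece a) = (if P a then Piece a else Blank)"
| "keep P (Cut d A B) = Cut d (keep P A) (keep P B)"

text \<open>\<open>Blank\<close> leaves count as well: an empty leaf is a free rectangle, and the
  small items may later turn it into a container.\<close>

primrec blocks :: "'a slicing \<Rightarrow> nat" where
  "blocks Blank = 1"
| "blocks (Piece a) = 1"
| "blocks (Cut d A B) = blocks A + blocks B"

primrec only_cuts :: "bool \<Rightarrow> 'a slicing \<Rightarrow> bool" where
  "only_cuts d Blank = True"
| "only_cuts d (Piece a) = True"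
| "only_cuts d (Cut c A B) = (c = d \<and> only_cuts d A \<and> only_cuts d B)"

definition area :: "(bool \<Rightarrow> 'a \<Rightarrow> real) \<Rightarrow> 'a slicing \<Rightarrow> real" where
  "area s T = (\<Sum>a\<leftarrow>pieces T. s True a * s False a)"

lemma pieces_map [simp]: "pieces (map_slicing g T) = map g (pieces T)"
  by (induction T) auto

lemma pieces_keep [simp]: "pieces (keep P T) = filter P (pieces T)"
  by (induction T) auto

lemma length_pieces_le: "length (pieces T) \<le> blocks T"
  by (induction T) auto

lemma extent_map: "extent s d (map_slicing g T) = extent (\<lambda>d a. s d (g a)) d T"
  by (induction T) auto

lemma extent_cong:
  "(\<And>a. a \<in> set (pieces T) \<Longrightarrow> s d a = s' d a) \<Longrightarrow> extent s d T = extent s' d T"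
  by (induction T) auto

lemma extent_mono_size:
  "(\<And>a. a \<in> set (pieces T) \<Longrightarrow> s d a \<le> s' d a) \<Longrightarrow> extent s d T \<le> extent s' d T"
  by (induction T) (auto intro: add_mono max.mono)

lemma extent_scale: "c \<ge> 0 \<Longrightarrow> extent (\<lambda>d a. c * s d a) d T = c * extent s d T"
  by (induction T) (auto simp: distrib_left max_mult_distrib_left)

lemma extent_nonneg: "(\<And>a. a \<in> set (pieces T) \<Longrightarrow> 0 \<le> s d a) \<Longrightarrow> 0 \<le> extent s d T"
  by (induction T) (auto simp: le_max_iff_disj)

lemma extent_ge_piece:
  "(\<And>a. a \<in> set (pieces T) \<Longrightarrow> 0 \<le> s d a) \<Longrightarrow> b \<in> set (pieces T) \<Longrightarrow> s d b \<le> extent s d T"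
proof (induction T)
  case (Cut c A B)
  have "0 \<le> extent s d A" "0 \<le> extent s d B"
    using Cut.prems by (auto intro!: extent_nonneg)
  then show ?case using Cut by (fastforce simp: le_max_iff_disj)
qed auto

lemma extent_keep_le:
  "(\<And>a. a \<in> set (pieces T) \<Longrightarrow> 0 \<le> s d a) \<Longrightarrow> extent s d (keep P T) \<le> extent s d T"
  by (induction T) (auto intro: add_mono max.mono)

lemma extent_no_pieces: "pieces T = [] \<Longrightarrow> extent s d T = 0"
  by (induction T) auto

text \<open>A tree has no coordinates, so the area is compared with the bounding box node by node:
  along a cut the extents add, across it both sides are bounded by their maximum.\<close>

lemma area_le_extents:
  "(\<And>d a. a \<in> set (pieces T) \<Longrightarrow> 0 \<le> s d a) \<Longrightarrow> area s T \<le> extent s True T * extent s False T"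
proof (induction T)
  case (Cut c A B)
  have nn: "0 \<le> extent s d A" "0 \<le> extent s d B" for d
    using Cut.prems by (auto intro!: extent_nonneg)
  have "area s (Cut c A B) = area s A + area s B" by (simp add: area_def)
  also have "\<dots> \<le> extent s True A * extent s False A + extent s True B * extent s False B"
    using Cut by (intro add_mono) auto
  also have "\<dots> \<le> extent s True (Cut c A B) * extent s False (Cut c A B)"
  proof (cases c)
    case True
    have "extent s True A * extent s False A \<le> extent s True A * max (extent s False A) (extent s False B)"
      "extent s True B * extent s False B \<le> extent s True B * max (extent s False A) (extent s False B)"
      using nn by (auto intro!: mult_left_mono)
    then show ?thesis using True by (simp add: distrib_right)
  next
    case False
    have "extent s True A * extent s False A \<le> max (extent s True A) (extent s True B) * extent s False A"
      "extent s True B * extent s False B \<le> max (extent s True A) (extent s True B) * extent s False B"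
      using nn by (auto intro!: mult_right_mono)
    then show ?thesis using False by (simp add: distrib_left)
  qed
  finally show ?case .
qed (auto simp: area_def)

section \<open>Cut lines in coordinates and the passage from packings to slicing trees\<close>

lemma open_rect_subset_closed_rect_iff:
  assumes "a < c" "b < d"
  shows "open_rect ((a, b), (c, d)) \<subseteq> closed_rect ((x0, y0), (x1, y1)) \<longleftrightarrow>
    x0 \<le> a \<and> c \<le> x1 \<and> y0 \<le> b \<and> d \<le> y1"
  using assms unfolding open_rect_def closed_rect_def subset_box
  by (auto simp: Basis_prod_def)

lemma mem_open_rect:
  "(x, y) \<in> open_rect ((a, b), (c, d)) \<longleftrightarrow> a < x \<and> x < c \<and> b < y \<and> y < d"
  by (auto simp: open_rect_def mem_box Basis_prod_def)

lemma vertical_line_misses_iff: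
  assumes "a < c" "b < d" "y0 \<le> b" "d \<le> y1"
  shows "({x} \<times> {y0..y1}) \<inter> open_rect ((a, b), (c, d)) = {} \<longleftrightarrow> c \<le> x \<or> x \<le> a"
proof -
  have "(x, (b + d) / 2) \<in> ({x} \<times> {y0..y1}) \<inter> open_rect ((a, b), (c, d))" if "a < x" "x < c"
    using that assms by (auto simp: mem_open_rect)
  moreover have "({x} \<times> {y0..y1}) \<inter> open_rect ((a, b), (c, d)) = {}" if "c \<le> x \<or> x \<le> a"
    using that by (auto simp: mem_open_rect)
  ultimately show ?thesis by (metis empty_iff not_le_imp_less)
qed

lemma horizontal_line_misses_iff:
  assumes "a < c" "b < d" "x0 \<le> a" "c \<le> x1"
  shows "({x0..x1} \<times> {y}) \<inter> open_rect ((a, b), (c, d)) = {} \<longleftrightarrow> d \<le> y \<or> y \<le> b"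
proof -
  have "((a + c) / 2, y) \<in> ({x0..x1} \<times> {y}) \<inter> open_rect ((a, b), (c, d))" if "b < y" "y < d"
    using that assms by (auto simp: mem_open_rect)
  moreover have "({x0..x1} \<times> {y}) \<inter> open_rect ((a, b), (c, d)) = {}" if "d \<le> y \<or> y \<le> b"
    using that by (auto simp: mem_open_rect)
  ultimately show ?thesis by (metis empty_iff not_le_imp_less)
qed

text \<open>A degenerate rectangle has an empty open box, and its inclusion in another rectangle
  says nothing. Nondegeneracy turns inclusion into inequalities between coordinates.\<close>

definition proper_rect :: "rect \<Rightarrow> bool" where
  "proper_rect R \<longleftrightarrow> rect_width R > 0 \<and> rect_height R > 0"

definition rect_size :: "('i \<Rightarrow> rect) \<Rightarrow> bool \<Rightarrow> 'i \<Rightarrow> real" where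
  "rect_size r d i = (if d then rect_width (r i) else rect_height (r i))"

lemma proper_rectE:
  assumes "proper_rect R"
  obtains a b c d where "R = ((a, b), (c, d))" "a < c" "b < d"
  using assms by (cases R) (auto simp: proper_rect_def rect_width_def rect_height_def)

text \<open>Each cut becomes a node and the coordinates are forgotten. The two halves have sides
  that add up along the cut and agree across it, which is the recursion of
  \<open>extent\<close>.\<close>

lemma guillotine_separable_imp_slicing:
  assumes "guillotine_separable r R S"
    and "finite S" "rect_width R \<ge> 0" "rect_height R \<ge> 0"
    and "\<And>i. i \<in> S \<Longrightarrow> proper_rect (r i) \<and> open_rect (r i) \<subseteq> closed_rect R"
  shows "\<exists>T. distinct (pieces T) \<and> set (pieces T) = S \<and>
    extent (rect_size r) True T \<le> rect_width R \<and> extent (rect_size r) False T \<le> rect_height R"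
  using assms
proof (induction rule: guillotine_separable.induct)
  case (at_most_one S R)
  show ?case
  proof (cases "S = {}")
    case True
    then show ?thesis using at_most_one by (intro exI[of _ Blank]) auto
  next
    case False
    then obtain i where S: "S = {i}"
      using at_most_one by (metis One_nat_def card_1_singletonE card_gt_0_iff le_antisym less_eq_Suc_le)
    then have "proper_rect (r i)" "open_rect (r i) \<subseteq> closed_rect R" using at_most_one by auto
    then obtain a b c d where ri: "r i = ((a, b), (c, d))" "a < c" "b < d" by (auto elim: proper_rectE)
    obtain x0 y0 x1 y1 where R: "R = ((x0, y0), (x1, y1))" by (metis surj_pair)
    have "x0 \<le> a \<and> c \<le> x1 \<and> y0 \<le> b \<and> d \<le> y1"
      using \<open>open_rect (r i) \<subseteq> closed_rect R\<close> ri R by (simp add: open_rect_subset_closed_rect_iff)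
    then show ?thesis using S ri R
      by (intro exI[of _ "Piece i"]) (auto simp: rect_size_def rect_width_def rect_height_def)
  qed
next
  case (vertical_cut x0 x x1 S y0 y1)
  let ?R1 = "((x0, y0), (x, y1))" and ?R2 = "((x, y0), (x1, y1))"
  let ?S1 = "{i\<in>S. open_rect (r i) \<subseteq> closed_rect ?R1}"
  let ?S2 = "{i\<in>S. open_rect (r i) \<subseteq> closed_rect ?R2}"
  have h: "y0 \<le> y1" using vertical_cut.prems by (simp add: rect_height_def)
  \<comment> \<open>Missing the cut line puts an item into one of the halves, and its positive width
    keeps it out of the other. Hence no leaf is lost and none is duplicated.\<close>
  have split: "(i \<in> ?S1 \<or> i \<in> ?S2) \<and> \<not> (i \<in> ?S1 \<and> i \<in> ?S2)" if i: "i \<in> S" for i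
  proof -
    obtain a b c d where ri: "r i = ((a, b), (c, d))" "a < c" "b < d"
      using vertical_cut.prems(4)[OF i] by (auto elim: proper_rectE)
    have io: "x0 \<le> a \<and> c \<le> x1 \<and> y0 \<le> b \<and> d \<le> y1"
      using vertical_cut.prems(4)[OF i] ri by (simp add: open_rect_subset_closed_rect_iff)
    have "c \<le> x \<or> x \<le> a"
      using vertical_cut.hyps(3) i ri io vertical_line_misses_iff[of a c b d y0 y1 x] by force
    then show ?thesis using ri io i by (auto simp: open_rect_subset_closed_rect_iff)
  qed
  have "\<exists>T. distinct (pieces T) \<and> set (pieces T) = ?S1 \<and>
    extent (rect_size r) True T \<le> rect_width ?R1 \<and> extent (rect_size r) False T \<le> rect_height ?R1"
    using vertical_cut.prems vertical_cut.hyps(1,2) h by (intro vertical_cut.IH(1)) (auto simp: rect_width_def rect_height_def)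
  then obtain T1 where T1: "distinct (pieces T1)" "set (pieces T1) = ?S1"
    "extent (rect_size r) True T1 \<le> rect_width ?R1" "extent (rect_size r) False T1 \<le> rect_height ?R1"
    by blast
  have "\<exists>T. distinct (pieces T) \<and> set (pieces T) = ?S2 \<and>
    extent (rect_size r) True T \<le> rect_width ?R2 \<and> extent (rect_size r) False T \<le> rect_height ?R2"
    using vertical_cut.prems vertical_cut.hyps(1,2) h by (intro vertical_cut.IH(2)) (auto simp: rect_width_def rect_height_def)
  then obtain T2 where T2: "distinct (pieces T2)" "set (pieces T2) = ?S2"
    "extent (rect_size r) True T2 \<le> rect_width ?R2" "extent (rect_size r) False T2 \<le> rect_height ?R2"
    by blast
  show ?case
  proof (intro exI[of _ "Cut True T1 T2"] conjI)
    show "distinct (pieces (Cut True T1 T2))" using T1 T2 split by auto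
    show "set (pieces (Cut True T1 T2)) = S" using T1 T2 split by auto
  qed (use T1 T2 in \<open>auto simp: rect_width_def rect_height_def\<close>)
next
  case (horizontal_cut y0 y y1 S x0 x1)
  let ?R1 = "((x0, y0), (x1, y))" and ?R2 = "((x0, y), (x1, y1))"
  let ?S1 = "{i\<in>S. open_rect (r i) \<subseteq> closed_rect ?R1}"
  let ?S2 = "{i\<in>S. open_rect (r i) \<subseteq> closed_rect ?R2}"
  have h: "x0 \<le> x1" using horizontal_cut.prems by (simp add: rect_width_def)
  have split: "(i \<in> ?S1 \<or> i \<in> ?S2) \<and> \<not> (i \<in> ?S1 \<and> i \<in> ?S2)" if i: "i \<in> S" for i
  proof -
    obtain a b c d where ri: "r i = ((a, b), (c, d))" "a < c" "b < d"
      using horizontal_cut.prems(4)[OF i] by (auto elim: proper_rectE)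
    have io: "x0 \<le> a \<and> c \<le> x1 \<and> y0 \<le> b \<and> d \<le> y1"
      using horizontal_cut.prems(4)[OF i] ri by (simp add: open_rect_subset_closed_rect_iff)
    have "d \<le> y \<or> y \<le> b"
      using horizontal_cut.hyps(3) i ri io horizontal_line_misses_iff[of a c b d x0 x1 y] by force
    then show ?thesis using ri io i by (auto simp: open_rect_subset_closed_rect_iff)
  qed
  have "\<exists>T. distinct (pieces T) \<and> set (pieces T) = ?S1 \<and>
    extent (rect_size r) True T \<le> rect_width ?R1 \<and> extent (rect_size r) False T \<le> rect_height ?R1"
    using horizontal_cut.prems horizontal_cut.hyps(1,2) h by (intro horizontal_cut.IH(1)) (auto simp: rect_width_def rect_height_def)
  then obtain T1 where T1: "distinct (pieces T1)" "set (pieces T1) = ?S1"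
    "extent (rect_size r) True T1 \<le> rect_width ?R1" "extent (rect_size r) False T1 \<le> rect_height ?R1"
    by blast
  have "\<exists>T. distinct (pieces T) \<and> set (pieces T) = ?S2 \<and>
    extent (rect_size r) True T \<le> rect_width ?R2 \<and> extent (rect_size r) False T \<le> rect_height ?R2"
    using horizontal_cut.prems horizontal_cut.hyps(1,2) h by (intro horizontal_cut.IH(2)) (auto simp: rect_width_def rect_height_def)
  then obtain T2 where T2: "distinct (pieces T2)" "set (pieces T2) = ?S2"
    "extent (rect_size r) True T2 \<le> rect_width ?R2" "extent (rect_size r) False T2 \<le> rect_height ?R2"
    by blast
  show ?case
  proof (intro exI[of _ "Cut False T1 T2"] conjI)
    show "distinct (pieces (Cut False T1 T2))" using T1 T2 split by auto
    show "set (pieces (Cut False T1 T2)) = S" using T1 T2 split by auto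
  qed (use T1 T2 in \<open>auto simp: rect_width_def rect_height_def\<close>)
qed

section \<open>Gluing two packings along a cut\<close>

lemma guillotine_separable_cong:
  assumes "guillotine_separable r R S" "\<And>i. i \<in> S \<Longrightarrow> r i = r' i"
  shows "guillotine_separable r' R S"
  using assms
proof (induction rule: guillotine_separable.induct)
  case (at_most_one S R)
  then show ?case by (intro guillotine_separable.at_most_one)
next
  case (vertical_cut x0 x x1 S y0 y1)
  have "{i\<in>S. open_rect (r' i) \<subseteq> Q} = {i\<in>S. open_rect (r i) \<subseteq> Q}" for Q
    using vertical_cut.prems by auto
  then show ?case using vertical_cut
    by (intro guillotine_separable.vertical_cut[of x0 x x1]) auto
next
  case (horizontal_cut y0 y y1 S x0 x1)
  have "{i\<in>S. open_rect (r' i) \<subseteq> Q} = {i\<in>S. open_rect (r i) \<subseteq> Q}" for Q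
    using horizontal_cut.prems by auto
  then show ?case using horizontal_cut
    by (intro guillotine_separable.horizontal_cut[of y0 y y1]) auto
qed

lemma guillotine_packing_cong:
  assumes "guillotine_packing r R S" "\<And>i. i \<in> S \<Longrightarrow> r i = r' i"
  shows "guillotine_packing r' R S"
proof -
  have "disjoint_family_on (\<lambda>i. open_rect (r' i)) S = disjoint_family_on (\<lambda>i. open_rect (r i)) S"
    using assms(2) by (auto simp: disjoint_family_on_def)
  then show ?thesis
    using assms guillotine_separable_cong[of r R S r'] unfolding guillotine_packing_def by auto
qed

lemma proper_rect_within:
  assumes "proper_rect Q" "open_rect Q \<subseteq> closed_rect ((x0, y0), (x1, y1))"
  obtains a b c d where "Q = ((a, b), (c, d))" "a < c" "b < d" "x0 \<le> a" "c \<le> x1" "y0 \<le> b" "d \<le> y1"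
proof -
  obtain a b c d where Q: "Q = ((a, b), (c, d))" "a < c" "b < d"
    using assms(1) by (auto elim: proper_rectE)
  then show ?thesis using that assms(2) by (auto simp: open_rect_subset_closed_rect_iff)
qed

text \<open>\<open>vertical_cut\<close> hands to each half the items contained in it, so the point
  is that this filter returns exactly \<open>S1\<close> and \<open>S2\<close>: an item of positive
  width does not fit into the wrong half.\<close>

lemma guillotine_packing_join_vertical:
  assumes p1: "guillotine_packing r ((x0, y0), (x, y1)) S1"
    and p2: "guillotine_packing r ((x, y0), (x1, y1)) S2"
    and x: "x0 < x" "x < x1" and proper: "\<And>i. i \<in> S1 \<union> S2 \<Longrightarrow> proper_rect (r i)"
  shows "guillotine_packing r ((x0, y0), (x1, y1)) (S1 \<union> S2)"
proof -
  have L: "\<exists>a b c d. r i = ((a, b), (c, d)) \<and> a < c \<and> b < d \<and> x0 \<le> a \<and> c \<le> x \<and> y0 \<le> b \<and> d \<le> y1"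
    if "i \<in> S1" for i
  proof -
    have "open_rect (r i) \<subseteq> closed_rect ((x0, y0), (x, y1))"
      using p1 \<open>i \<in> S1\<close> by (auto simp: guillotine_packing_def)
    with proper[of i] \<open>i \<in> S1\<close> show ?thesis by (auto elim!: proper_rect_within)
  qed
  have R: "\<exists>a b c d. r i = ((a, b), (c, d)) \<and> a < c \<and> b < d \<and> x \<le> a \<and> c \<le> x1 \<and> y0 \<le> b \<and> d \<le> y1"
    if "i \<in> S2" for i
  proof -
    have "open_rect (r i) \<subseteq> closed_rect ((x, y0), (x1, y1))"
      using p2 \<open>i \<in> S2\<close> by (auto simp: guillotine_packing_def)
    with proper[of i] \<open>i \<in> S2\<close> show ?thesis by (auto elim!: proper_rect_within)
  qed
  have in1: "open_rect (r i) \<subseteq> closed_rect ((x0, y0), (x, y1)) \<longleftrightarrow> i \<in> S1" if "i \<in> S1 \<union> S2" for i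
  proof
    assume "i \<in> S1"
    then show "open_rect (r i) \<subseteq> closed_rect ((x0, y0), (x, y1))" using p1 by (simp add: guillotine_packing_def)
  next
    assume *: "open_rect (r i) \<subseteq> closed_rect ((x0, y0), (x, y1))"
    show "i \<in> S1"
    proof (rule ccontr)
      assume "i \<notin> S1"
      with that have "i \<in> S2" by simp
      from R[OF this] * show False by (elim exE conjE) (simp add: open_rect_subset_closed_rect_iff)
    qed
  qed
  have in2: "open_rect (r i) \<subseteq> closed_rect ((x, y0), (x1, y1)) \<longleftrightarrow> i \<in> S2" if "i \<in> S1 \<union> S2" for i
  proof
    assume "i \<in> S2"
    then show "open_rect (r i) \<subseteq> closed_rect ((x, y0), (x1, y1))" using p2 by (simp add: guillotine_packing_def)
  next
    assume *: "open_rect (r i) \<subseteq> closed_rect ((x, y0), (x1, y1))"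
    show "i \<in> S2"
    proof (rule ccontr)
      assume "i \<notin> S2"
      with that have "i \<in> S1" by simp
      from L[OF this] * show False by (elim exE conjE) (simp add: open_rect_subset_closed_rect_iff)
    qed
  qed
  have cross: "open_rect (r i) \<inter> open_rect (r j) = {}" if "i \<in> S1" "j \<in> S2" for i j
    using L[OF that(1)] R[OF that(2)] by (auto simp: mem_open_rect)
  have "disjoint_family_on (\<lambda>i. open_rect (r i)) (S1 \<union> S2)"
    unfolding disjoint_family_on_def
  proof (intro ballI impI)
    fix i j assume ij: "i \<in> S1 \<union> S2" "j \<in> S1 \<union> S2" "i \<noteq> j"
    have "disjoint_family_on (\<lambda>i. open_rect (r i)) S1" "disjoint_family_on (\<lambda>i. open_rect (r i)) S2"
      using p1 p2 by (auto simp: guillotine_packing_def)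
    then show "open_rect (r i) \<inter> open_rect (r j) = {}"
      using ij cross[of i j] cross[of j i] unfolding disjoint_family_on_def by blast
  qed
  moreover have "open_rect (r i) \<subseteq> closed_rect ((x0, y0), (x1, y1))" if "i \<in> S1 \<union> S2" for i
  proof (cases "i \<in> S1")
    case True
    from L[OF this] x show ?thesis by (elim exE conjE) (simp add: open_rect_subset_closed_rect_iff)
  next
    case False
    with that have "i \<in> S2" by simp
    from R[OF this] x show ?thesis by (elim exE conjE) (simp add: open_rect_subset_closed_rect_iff)
  qed
  moreover have "guillotine_separable r ((x0, y0), (x1, y1)) (S1 \<union> S2)"
  proof (rule guillotine_separable.vertical_cut[OF x])
    have "({x} \<times> {y0..y1}) \<inter> open_rect (r i) = {}" if "i \<in> S1" for i
      using L[OF that] by (auto simp: mem_open_rect)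
    moreover have "({x} \<times> {y0..y1}) \<inter> open_rect (r i) = {}" if "i \<in> S2" for i
      using R[OF that] by (auto simp: mem_open_rect)
    ultimately show "\<forall>i\<in>S1 \<union> S2. ({x} \<times> {y0..y1}) \<inter> open_rect (r i) = {}" by blast
    have "{i \<in> S1 \<union> S2. open_rect (r i) \<subseteq> closed_rect ((x0, y0), (x, y1))} = S1"
      using in1 by blast
    then show "guillotine_separable r ((x0, y0), (x, y1))
        {i \<in> S1 \<union> S2. open_rect (r i) \<subseteq> closed_rect ((x0, y0), (x, y1))}"
      using p1 by (simp add: guillotine_packing_def)
    have "{i \<in> S1 \<union> S2. open_rect (r i) \<subseteq> closed_rect ((x, y0), (x1, y1))} = S2"
      using in2 by blast
    then show "guillotine_separable r ((x, y0), (x1, y1))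
        {i \<in> S1 \<union> S2. open_rect (r i) \<subseteq> closed_rect ((x, y0), (x1, y1))}"
      using p2 by (simp add: guillotine_packing_def)
  qed
  ultimately show ?thesis by (auto simp: guillotine_packing_def)
qed

lemma guillotine_packing_join_horizontal:
  assumes p1: "guillotine_packing r ((x0, y0), (x1, y)) S1"
    and p2: "guillotine_packing r ((x0, y), (x1, y1)) S2"
    and y: "y0 < y" "y < y1" and proper: "\<And>i. i \<in> S1 \<union> S2 \<Longrightarrow> proper_rect (r i)"
  shows "guillotine_packing r ((x0, y0), (x1, y1)) (S1 \<union> S2)"
proof -
  have L: "\<exists>a b c d. r i = ((a, b), (c, d)) \<and> a < c \<and> b < d \<and> x0 \<le> a \<and> c \<le> x1 \<and> y0 \<le> b \<and> d \<le> y"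
    if "i \<in> S1" for i
  proof -
    have "open_rect (r i) \<subseteq> closed_rect ((x0, y0), (x1, y))"
      using p1 \<open>i \<in> S1\<close> by (auto simp: guillotine_packing_def)
    with proper[of i] \<open>i \<in> S1\<close> show ?thesis by (auto elim!: proper_rect_within)
  qed
  have R: "\<exists>a b c d. r i = ((a, b), (c, d)) \<and> a < c \<and> b < d \<and> x0 \<le> a \<and> c \<le> x1 \<and> y \<le> b \<and> d \<le> y1"
    if "i \<in> S2" for i
  proof -
    have "open_rect (r i) \<subseteq> closed_rect ((x0, y), (x1, y1))"
      using p2 \<open>i \<in> S2\<close> by (auto simp: guillotine_packing_def)
    with proper[of i] \<open>i \<in> S2\<close> show ?thesis by (auto elim!: proper_rect_within)
  qed
  have in1: "open_rect (r i) \<subseteq> closed_rect ((x0, y0), (x1, y)) \<longleftrightarrow> i \<in> S1" if "i \<in> S1 \<union> S2" for i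
  proof
    assume "i \<in> S1"
    then show "open_rect (r i) \<subseteq> closed_rect ((x0, y0), (x1, y))" using p1 by (simp add: guillotine_packing_def)
  next
    assume *: "open_rect (r i) \<subseteq> closed_rect ((x0, y0), (x1, y))"
    show "i \<in> S1"
    proof (rule ccontr)
      assume "i \<notin> S1"
      with that have "i \<in> S2" by simp
      from R[OF this] * show False by (elim exE conjE) (simp add: open_rect_subset_closed_rect_iff)
    qed
  qed
  have in2: "open_rect (r i) \<subseteq> closed_rect ((x0, y), (x1, y1)) \<longleftrightarrow> i \<in> S2" if "i \<in> S1 \<union> S2" for i
  proof
    assume "i \<in> S2"
    then show "open_rect (r i) \<subseteq> closed_rect ((x0, y), (x1, y1))" using p2 by (simp add: guillotine_packing_def)
  next
    assume *: "open_rect (r i) \<subseteq> closed_rect ((x0, y), (x1, y1))"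
    show "i \<in> S2"
    proof (rule ccontr)
      assume "i \<notin> S2"
      with that have "i \<in> S1" by simp
      from L[OF this] * show False by (elim exE conjE) (simp add: open_rect_subset_closed_rect_iff)
    qed
  qed
  have cross: "open_rect (r i) \<inter> open_rect (r j) = {}" if "i \<in> S1" "j \<in> S2" for i j
    using L[OF that(1)] R[OF that(2)] by (auto simp: mem_open_rect)
  have "disjoint_family_on (\<lambda>i. open_rect (r i)) (S1 \<union> S2)"
    unfolding disjoint_family_on_def
  proof (intro ballI impI)
    fix i j assume ij: "i \<in> S1 \<union> S2" "j \<in> S1 \<union> S2" "i \<noteq> j"
    have "disjoint_family_on (\<lambda>i. open_rect (r i)) S1" "disjoint_family_on (\<lambda>i. open_rect (r i)) S2"
      using p1 p2 by (auto simp: guillotine_packing_def)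
    then show "open_rect (r i) \<inter> open_rect (r j) = {}"
      using ij cross[of i j] cross[of j i] unfolding disjoint_family_on_def by blast
  qed
  moreover have "open_rect (r i) \<subseteq> closed_rect ((x0, y0), (x1, y1))" if "i \<in> S1 \<union> S2" for i
  proof (cases "i \<in> S1")
    case True
    from L[OF this] y show ?thesis by (elim exE conjE) (simp add: open_rect_subset_closed_rect_iff)
  next
    case False
    with that have "i \<in> S2" by simp
    from R[OF this] y show ?thesis by (elim exE conjE) (simp add: open_rect_subset_closed_rect_iff)
  qed
  moreover have "guillotine_separable r ((x0, y0), (x1, y1)) (S1 \<union> S2)"
  proof (rule guillotine_separable.horizontal_cut[OF y])
    have "({x0..x1} \<times> {y}) \<inter> open_rect (r i) = {}" if "i \<in> S1" for i
      using L[OF that] by (auto simp: mem_open_rect)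
    moreover have "({x0..x1} \<times> {y}) \<inter> open_rect (r i) = {}" if "i \<in> S2" for i
      using R[OF that] by (auto simp: mem_open_rect)
    ultimately show "\<forall>i\<in>S1 \<union> S2. ({x0..x1} \<times> {y}) \<inter> open_rect (r i) = {}" by blast
    have "{i \<in> S1 \<union> S2. open_rect (r i) \<subseteq> closed_rect ((x0, y0), (x1, y))} = S1"
      using in1 by blast
    then show "guillotine_separable r ((x0, y0), (x1, y))
        {i \<in> S1 \<union> S2. open_rect (r i) \<subseteq> closed_rect ((x0, y0), (x1, y))}"
      using p1 by (simp add: guillotine_packing_def)
    have "{i \<in> S1 \<union> S2. open_rect (r i) \<subseteq> closed_rect ((x0, y), (x1, y1))} = S2"
      using in2 by blast
    then show "guillotine_separable r ((x0, y), (x1, y1))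
        {i \<in> S1 \<union> S2. open_rect (r i) \<subseteq> closed_rect ((x0, y), (x1, y1))}"
      using p2 by (simp add: guillotine_packing_def)
  qed
  ultimately show ?thesis by (auto simp: guillotine_packing_def)
qed

section \<open>Realising a slicing tree by a placement of items\<close>

definition item_size :: "knapsack_instance \<Rightarrow> bool \<Rightarrow> nat \<times> bool \<Rightarrow> real" where
  "item_size G d l = (if d then fst else snd) (placed_size G (fst l) (snd l))"

definition side_by_side :: "('i \<Rightarrow> rect) \<Rightarrow> 'i set \<Rightarrow> bool" where
  "side_by_side r S \<longleftrightarrow> pairwise (\<lambda>i j. fst (snd (r i)) \<le> fst (fst (r j)) \<or>
                                   fst (snd (r j)) \<le> fst (fst (r i))) S"

definition stacked :: "('i \<Rightarrow> rect) \<Rightarrow> 'i set \<Rightarrow> bool" where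
  "stacked r S \<longleftrightarrow> pairwise (\<lambda>i j. snd (snd (r i)) \<le> snd (fst (r j)) \<or>
                              snd (snd (r j)) \<le> snd (fst (r i))) S"

lemma side_by_side_Un:
  assumes "side_by_side r1 S1" "side_by_side r2 S2" "\<And>i. i \<in> S1 \<Longrightarrow> r i = r1 i" "\<And>i. i \<in> S2 \<Longrightarrow> r i = r2 i"
    and "\<And>i j. i \<in> S1 \<Longrightarrow> j \<in> S2 \<Longrightarrow> fst (snd (r i)) \<le> fst (fst (r j))"
  shows "side_by_side r (S1 \<union> S2)"
  unfolding side_by_side_def pairwise_def
proof (intro ballI impI)
  fix i j assume ij: "i \<in> S1 \<union> S2" "j \<in> S1 \<union> S2" "i \<noteq> j"
  then consider "i \<in> S1" "j \<in> S1" | "i \<in> S2" "j \<in> S2" | "i \<in> S1" "j \<in> S2" | "i \<in> S2" "j \<in> S1" by blast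
  then show "fst (snd (r i)) \<le> fst (fst (r j)) \<or> fst (snd (r j)) \<le> fst (fst (r i))"
    by cases (use assms ij(3) in \<open>auto simp: side_by_side_def pairwise_def\<close>)
qed

lemma stacked_Un:
  assumes "stacked r1 S1" "stacked r2 S2" "\<And>i. i \<in> S1 \<Longrightarrow> r i = r1 i" "\<And>i. i \<in> S2 \<Longrightarrow> r i = r2 i"
    and "\<And>i j. i \<in> S1 \<Longrightarrow> j \<in> S2 \<Longrightarrow> snd (snd (r i)) \<le> snd (fst (r j))"
  shows "stacked r (S1 \<union> S2)"
  unfolding stacked_def pairwise_def
proof (intro ballI impI)
  fix i j assume ij: "i \<in> S1 \<union> S2" "j \<in> S1 \<union> S2" "i \<noteq> j"
  then consider "i \<in> S1" "j \<in> S1" | "i \<in> S2" "j \<in> S2" | "i \<in> S1" "j \<in> S2" | "i \<in> S2" "j \<in> S1" by blast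
  then show "snd (snd (r i)) \<le> snd (fst (r j)) \<or> snd (snd (r j)) \<le> snd (fst (r i))"
    by cases (use assms ij(3) in \<open>auto simp: stacked_def pairwise_def\<close>)
qed

lemma placed_rect_eq:
  "P i = Some ((x, y), b) \<Longrightarrow> placed_rect G P i =
     ((x, y), (x + item_size G True (i, b), y + item_size G False (i, b)))"
  by (simp add: placed_rect_def item_size_def placed_size_def)

lemma guillotine_packing_empty: "guillotine_packing r R {}"
  by (auto simp: guillotine_packing_def disjoint_family_on_def intro: guillotine_separable.at_most_one)

lemma guillotine_packing_single:
  "open_rect (r i) \<subseteq> closed_rect R \<Longrightarrow> guillotine_packing r R {i}"
  by (auto simp: guillotine_packing_def disjoint_family_on_def intro: guillotine_separable.at_most_one)

lemma placed_rect_map_add: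
  assumes "dom P1 \<inter> dom P2 = {}"
  shows "i \<in> dom P1 \<Longrightarrow> placed_rect G (P1 ++ P2) i = placed_rect G P1 i"
    and "i \<in> dom P2 \<Longrightarrow> placed_rect G (P1 ++ P2) i = placed_rect G P2 i"
proof -
  assume "i \<in> dom P1"
  then have "i \<notin> dom P2" using assms by auto
  then have "(P1 ++ P2) i = P1 i" by (auto simp: map_add_def split: option.split)
  then show "placed_rect G (P1 ++ P2) i = placed_rect G P1 i" by (simp add: placed_rect_def)
next
  assume "i \<in> dom P2"
  then have "(P1 ++ P2) i = P2 i" by (auto simp: map_add_def split: option.split)
  then show "placed_rect G (P1 ++ P2) i = placed_rect G P2 i" by (simp add: placed_rect_def)
qed

text \<open>Going down the tree, every subtree receives a rectangle that holds its extents.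
  Distinctness is asked of the item numbers \<open>map fst\<close>, since a solution cannot contain
  an item in both orientations. The last two clauses are what \<open>Vertical\<close> and
  \<open>Horizontal\<close> containers demand.\<close>

lemma place_slicing:
  assumes "distinct (map fst (pieces T))"
    and "\<And>l d. l \<in> set (pieces T) \<Longrightarrow> item_size G d l > 0"
    and "extent (item_size G) True T \<le> x1 - x0" "extent (item_size G) False T \<le> y1 - y0"
  shows "\<exists>P. dom P = fst ` set (pieces T) \<and>
    (\<forall>l\<in>set (pieces T). rect_width (placed_rect G P (fst l)) = item_size G True l \<and>
       rect_height (placed_rect G P (fst l)) = item_size G False l) \<and>
    guillotine_packing (placed_rect G P) ((x0, y0), (x1, y1)) (dom P) \<and>
    (only_cuts True T \<longrightarrow> side_by_side (placed_rect G P) (dom P)) \<and>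
    (only_cuts False T \<longrightarrow> stacked (placed_rect G P) (dom P))"
  using assms
proof (induction T arbitrary: x0 y0 x1 y1)
  case Blank
  then show ?case
    by (intro exI[of _ Map.empty]) (auto simp: guillotine_packing_empty side_by_side_def stacked_def)
next
  case (Piece l)
  define P where "P = [fst l \<mapsto> ((x0, y0), snd l)]"
  have r: "placed_rect G P (fst l) = ((x0, y0), (x0 + item_size G True l, y0 + item_size G False l))"
    by (subst placed_rect_eq[of _ _ x0 y0 "snd l"]) (auto simp: P_def)
  have dom: "dom P = {fst l}" by (simp add: P_def)
  have "item_size G True l > 0" "item_size G False l > 0" using Piece.prems by auto
  then have "guillotine_packing (placed_rect G P) ((x0, y0), (x1, y1)) {fst l}"
    using Piece.prems r by (intro guillotine_packing_single) (simp add: open_rect_subset_closed_rect_iff)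
  then show ?case using r dom
    by (intro exI[of _ P]) (simp add: side_by_side_def stacked_def rect_width_def rect_height_def)
next
  case (Cut d A B)
  have posA: "\<And>l d. l \<in> set (pieces A) \<Longrightarrow> item_size G d l > 0"
    and posB: "\<And>l d. l \<in> set (pieces B) \<Longrightarrow> item_size G d l > 0" using Cut.prems by auto
  \<comment> \<open>A subtree without pieces may push the cut onto the border, where guillotine cuts
    are not allowed; such a node is replaced by its other side.\<close>
  consider "pieces A = []" | "pieces B = []" | "pieces A \<noteq> []" "pieces B \<noteq> []" by blast
  then show ?case
  proof cases
    case 1
    have "0 \<le> extent (item_size G) d B" for d using posB by (intro extent_nonneg) (auto intro: less_imp_le)
    then have e: "extent (item_size G) d' (Cut d A B) = extent (item_size G) d' B" for d'
      using extent_no_pieces[OF 1, of "item_size G"] by auto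
    have "distinct (map fst (pieces B))" using Cut.prems(1) by simp
    from Cut.IH(2)[OF this posB Cut.prems(3,4)[unfolded e]] 1 show ?thesis by auto
  next
    case 2
    have "0 \<le> extent (item_size G) d A" for d using posA by (intro extent_nonneg) (auto intro: less_imp_le)
    then have e: "extent (item_size G) d' (Cut d A B) = extent (item_size G) d' A" for d'
      using extent_no_pieces[OF 2, of "item_size G"] by auto
    have "distinct (map fst (pieces A))" using Cut.prems(1) by simp
    from Cut.IH(1)[OF this posA Cut.prems(3,4)[unfolded e]] 2 show ?thesis by auto
  next
    case 3
    have A0: "extent (item_size G) d A > 0" for d
    proof -
      obtain l where "l \<in> set (pieces A)" using 3 by (meson last_in_set)
      then show ?thesis
        using posA[of l d] extent_ge_piece[of A "item_size G" d l] posA by (fastforce intro: less_imp_le)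
    qed
    have B0: "extent (item_size G) d B > 0" for d
    proof -
      obtain l where "l \<in> set (pieces B)" using 3 by (meson last_in_set)
      then show ?thesis
        using posB[of l d] extent_ge_piece[of B "item_size G" d l] posB by (fastforce intro: less_imp_le)
    qed
    \<comment> \<open>Along the cut, \<open>A\<close> gets exactly its extent and \<open>B\<close>
      all the rest; across the cut both get the full side.\<close>
    define x where "x = (if d then x0 + extent (item_size G) True A else x1)"
    define y where "y = (if d then y1 else y0 + extent (item_size G) False A)"
    define x' where "x' = (if d then x else x0)"
    define y' where "y' = (if d then y0 else y)"
    have fitA: "extent (item_size G) True A \<le> x - x0" "extent (item_size G) False A \<le> y - y0"
      using Cut.prems(3,4) by (auto simp: x_def y_def split: if_splits)
    have fitB: "extent (item_size G) True B \<le> x1 - x'" "extent (item_size G) False B \<le> y1 - y'"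
      using Cut.prems(3,4) by (auto simp: x_def y_def x'_def y'_def split: if_splits)
    have dA: "distinct (map fst (pieces A))" and dB: "distinct (map fst (pieces B))"
      and disj: "fst ` set (pieces A) \<inter> fst ` set (pieces B) = {}"
      using Cut.prems(1) by auto
    obtain P1 where P1: "dom P1 = fst ` set (pieces A)"
      "\<And>l. l \<in> set (pieces A) \<Longrightarrow> rect_width (placed_rect G P1 (fst l)) = item_size G True l \<and>
         rect_height (placed_rect G P1 (fst l)) = item_size G False l"
      "guillotine_packing (placed_rect G P1) ((x0, y0), (x, y)) (dom P1)"
      "only_cuts True A \<Longrightarrow> side_by_side (placed_rect G P1) (dom P1)"
      "only_cuts False A \<Longrightarrow> stacked (placed_rect G P1) (dom P1)"
      using Cut.IH(1)[OF dA posA fitA] by blast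
    obtain P2 where P2: "dom P2 = fst ` set (pieces B)"
      "\<And>l. l \<in> set (pieces B) \<Longrightarrow> rect_width (placed_rect G P2 (fst l)) = item_size G True l \<and>
         rect_height (placed_rect G P2 (fst l)) = item_size G False l"
      "guillotine_packing (placed_rect G P2) ((x', y'), (x1, y1)) (dom P2)"
      "only_cuts True B \<Longrightarrow> side_by_side (placed_rect G P2) (dom P2)"
      "only_cuts False B \<Longrightarrow> stacked (placed_rect G P2) (dom P2)"
      using Cut.IH(2)[OF dB posB fitB] by blast
    let ?P = "P1 ++ P2" and ?r = "placed_rect G (P1 ++ P2)"
    have dd: "dom P1 \<inter> dom P2 = {}" using disj P1 P2 by simp
    have r1: "?r i = placed_rect G P1 i" if "i \<in> dom P1" for i
      using that placed_rect_map_add(1)[OF dd] by blast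
    have r2: "?r i = placed_rect G P2 i" if "i \<in> dom P2" for i
      using that placed_rect_map_add(2)[OF dd] by blast
    have sz: "rect_width (?r (fst l)) = item_size G True l \<and> rect_height (?r (fst l)) = item_size G False l"
      if "l \<in> set (pieces (Cut d A B))" for l
    proof (cases "l \<in> set (pieces A)")
      case True
      then show ?thesis using P1(2)[OF True] r1[of "fst l"] P1(1) by simp
    next
      case False
      then have l: "l \<in> set (pieces B)" using that by simp
      show ?thesis using P2(2)[OF l] r2[of "fst l"] P2(1) l by simp
    qed
    have proper: "proper_rect (?r i)" if i: "i \<in> dom P1 \<union> dom P2" for i
    proof -
      have "i \<in> fst ` set (pieces (Cut d A B))" using i P1(1) P2(1) by auto
      then obtain l where "l \<in> set (pieces (Cut d A B))" "i = fst l" by blast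
      then show ?thesis using sz[of l] Cut.prems(2)[of l] by (auto simp: proper_rect_def)
    qed
    have g1: "guillotine_packing ?r ((x0, y0), (x, y)) (dom P1)"
      using r1 by (intro guillotine_packing_cong[OF P1(3)]) auto
    have g2: "guillotine_packing ?r ((x', y'), (x1, y1)) (dom P2)"
      using r2 by (intro guillotine_packing_cong[OF P2(3)]) auto
    have in1: "\<exists>a b c e. ?r i = ((a, b), (c, e)) \<and> c \<le> x \<and> e \<le> y" if "i \<in> dom P1" for i
    proof -
      have "open_rect (?r i) \<subseteq> closed_rect ((x0, y0), (x, y))" using g1 that by (auto simp: guillotine_packing_def)
      then show ?thesis using proper[of i] that by (auto elim!: proper_rect_within)
    qed
    have in2: "\<exists>a b c e. ?r i = ((a, b), (c, e)) \<and> x' \<le> a \<and> y' \<le> b" if "i \<in> dom P2" for i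
    proof -
      have "open_rect (?r i) \<subseteq> closed_rect ((x', y'), (x1, y1))" using g2 that by (auto simp: guillotine_packing_def)
      then show ?thesis using proper[of i] that by (auto elim!: proper_rect_within)
    qed
    have dom: "dom ?P = dom P1 \<union> dom P2" by auto
    have join: "guillotine_packing ?r ((x0, y0), (x1, y1)) (dom P1 \<union> dom P2)"
    proof (cases d)
      case True
      show ?thesis
        using g1 g2 True A0[of True] B0[of True] fitB proper
        by (intro guillotine_packing_join_vertical[of _ x0 y0 x]) (auto simp: x_def y_def x'_def y'_def)
    next
      case False
      show ?thesis
        using g1 g2 False A0[of False] B0[of False] fitB proper
        by (intro guillotine_packing_join_horizontal[of _ x0 y0 x1 y]) (auto simp: x_def y_def x'_def y'_def)
    qed
    have "side_by_side ?r (dom P1 \<union> dom P2)" if "only_cuts True (Cut d A B)"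
    proof -
      have d: "d" "side_by_side (placed_rect G P1) (dom P1)" "side_by_side (placed_rect G P2) (dom P2)"
        using that P1(4) P2(4) by auto
      have "fst (snd (?r i)) \<le> fst (fst (?r j))" if "i \<in> dom P1" "j \<in> dom P2" for i j
        using in1[OF that(1)] in2[OF that(2)] d(1) by (auto simp: x'_def)
      then show ?thesis using r1 r2 by (intro side_by_side_Un[OF d(2,3)]) auto
    qed
    moreover have "stacked ?r (dom P1 \<union> dom P2)" if "only_cuts False (Cut d A B)"
    proof -
      have d: "\<not> d" "stacked (placed_rect G P1) (dom P1)" "stacked (placed_rect G P2) (dom P2)"
        using that P1(5) P2(5) by auto
      have "snd (snd (?r i)) \<le> snd (fst (?r j))" if "i \<in> dom P1" "j \<in> dom P2" for i j
        using in1[OF that(1)] in2[OF that(2)] d(1) by (auto simp: y'_def)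
      then show ?thesis using r1 r2 by (intro stacked_Un[OF d(2,3)]) auto
    qed
    ultimately show ?thesis
      using join sz P1(1) P2(1) unfolding dom[symmetric]
      by (intro exI[of _ ?P]) (simp add: image_Un dom Un_commute)
  qed
qed

section \<open>From planned containers to container packings\<close>

text \<open>The two numbers are the width and the height of the container; its position is left open.\<close>

type_synonym 'l plan = "container_kind \<times> 'l slicing \<times> real \<times> real"

definition plan_size :: "bool \<Rightarrow> 'l plan \<Rightarrow> real" where
  "plan_size d c = (case c of (k, T, w, h) \<Rightarrow> if d then w else h)"

definition contents :: "'l plan \<Rightarrow> 'l list" where
  "contents c = pieces (fst (snd c))"

text \<open>Every kind of container, \<open>Area\<close> included, carries a slicing tree of its
  items, because the items themselves must form a guillotine separable packing.
  \<open>Horizontal\<close> goes with \<open>only_cuts False\<close>: horizontal cuts separate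
  stacked items.\<close>

definition plan_ok :: "real \<Rightarrow> (bool \<Rightarrow> 'l \<Rightarrow> real) \<Rightarrow> 'l plan \<Rightarrow> bool" where
  "plan_ok \<epsilon> s c \<longleftrightarrow> (case c of (k, T, w, h) \<Rightarrow>
     0 < w \<and> 0 < h \<and> extent s True T \<le> w \<and> extent s False T \<le> h \<and>
     (case k of
        Large \<Rightarrow> (\<exists>a. T = Piece a)
      | Horizontal \<Rightarrow> only_cuts False T
      | Vertical \<Rightarrow> only_cuts True T
      | Area \<Rightarrow> (\<forall>a\<in>set (pieces T). s True a \<le> \<epsilon> * w \<and> s False a \<le> \<epsilon> * h)))"

definition all_contents :: "'l plan slicing \<Rightarrow> 'l list" where
  "all_contents C = concat (map contents (pieces C))"

lemma all_contents_simps [simp]: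
  "all_contents Blank = []"
  "all_contents (Piece c) = contents c"
  "all_contents (Cut d A B) = all_contents A @ all_contents B"
  by (simp_all add: all_contents_def)

lemma fills_cong:
  assumes "\<And>i. i \<in> S \<Longrightarrow> r i = r' i"
  shows "fills \<epsilon> C r S = fills \<epsilon> C r' S"
proof -
  obtain k B where C: "C = (k, B)" by (cases C)
  show ?thesis unfolding C using assms by (cases k) (auto simp: pairwise_def)
qed

lemma place_container_slicing:
  fixes spec :: "nat \<Rightarrow> (nat \<times> bool) plan"
  assumes "\<epsilon> > 0" "distinct (pieces I)"
    and "\<forall>j\<in>set (pieces I). plan_ok \<epsilon> (item_size G) (spec j)"
    and "distinct (map fst (all_contents (map_slicing spec I)))"
    and "\<forall>l\<in>set (all_contents (map_slicing spec I)). \<forall>d. item_size G d l > 0"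
    and "extent plan_size True (map_slicing spec I) \<le> x1 - x0"
    and "extent plan_size False (map_slicing spec I) \<le> y1 - y0"
  shows "\<exists>rc P. (\<forall>j\<in>set (pieces I). proper_rect (rc j)) \<and>
    guillotine_packing rc ((x0, y0), (x1, y1)) (set (pieces I)) \<and>
    dom P = fst ` set (all_contents (map_slicing spec I)) \<and>
    (\<forall>i\<in>dom P. proper_rect (placed_rect G P i)) \<and>
    guillotine_packing (placed_rect G P) ((x0, y0), (x1, y1)) (dom P) \<and>
    (\<forall>j\<in>set (pieces I). fills \<epsilon> (fst (spec j), rc j) (placed_rect G P) (fst ` set (contents (spec j))))"
  using assms(2-)
proof (induction I arbitrary: x0 y0 x1 y1)
  case Blank
  then show ?case
    by (intro exI[of _ "\<lambda>_. undefined"] exI[of _ Map.empty]) (auto simp: guillotine_packing_empty)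
next
  case (Piece j)
  obtain k T w h where spec: "spec j = (k, T, w, h)" by (metis prod_cases4)
  have ok: "plan_ok \<epsilon> (item_size G) (k, T, w, h)" using Piece.prems(2) spec by simp
  have c: "contents (spec j) = pieces T" by (simp add: spec contents_def)
  have wh: "0 < w" "0 < h" "w \<le> x1 - x0" "h \<le> y1 - y0"
    using ok Piece.prems(5,6) by (auto simp: spec plan_ok_def plan_size_def)
  have fit: "extent (item_size G) True T \<le> x1 - x0" "extent (item_size G) False T \<le> y1 - y0"
    using ok wh by (auto simp: plan_ok_def)
  have dis: "distinct (map fst (pieces T))" using Piece.prems(3) c by simp
  have pos: "\<And>l d. l \<in> set (pieces T) \<Longrightarrow> item_size G d l > 0" using Piece.prems(4) c by simp
  obtain P where P: "dom P = fst ` set (pieces T)"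
    "\<And>l. l \<in> set (pieces T) \<Longrightarrow> rect_width (placed_rect G P (fst l)) = item_size G True l \<and>
       rect_height (placed_rect G P (fst l)) = item_size G False l"
    "guillotine_packing (placed_rect G P) ((x0, y0), (x1, y1)) (dom P)"
    "only_cuts True T \<Longrightarrow> side_by_side (placed_rect G P) (dom P)"
    "only_cuts False T \<Longrightarrow> stacked (placed_rect G P) (dom P)"
    using place_slicing[OF dis pos fit] by blast
  let ?R = "((x0, y0), (x1, y1))"
  have proper: "proper_rect (placed_rect G P i)" if i: "i \<in> dom P" for i
  proof -
    obtain l where "l \<in> set (pieces T)" "i = fst l" using i P(1) by auto
    then show ?thesis using P(2)[of l] pos[of l] by (auto simp: proper_rect_def)
  qed
  \<comment> \<open>The container takes the whole rectangle available at its leaf and not only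
    \<open>w\<close> times \<open>h\<close>. Enlarging it keeps the items inside and relaxes the
    \<open>Area\<close> condition.\<close>
  have R: "proper_rect ?R" using wh by (auto simp: proper_rect_def rect_width_def rect_height_def)
  then have gR: "guillotine_packing (\<lambda>_. ?R) ?R {j}"
    using wh by (intro guillotine_packing_single) (simp add: open_rect_subset_closed_rect_iff)
  have inside: "\<forall>i\<in>dom P. open_rect (placed_rect G P i) \<subseteq> closed_rect ?R"
    using P(3) by (simp add: guillotine_packing_def)
  have "fills \<epsilon> (k, ?R) (placed_rect G P) (dom P)"
  proof (cases k)
    case Large
    then obtain a where "T = Piece a" using ok by (auto simp: plan_ok_def)
    then show ?thesis using inside P(1) Large by simp
  next
    case Horizontal
    then have "stacked (placed_rect G P) (dom P)" using ok P(5) by (auto simp: plan_ok_def)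
    then show ?thesis using inside Horizontal by (simp add: stacked_def)
  next
    case Vertical
    then have "side_by_side (placed_rect G P) (dom P)" using ok P(4) by (auto simp: plan_ok_def)
    then show ?thesis using inside Vertical by (simp add: side_by_side_def)
  next
    case Area
    have "rect_width (placed_rect G P i) \<le> \<epsilon> * rect_width ?R \<and>
      rect_height (placed_rect G P i) \<le> \<epsilon> * rect_height ?R" if i: "i \<in> dom P" for i
    proof -
      obtain l where l: "l \<in> set (pieces T)" "i = fst l" using i P(1) by auto
      then have "item_size G True l \<le> \<epsilon> * w" "item_size G False l \<le> \<epsilon> * h"
        using ok Area by (auto simp: plan_ok_def)
      moreover have "\<epsilon> * w \<le> \<epsilon> * rect_width ?R" "\<epsilon> * h \<le> \<epsilon> * rect_height ?R"
        using wh assms(1) by (auto simp: rect_width_def rect_height_def)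
      ultimately show ?thesis using P(2)[OF l(1)] l(2) by auto
    qed
    then show ?thesis using inside Area by simp
  qed
  then show ?case using gR R P(1,3) proper c
    by (intro exI[of _ "\<lambda>_. ?R"] exI[of _ P]) (simp add: spec)
next
  case (Cut d A B)
  let ?A = "map_slicing spec A" and ?B = "map_slicing spec B"
  have okA: "\<forall>j\<in>set (pieces A). plan_ok \<epsilon> (item_size G) (spec j)"
    and okB: "\<forall>j\<in>set (pieces B). plan_ok \<epsilon> (item_size G) (spec j)"
    using Cut.prems(2) by auto
  have posA: "\<forall>l\<in>set (all_contents ?A). \<forall>d. item_size G d l > 0"
    and posB: "\<forall>l\<in>set (all_contents ?B). \<forall>d. item_size G d l > 0"
    using Cut.prems(4) by auto
  have dA: "distinct (pieces A)" "distinct (map fst (all_contents ?A))"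
    and dB: "distinct (pieces B)" "distinct (map fst (all_contents ?B))"
    and disj: "fst ` set (all_contents ?A) \<inter> fst ` set (all_contents ?B) = {}"
      "set (pieces A) \<inter> set (pieces B) = {}"
    using Cut.prems(1,3) by auto
  have sp: "plan_size d (spec j) > 0" if "j \<in> set (pieces A) \<union> set (pieces B)" for d j
    using that okA okB by (fastforce simp: plan_ok_def plan_size_def split: prod.splits)
  consider "pieces A = []" | "pieces B = []" | "pieces A \<noteq> []" "pieces B \<noteq> []" by blast
  then show ?case
  proof cases
    case 1
    have "0 \<le> extent plan_size d ?B" for d using sp by (intro extent_nonneg) (auto intro: less_imp_le)
    then have e: "extent plan_size d' (map_slicing spec (Cut d A B)) = extent plan_size d' ?B" for d'
      using extent_no_pieces[of ?A plan_size] 1 by auto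
    have ac: "all_contents ?A = []" using 1 by (simp add: all_contents_def)
    from Cut.IH(2)[OF dB(1) okB dB(2) posB Cut.prems(5,6)[unfolded e]] 1 ac show ?thesis by simp
  next
    case 2
    have "0 \<le> extent plan_size d ?A" for d using sp by (intro extent_nonneg) (auto intro: less_imp_le)
    then have e: "extent plan_size d' (map_slicing spec (Cut d A B)) = extent plan_size d' ?A" for d'
      using extent_no_pieces[of ?B plan_size] 2 by auto
    have ac: "all_contents ?B = []" using 2 by (simp add: all_contents_def)
    from Cut.IH(1)[OF dA(1) okA dA(2) posA Cut.prems(5,6)[unfolded e]] 2 ac show ?thesis by simp
  next
    case 3
    have A0: "extent plan_size d ?A > 0" for d
    proof -
      obtain j where j: "j \<in> set (pieces A)" using 3 by (meson last_in_set)
      then have "plan_size d (spec j) \<le> extent plan_size d ?A"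
        using sp by (intro extent_ge_piece) (auto intro: less_imp_le)
      then show ?thesis using sp[of j d] j by auto
    qed
    have B0: "extent plan_size d ?B > 0" for d
    proof -
      obtain j where j: "j \<in> set (pieces B)" using 3 by (meson last_in_set)
      then have "plan_size d (spec j) \<le> extent plan_size d ?B"
        using sp by (intro extent_ge_piece) (auto intro: less_imp_le)
      then show ?thesis using sp[of j d] j by auto
    qed
    define x where "x = (if d then x0 + extent plan_size True ?A else x1)"
    define y where "y = (if d then y1 else y0 + extent plan_size False ?A)"
    define x' where "x' = (if d then x else x0)"
    define y' where "y' = (if d then y0 else y)"
    have fitA: "extent plan_size True ?A \<le> x - x0" "extent plan_size False ?A \<le> y - y0"
      using Cut.prems(5,6) by (auto simp: x_def y_def split: if_splits)
    have fitB: "extent plan_size True ?B \<le> x1 - x'" "extent plan_size False ?B \<le> y1 - y'"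
      using Cut.prems(5,6) by (auto simp: x_def y_def x'_def y'_def split: if_splits)
    obtain rc1 P1 where ex1: "\<forall>j\<in>set (pieces A). proper_rect (rc1 j)"
      "guillotine_packing rc1 ((x0, y0), (x, y)) (set (pieces A))"
      "dom P1 = fst ` set (all_contents ?A)"
      "\<forall>i\<in>dom P1. proper_rect (placed_rect G P1 i)"
      "guillotine_packing (placed_rect G P1) ((x0, y0), (x, y)) (dom P1)"
      "\<forall>j\<in>set (pieces A).
        fills \<epsilon> (fst (spec j), rc1 j) (placed_rect G P1) (fst ` set (contents (spec j)))"
      using Cut.IH(1)[OF dA(1) okA dA(2) posA fitA] by (elim exE conjE) (rule that)
    note 1 = ex1[rule_format]
    obtain rc2 P2 where ex2: "\<forall>j\<in>set (pieces B). proper_rect (rc2 j)"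
      "guillotine_packing rc2 ((x', y'), (x1, y1)) (set (pieces B))"
      "dom P2 = fst ` set (all_contents ?B)"
      "\<forall>i\<in>dom P2. proper_rect (placed_rect G P2 i)"
      "guillotine_packing (placed_rect G P2) ((x', y'), (x1, y1)) (dom P2)"
      "\<forall>j\<in>set (pieces B).
        fills \<epsilon> (fst (spec j), rc2 j) (placed_rect G P2) (fst ` set (contents (spec j)))"
      using Cut.IH(2)[OF dB(1) okB dB(2) posB fitB] by (elim exE conjE) (rule that)
    note 2 = ex2[rule_format]
    let ?P = "P1 ++ P2" and ?r = "placed_rect G (P1 ++ P2)"
    define rc where "rc = (\<lambda>j. if j \<in> set (pieces A) then rc1 j else rc2 j)"
    have dd: "dom P1 \<inter> dom P2 = {}" using disj 1(3) 2(3) by simp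
    have r1: "?r i = placed_rect G P1 i" if "i \<in> dom P1" for i
      using that placed_rect_map_add(1)[OF dd] by blast
    have r2: "?r i = placed_rect G P2 i" if "i \<in> dom P2" for i
      using that placed_rect_map_add(2)[OF dd] by blast
    have c1: "rc j = rc1 j" if "j \<in> set (pieces A)" for j using that by (simp add: rc_def)
    have c2: "rc j = rc2 j" if "j \<in> set (pieces B)" for j using that disj(2) by (auto simp: rc_def)
    have join: "guillotine_packing q ((x0, y0), (x1, y1)) (S1 \<union> S2)"
      if "guillotine_packing q ((x0, y0), (x, y)) S1" "guillotine_packing q ((x', y'), (x1, y1)) S2"
        "\<And>i. i \<in> S1 \<union> S2 \<Longrightarrow> proper_rect (q i)" for q and S1 S2 :: "nat set"
    proof (cases d)
      case True
      show ?thesis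
        using that True A0[of True] B0[of True] fitB
        by (intro guillotine_packing_join_vertical[of _ x0 y0 x]) (auto simp: x_def y_def x'_def y'_def)
    next
      case False
      show ?thesis
        using that False A0[of False] B0[of False] fitB
        by (intro guillotine_packing_join_horizontal[of _ x0 y0 x1 y]) (auto simp: x_def y_def x'_def y'_def)
    qed
    have proper: "proper_rect (?r i)" if "i \<in> dom P1 \<union> dom P2" for i
      using that 1(4)[of i] 2(4)[of i] r1[of i] r2[of i] by (elim UnE) (simp_all only:)
    have properc: "proper_rect (rc j)" if "j \<in> set (pieces A) \<union> set (pieces B)" for j
      using that 1(1)[of j] 2(1)[of j] c1[of j] c2[of j] by auto
    have gr: "guillotine_packing ?r ((x0, y0), (x1, y1)) (dom P1 \<union> dom P2)"
      using 1(5) 2(5) r1 r2 proper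
      by (intro join guillotine_packing_cong[OF 1(5)] guillotine_packing_cong[OF 2(5)]) auto
    have gc: "guillotine_packing rc ((x0, y0), (x1, y1)) (set (pieces A) \<union> set (pieces B))"
      using c1 c2 properc
      by (intro join guillotine_packing_cong[OF 1(2)] guillotine_packing_cong[OF 2(2)]) auto
    have fl: "fills \<epsilon> (fst (spec j), rc j) ?r (fst ` set (contents (spec j)))"
      if "j \<in> set (pieces A) \<union> set (pieces B)" for j
    proof (cases "j \<in> set (pieces A)")
      case True
      have "fst ` set (contents (spec j)) \<subseteq> dom P1" using 1(3) True by (auto simp: all_contents_def)
      then have "fills \<epsilon> (fst (spec j), rc1 j) ?r (fst ` set (contents (spec j)))"
        using 1(6)[OF True] r1 by (subst fills_cong[of _ _ "placed_rect G P1"]) auto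
      then show ?thesis using c1[OF True] by simp
    next
      case False
      then have j: "j \<in> set (pieces B)" using that by simp
      have "fst ` set (contents (spec j)) \<subseteq> dom P2" using 2(3) j by (auto simp: all_contents_def)
      then have "fills \<epsilon> (fst (spec j), rc2 j) ?r (fst ` set (contents (spec j)))"
        using 2(6)[OF j] r2 by (subst fills_cong[of _ _ "placed_rect G P2"]) auto
      then show ?thesis using c2[OF j] by simp
    qed
    have dom: "dom ?P = dom P1 \<union> dom P2" by auto
    show ?thesis
    proof (intro exI conjI)
      show "dom ?P = fst ` set (all_contents (map_slicing spec (Cut d A B)))"
        using dom 1(3) 2(3) by (simp add: image_Un)
      show "\<forall>j\<in>set (pieces (Cut d A B)). proper_rect (rc j)" using properc by simp
      show "guillotine_packing rc ((x0, y0), (x1, y1)) (set (pieces (Cut d A B)))" using gc by simp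
      show "\<forall>i\<in>dom ?P. proper_rect (?r i)" using proper dom by simp
      show "guillotine_packing ?r ((x0, y0), (x1, y1)) (dom ?P)" using gr dom by simp
      show "\<forall>j\<in>set (pieces (Cut d A B)). fills \<epsilon> (fst (spec j), rc j) ?r (fst ` set (contents (spec j)))"
        using fl by simp
    qed
  qed
qed

text \<open>Plans with empty contents may coincide, so the leaves are replaced by distinct indices
  before containers are listed.\<close>

primrec number :: "nat \<Rightarrow> 'a slicing \<Rightarrow> nat slicing" where
  "number n Blank = Blank"
| "number n (Piece a) = Piece n"
| "number n (Cut d A B) = Cut d (number n A) (number (n + length (pieces A)) B)"

lemma pieces_number: "pieces (number n T) = [n..<n + length (pieces T)]"
proof (induction T arbitrary: n)
  case (Cut d A B)
  then show ?case
    using upt_add_eq_append[of n "n + length (pieces A)" "length (pieces B)"] by (simp add: add.assoc)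
qed auto

lemma map_number:
  "(\<And>k. k < length (pieces T) \<Longrightarrow> f (n + k) = pieces T ! k) \<Longrightarrow> map_slicing f (number n T) = T"
proof (induction T arbitrary: n)
  case (Piece a)
  then show ?case using Piece.prems[of 0] by simp
next
  case (Cut d A B)
  have "map_slicing f (number n A) = A"
    using Cut.prems by (intro Cut.IH) (simp add: nth_append)
  moreover have "map_slicing f (number (n + length (pieces A)) B) = B"
  proof (rule Cut.IH)
    fix k assume "k < length (pieces B)"
    then show "f (n + length (pieces A) + k) = pieces B ! k"
      using Cut.prems[of "length (pieces A) + k"] by (simp add: nth_append add.assoc)
  qed
  ultimately show ?case by simp
qed auto

lemma distinct_concat_nth_disjoint:
  assumes "distinct (map g (concat xss))" "j < length xss" "k < length xss" "j \<noteq> k"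
  shows "g ` set (xss ! j) \<inter> g ` set (xss ! k) = {}"
  using assms
proof (induction xss arbitrary: j k)
  case (Cons xs xss)
  have in_concat: "g ` set (xss ! m) \<subseteq> g ` set (concat xss)" if "m < length xss" for m
    using that by (auto intro!: image_eqI bexI[of _ "xss ! m"])
  have "g ` set xs \<inter> g ` set (concat xss) = {}" using Cons.prems(1) by auto
  then have 0: "g ` set xs \<inter> g ` set (xss ! m) = {}" if "m < length xss" for m
    using in_concat[OF that] by blast
  show ?case
  proof (cases j)
    case 0
    then obtain m where "k = Suc m" using Cons.prems(4) by (cases k) auto
    then show ?thesis using 0 \<open>\<And>m. m < length xss \<Longrightarrow> g ` set xs \<inter> g ` set (xss ! m) = {}\<close>[of m] Cons.prems(3)
      by simp
  next
    case (Suc m)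
    show ?thesis
    proof (cases k)
      case 0
      then show ?thesis using Suc \<open>\<And>m. m < length xss \<Longrightarrow> g ` set xs \<inter> g ` set (xss ! m) = {}\<close>[of m] Cons.prems(2)
        by (simp add: Int_commute)
    next
      case (Suc n)
      have "distinct (map g (concat xss))" using Cons.prems(1) by auto
      then show ?thesis using Cons.IH[of m n] Cons.prems(2-) Suc \<open>j = Suc m\<close> by simp
    qed
  qed
qed auto

text \<open>Since item numbers are distinct over all plans, different containers have disjoint
  contents and each packed item determines its container.\<close>

lemma container_slicing_imp_packed:
  assumes "\<epsilon> > 0" "valid_instance G"
    and ok: "\<And>c. c \<in> set (pieces C) \<Longrightarrow> plan_ok \<epsilon> (item_size G) c"
    and dist: "distinct (map fst (all_contents C))"
    and items: "fst ` set (all_contents C) \<subseteq> items G"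
    and fit: "\<And>d. extent plan_size d C \<le> real (side G)"
    and k: "length (pieces C) \<le> k"
  shows "\<exists>P. guillotine_container_packed \<epsilon> k G P \<and> profit P = length (all_contents C)"
proof -
  define n where "n = length (pieces C)"
  define spec where "spec = (\<lambda>j. pieces C ! j)"
  define I where "I = number 0 C"
  have mapI: "map_slicing spec I = C" unfolding I_def spec_def by (rule map_number) simp
  have pI: "pieces I = [0..<n]" by (simp add: I_def n_def pieces_number)
  have okI: "\<forall>j\<in>set (pieces I). plan_ok \<epsilon> (item_size G) (spec j)"
    using ok by (simp add: pI spec_def n_def)
  have pos: "item_size G d l > 0" if l: "l \<in> set (all_contents (map_slicing spec I))" for l d
  proof -
    have "fst l \<in> items G" using l items mapI by auto
    then show ?thesis using assms(2)
      by (auto simp: valid_instance_def item_size_def placed_size_def)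
  qed
  then have pos': "\<forall>l\<in>set (all_contents (map_slicing spec I)). \<forall>d. item_size G d l > 0" by blast
  let ?N = "real (side G)"
  obtain rc P where ex: "\<forall>j\<in>set (pieces I). proper_rect (rc j)"
    "guillotine_packing rc ((0, 0), (?N, ?N)) (set (pieces I))"
    "dom P = fst ` set (all_contents (map_slicing spec I))"
    "\<forall>i\<in>dom P. proper_rect (placed_rect G P i)"
    "guillotine_packing (placed_rect G P) ((0, 0), (?N, ?N)) (dom P)"
    "\<forall>j\<in>set (pieces I). fills \<epsilon> (fst (spec j), rc j) (placed_rect G P) (fst ` set (contents (spec j)))"
  proof -
    have "distinct (pieces I)" by (simp add: pI)
    moreover have "distinct (map fst (all_contents (map_slicing spec I)))" using dist mapI by simp
    moreover have "extent plan_size True (map_slicing spec I) \<le> ?N - 0"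
      "extent plan_size False (map_slicing spec I) \<le> ?N - 0" using fit mapI by simp_all
    ultimately have "\<exists>rc P. (\<forall>j\<in>set (pieces I). proper_rect (rc j)) \<and>
      guillotine_packing rc ((0, 0), (?N, ?N)) (set (pieces I)) \<and>
      dom P = fst ` set (all_contents (map_slicing spec I)) \<and>
      (\<forall>i\<in>dom P. proper_rect (placed_rect G P i)) \<and>
      guillotine_packing (placed_rect G P) ((0, 0), (?N, ?N)) (dom P) \<and>
      (\<forall>j\<in>set (pieces I). fills \<epsilon> (fst (spec j), rc j) (placed_rect G P) (fst ` set (contents (spec j))))"
      using place_container_slicing[OF assms(1) _ okI _ pos'] by simp
    then show thesis by (elim exE conjE) (rule that)
  qed
  have setI: "set (pieces I) = {..<n}" using pI by auto
  have rc: "\<And>j. j < n \<Longrightarrow> proper_rect (rc j)" "guillotine_packing rc (knapsack G) {..<n}"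
    using ex(1,2) setI by (simp_all add: knapsack_def)
  have P: "dom P = fst ` set (all_contents C)" "guillotine_packing (placed_rect G P) (knapsack G) (dom P)"
    using ex(3,5) mapI by (simp_all add: knapsack_def)
  have fl: "fills \<epsilon> (fst (spec j), rc j) (placed_rect G P) (fst ` set (contents (spec j)))" if "j < n" for j
    using ex(6) that setI by (simp del: fills.simps)
  define cs where "cs = map (\<lambda>j. (fst (spec j), rc j)) [0..<n]"
  define f where "f = (\<lambda>i. SOME j. j < n \<and> i \<in> fst ` set (contents (spec j)))"
  have disj: "fst ` set (contents (spec j)) \<inter> fst ` set (contents (spec k)) = {}"
    if "j < n" "k < n" "j \<noteq> k" for j k
    using distinct_concat_nth_disjoint[of fst "map contents (pieces C)" j k] dist that
    by (simp add: all_contents_def spec_def n_def)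
  have f: "f i = j" if "j < n" "i \<in> fst ` set (contents (spec j))" for i j
    unfolding f_def
  proof (rule some_equality)
    fix k assume "k < n \<and> i \<in> fst ` set (contents (spec k))"
    then show "k = j" using disj[of k j] that by blast
  qed (use that in simp)
  have cover: "\<exists>j<n. i \<in> fst ` set (contents (spec j))" if i: "i \<in> dom P" for i
  proof -
    obtain c l where "c \<in> set (pieces C)" "l \<in> set (contents c)" "i = fst l"
      using i P(1) by (auto simp: all_contents_def)
    moreover from this obtain j where "j < n" "c = spec j" by (auto simp: spec_def n_def in_set_conv_nth)
    ultimately show ?thesis by blast
  qed
  have fj: "{i \<in> dom P. f i = j} = fst ` set (contents (spec j))" if "j < n" for j
  proof
    show "{i \<in> dom P. f i = j} \<subseteq> fst ` set (contents (spec j))" using cover f by blast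
    have "spec j \<in> set (pieces C)" using that by (simp add: spec_def n_def)
    then have "set (contents (spec j)) \<subseteq> set (all_contents C)" by (auto simp: all_contents_def)
    then show "fst ` set (contents (spec j)) \<subseteq> {i \<in> dom P. f i = j}" using that f P(1) by blast
  qed
  have lcs: "length cs = n" by (simp add: cs_def)
  have nth: "cs ! j = (fst (spec j), rc j)" if "j < n" for j using that by (simp add: cs_def)
  have "guillotine_container_packed \<epsilon> k G P"
    unfolding guillotine_container_packed_def
  proof (intro conjI exI)
    show "feasible G P" using P items by (auto simp: feasible_def)
    show "length cs \<le> k" using k lcs n_def by simp
    show "\<forall>C\<in>set cs. rect_width (snd C) > 0 \<and> rect_height (snd C) > 0"
      using rc(1) by (auto simp: cs_def proper_rect_def)
    show "guillotine_packing (\<lambda>j. snd (cs ! j)) (knapsack G) {..<length cs}"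
      unfolding lcs using nth by (intro guillotine_packing_cong[OF rc(2)]) auto
    show "\<forall>i\<in>dom P. f i < length cs" using cover f lcs by auto
    show "\<forall>j<length cs. fills \<epsilon> (cs ! j) (placed_rect G P) {i \<in> dom P. f i = j}"
      using fl nth fj lcs by (simp del: fills.simps)
  qed
  moreover have "profit P = length (all_contents C)"
    unfolding profit_def P(1) using dist by (metis distinct_card length_map list.set_map)
  ultimately show ?thesis by blast
qed

section \<open>Freeing a strip among long items\<close>

text \<open>\<open>ori a\<close> is the direction in which \<open>a\<close> is thin, as
  \<open>long_thin\<close> makes precise: for \<open>True\<close> the item is tall and narrow. In a
  tree that is pure in direction \<open>d\<close>, a \<open>d\<close>-cut adds up thicknesses
  only.\<close>

definition pure :: "('a \<Rightarrow> bool) \<Rightarrow> bool \<Rightarrow> 'a slicing \<Rightarrow> bool" where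
  "pure ori d T \<longleftrightarrow> (\<forall>a\<in>set (pieces T). ori a = d)"

definition long_thin :: "(bool \<Rightarrow> 'a \<Rightarrow> real) \<Rightarrow> ('a \<Rightarrow> bool) \<Rightarrow> real \<Rightarrow> 'a \<Rightarrow> bool" where
  "long_thin s ori \<rho> a \<longleftrightarrow> 0 < s (ori a) a \<and> \<rho> \<le> s (\<not> ori a) a"

text \<open>In a slab whose items are all thin in direction \<open>d\<close>, the offset is the
  coordinate of the near edge of an item along \<open>d\<close>, counted from \<open>v\<close>, when
  \<open>A\<close> is placed before \<open>B\<close>.\<close>

primrec offsets_pure ::
    "(bool \<Rightarrow> 'a \<Rightarrow> real) \<Rightarrow> bool \<Rightarrow> real \<Rightarrow> 'a slicing \<Rightarrow> ('a \<times> real) slicing" where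
  "offsets_pure s d v Blank = Blank"
| "offsets_pure s d v (Piece a) = Piece (a, v)"
| "offsets_pure s d v (Cut c A B) =
     Cut c (offsets_pure s d v A) (offsets_pure s d (if c = d then v + extent s d A else v) B)"

text \<open>The offset of a piece is the total thickness of the slabs of its own orientation that are peeled
  off before it. Offsets restart at \<open>0\<close> below a cut that leaves pieces lying across it on both sides;
  such cuts are nested only boundedly often because both sides are at least \<open>\<rho>\<close> wide.\<close>

primrec offsets ::
    "(bool \<Rightarrow> 'a \<Rightarrow> real) \<Rightarrow> ('a \<Rightarrow> bool) \<Rightarrow> (bool \<Rightarrow> real) \<Rightarrow> 'a slicing \<Rightarrow> ('a \<times> real) slicing" where
  "offsets s ori u Blank = Blank"
| "offsets s ori u (Piece a) = Piece (a, u (ori a))"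
| "offsets s ori u (Cut d A B) =
     (if pure ori True (Cut d A B) then offsets_pure s True (u True) (Cut d A B)
      else if pure ori False (Cut d A B) then offsets_pure s False (u False) (Cut d A B)
      else if pure ori d A then
        Cut d (offsets_pure s d (u d) A) (offsets s ori (u(d := u d + extent s d A)) B)
      else if pure ori d B then
        Cut d (offsets s ori (u(d := u d + extent s d B)) A) (offsets_pure s d (u d) B)
      else Cut d (offsets s ori (\<lambda>_. 0) A) (offsets s ori (\<lambda>_. 0) B))"

lemma map_fst_offsets_pure [simp]: "map_slicing fst (offsets_pure s d v T) = T"
  by (induction T arbitrary: v) auto

lemma map_fst_offsets [simp]: "map_slicing fst (offsets s ori u T) = T"
  by (induction T arbitrary: u) auto

lemma extent_fst: "extent (\<lambda>d p. s d (fst p)) d T = extent s d (map_slicing fst T)"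
  by (simp add: extent_map)

lemma pieces_fst: "map fst (pieces T) = pieces (map_slicing fst T)"
  by simp

lemma offsets_pure_range:
  assumes "\<And>a. a \<in> set (pieces T) \<Longrightarrow> 0 \<le> s d a" "(a, x) \<in> set (pieces (offsets_pure s d v T))"
  shows "v \<le> x \<and> x + s d a \<le> v + extent s d T"
  using assms
proof (induction T arbitrary: v)
  case (Cut c A B)
  have A: "0 \<le> extent s d A" and B: "0 \<le> extent s d B"
    using Cut.prems(1) by (auto intro!: extent_nonneg)
  from Cut.prems(2) consider "(a, x) \<in> set (pieces (offsets_pure s d v A))"
    | "(a, x) \<in> set (pieces (offsets_pure s d (if c = d then v + extent s d A else v) B))" by auto
  then show ?case
  proof cases
    case 1
    then show ?thesis using Cut.IH(1)[of v] Cut.prems(1) B by auto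
  next
    case 2
    have "(if c = d then v + extent s d A else v) \<le> x \<and>
        x + s d a \<le> (if c = d then v + extent s d A else v) + extent s d B"
      using Cut.prems(1) 2 by (intro Cut.IH(2)) auto
    then show ?thesis using A by (auto split: if_splits)
  qed
qed auto

lemma extent_keep_offsets_le:
  assumes "\<And>a. a \<in> set (pieces T) \<Longrightarrow> 0 \<le> s d a" "map_slicing fst L = T"
  shows "extent (\<lambda>d p. s d (fst p)) d (keep P L) \<le> extent s d T"
proof -
  have "extent (\<lambda>d p. s d (fst p)) d (keep P L) \<le> extent (\<lambda>d p. s d (fst p)) d L"
    using assms by (intro extent_keep_le) force
  then show ?thesis using assms by (simp add: extent_fst)
qed

text \<open>What is kept starts at coordinate \<open>f\<close> or later, so the first
  \<open>f - v\<close> of the slab is empty. The outer \<open>max 0\<close> covers a slab that ends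
  before \<open>f\<close>.\<close>

lemma keep_offsets_pure_extent:
  assumes "\<And>a. a \<in> set (pieces T) \<Longrightarrow> 0 \<le> s d a"
  shows "extent (\<lambda>d p. s d (fst p)) d (keep (\<lambda>p. f \<le> snd p) (offsets_pure s d v T))
    \<le> max 0 (extent s d T - max 0 (f - v))"
  using assms
proof (induction T arbitrary: v)
  case (Cut c A B)
  have A: "0 \<le> extent s d A" and B: "0 \<le> extent s d B"
    using Cut.prems(1) by (auto intro!: extent_nonneg)
  have "\<And>a. a \<in> set (pieces A) \<Longrightarrow> 0 \<le> s d a" "\<And>a. a \<in> set (pieces B) \<Longrightarrow> 0 \<le> s d a"
    using Cut.prems by auto
  note IHA = Cut.IH(1)[OF this(1)] and IHB = Cut.IH(2)[OF this(2)]
  show ?case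
  proof (cases "c = d")
    case True
    have "extent (\<lambda>d p. s d (fst p)) d (keep (\<lambda>p. f \<le> snd p) (offsets_pure s d v A)) +
        extent (\<lambda>d p. s d (fst p)) d (keep (\<lambda>p. f \<le> snd p) (offsets_pure s d (v + extent s d A) B))
        \<le> max 0 (extent s d A + extent s d B - max 0 (f - v))"
      using IHA[of v] IHB[of "v + extent s d A"] A B by linarith
    then show ?thesis using True by simp
  next
    case False
    have "max (extent (\<lambda>d p. s d (fst p)) d (keep (\<lambda>p. f \<le> snd p) (offsets_pure s d v A)))
        (extent (\<lambda>d p. s d (fst p)) d (keep (\<lambda>p. f \<le> snd p) (offsets_pure s d v B)))
        \<le> max 0 (max (extent s d A) (extent s d B) - max 0 (f - v))"
      using IHA[of v] IHB[of v] A B by linarith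
    then show ?thesis using False by simp
  qed
qed auto

text \<open>A tree without pieces is pure in both directions, and \<open>offsets\<close> then
  prefers \<open>True\<close> at a cut; hence the direction \<open>d'\<close> need not be the given
  one.\<close>

lemma offsets_of_pure:
  assumes "pure ori d T"
  shows "\<exists>d'. pure ori d' T \<and> offsets s ori u T = offsets_pure s d' (u d') T"
proof (cases T)
  case (Cut c A B)
  show ?thesis
  proof (cases "pure ori True T")
    case True
    then have "offsets s ori u T = offsets_pure s True (u True) T" unfolding Cut by simp
    then show ?thesis using True by blast
  next
    case False
    then have "pure ori False T" using assms by (cases d) auto
    moreover from this have "offsets s ori u T = offsets_pure s False (u False) T"
      using False unfolding Cut by simp
    ultimately show ?thesis by blast
  qed
qed (use assms in \<open>auto simp: pure_def\<close>)

section \<open>Extents of what remains above a given offset\<close>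

lemma long_thin_nonneg: "long_thin s ori \<rho> a \<Longrightarrow> 0 < \<rho> \<Longrightarrow> 0 < s d a"
  by (cases "d = ori a") (auto simp: long_thin_def)

lemma impure_extent:
  assumes "\<And>a. a \<in> set (pieces T) \<Longrightarrow> long_thin s ori \<rho> a" "0 < \<rho>" "\<not> pure ori d T"
  shows "\<rho> \<le> extent s d T"
proof -
  obtain a where a: "a \<in> set (pieces T)" "ori a \<noteq> d" using assms(3) by (auto simp: pure_def)
  then have "d = (\<not> ori a)" by auto
  then have "\<rho> \<le> s d a" using assms(1)[OF a(1)] by (simp add: long_thin_def)
  also have "\<dots> \<le> extent s d T"
    using assms a long_thin_nonneg[of s ori \<rho>] by (intro extent_ge_piece) (auto intro: less_imp_le)
  finally show ?thesis .
qed

text \<open>Either the width or the height shrinks: across a balanced cut one side that shrinks in the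
  additive direction suffices, and otherwise both sides shrink in the other direction.\<close>

lemma keep_offsets_extent:
  assumes "\<forall>a\<in>set (pieces T). long_thin s ori \<rho> a" "0 < \<rho>" "0 \<le> f" "f \<le> \<rho>" "\<forall>d. 0 \<le> u d"
  shows "\<exists>d. extent (\<lambda>d p. s d (fst p)) d (keep (\<lambda>p. f \<le> snd p) (offsets s ori u T))
    \<le> max 0 (extent s d T - max 0 (f - u d))"
  using assms(1,5)
proof (induction T arbitrary: u)
  case Blank
  then show ?case by simp
next
  case (Piece a)
  then show ?case by (intro exI[of _ "ori a"]) (simp add: long_thin_def)
next
  case (Cut d A B)
  note prem1 = bspec[OF Cut.prems(1)] and prem2 = spec[OF Cut.prems(2)]
  let ?s = "\<lambda>d p. s d (fst p)" and ?k = "keep (\<lambda>p. f \<le> snd p)"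
  have pos: "0 < s e a" if "a \<in> set (pieces (Cut d A B))" for e a
    using prem1[OF that] assms(2) by (rule long_thin_nonneg)
  have posA: "\<And>a e. a \<in> set (pieces A) \<Longrightarrow> 0 \<le> s e a" and posB: "\<And>a e. a \<in> set (pieces B) \<Longrightarrow> 0 \<le> s e a"
    using pos by (auto intro: less_imp_le)
  have A: "0 \<le> extent s e A" and B: "0 \<le> extent s e B" for e
    using posA posB by (auto intro!: extent_nonneg)
  have ltA: "\<forall>a\<in>set (pieces A). long_thin s ori \<rho> a"
    and ltB: "\<forall>a\<in>set (pieces B). long_thin s ori \<rho> a" using prem1 by auto
  note IHA = Cut.IH(1)[OF ltA] and IHB = Cut.IH(2)[OF ltB]
  consider (pure) e where "pure ori e (Cut d A B)"
    | (peelA) "\<And>e. \<not> pure ori e (Cut d A B)" "pure ori d A"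
    | (peelB) "\<And>e. \<not> pure ori e (Cut d A B)" "\<not> pure ori d A" "pure ori d B"
    | (balanced) "\<And>e. \<not> pure ori e (Cut d A B)" "\<not> pure ori d A" "\<not> pure ori d B" by blast
  then show ?case
  proof cases
    case pure
    then obtain e where e: "pure ori e (Cut d A B)"
      "offsets s ori u (Cut d A B) = offsets_pure s e (u e) (Cut d A B)"
      using offsets_of_pure by blast
    have "extent ?s e (?k (offsets_pure s e (u e) (Cut d A B)))
        \<le> max 0 (extent s e (Cut d A B) - max 0 (f - u e))"
      using pos by (intro keep_offsets_pure_extent) (auto intro: less_imp_le)
    then show ?thesis unfolding e(2) by blast
  next
    case peelA
    have eq: "offsets s ori u (Cut d A B) =
        Cut d (offsets_pure s d (u d) A) (offsets s ori (u(d := u d + extent s d A)) B)"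
      using peelA by simp
    let ?LA = "?k (offsets_pure s d (u d) A)"
    let ?LB = "?k (offsets s ori (u(d := u d + extent s d A)) B)"
    have kA: "extent ?s d ?LA \<le> max 0 (extent s d A - max 0 (f - u d))"
      using posA by (intro keep_offsets_pure_extent)
    have kB: "extent ?s d ?LB \<le> extent s d B" using posB by (intro extent_keep_offsets_le) auto
    show ?thesis
    proof (cases "f \<le> u d + extent s d A")
      case True
      \<comment> \<open>The slab \<open>A\<close> reaches beyond \<open>f\<close>, so deleting its
        low part alone frees \<open>f - u d\<close>; \<open>B\<close> may keep its full
        extent.\<close>
      have "extent ?s d ?LA + extent ?s d ?LB \<le> max 0 (extent s d A + extent s d B - max 0 (f - u d))"
        using True kA kB A[of d] B[of d] by linarith
      then show ?thesis unfolding eq by (intro exI[of _ d]) simp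
    next
      case False
      \<comment> \<open>The slab ends before \<open>f\<close> and disappears. If the induction
        hypothesis shrinks \<open>B\<close> along \<open>d\<close>, the thickness of
        \<open>A\<close> makes up for the larger starting offset of \<open>B\<close>; if it shrinks
        \<open>B\<close> in the other direction, the empty \<open>A\<close> does not obstruct the
        maximum.\<close>
      have "pieces ?LA = []"
      proof (rule ccontr)
        assume "pieces ?LA \<noteq> []"
        then obtain a x where ax: "(a, x) \<in> set (pieces ?LA)" by (metis list.set_intros(1) neq_Nil_conv surj_pair)
        then have m: "(a, x) \<in> set (pieces (offsets_pure s d (u d) A))" by simp
        then have "x + s d a \<le> u d + extent s d A" using offsets_pure_range[of A s d] posA by blast
        moreover have "a \<in> set (pieces A)"
          using m pieces_fst[of "offsets_pure s d (u d) A"] by (metis fst_conv image_eqI list.set_map map_fst_offsets_pure)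
        ultimately show False using pos[of a d] ax False by auto
      qed
      then have LA0: "extent ?s e ?LA = 0" for e by (rule extent_no_pieces)
      have u': "\<forall>c. 0 \<le> (u(d := u d + extent s d A)) c" using prem2 A by simp
      obtain e where e: "extent ?s e ?LB \<le> max 0 (extent s e B - max 0 (f - (u(d := u d + extent s d A)) e))"
        using IHB[of "u(d := u d + extent s d A)", OF u'] by blast
      show ?thesis
      proof (cases "e = d")
        case True
        have "extent ?s d ?LB \<le> max 0 (extent s d B - max 0 (f - (u d + extent s d A)))"
          using e True by simp
        then have "extent ?s d ?LA + extent ?s d ?LB \<le> max 0 (extent s d A + extent s d B - max 0 (f - u d))"
          using LA0[of d] A[of d] B[of d] prem2[of d] False by linarith
        then show ?thesis unfolding eq by (intro exI[of _ d]) simp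
      next
        case ne: False
        have "extent ?s e ?LB \<le> max 0 (extent s e B - max 0 (f - u e))"
          using e ne by simp
        then have "max (extent ?s e ?LA) (extent ?s e ?LB) \<le> max 0 (max (extent s e A) (extent s e B) - max 0 (f - u e))"
          using LA0[of e] A[of e] B[of e] by linarith
        then show ?thesis unfolding eq using ne by (intro exI[of _ e]) simp
      qed
    qed
  next
    case peelB
    have eq: "offsets s ori u (Cut d A B) =
        Cut d (offsets s ori (u(d := u d + extent s d B)) A) (offsets_pure s d (u d) B)"
      using peelB by simp
    let ?LB = "?k (offsets_pure s d (u d) B)"
    let ?LA = "?k (offsets s ori (u(d := u d + extent s d B)) A)"
    have kB: "extent ?s d ?LB \<le> max 0 (extent s d B - max 0 (f - u d))"
      using posB by (intro keep_offsets_pure_extent)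
    have kA: "extent ?s d ?LA \<le> extent s d A" using posA by (intro extent_keep_offsets_le) auto
    show ?thesis
    proof (cases "f \<le> u d + extent s d B")
      case True
      have "extent ?s d ?LA + extent ?s d ?LB \<le> max 0 (extent s d A + extent s d B - max 0 (f - u d))"
        using True kA kB A[of d] B[of d] by linarith
      then show ?thesis unfolding eq by (intro exI[of _ d]) simp
    next
      case False
      have "pieces ?LB = []"
      proof (rule ccontr)
        assume "pieces ?LB \<noteq> []"
        then obtain a x where ax: "(a, x) \<in> set (pieces ?LB)" by (metis list.set_intros(1) neq_Nil_conv surj_pair)
        then have m: "(a, x) \<in> set (pieces (offsets_pure s d (u d) B))" by simp
        then have "x + s d a \<le> u d + extent s d B" using offsets_pure_range[of B s d] posB by blast
        moreover have "a \<in> set (pieces B)"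
          using m pieces_fst[of "offsets_pure s d (u d) B"] by (metis fst_conv image_eqI list.set_map map_fst_offsets_pure)
        ultimately show False using pos[of a d] ax False by auto
      qed
      then have LB0: "extent ?s e ?LB = 0" for e by (rule extent_no_pieces)
      have u': "\<forall>c. 0 \<le> (u(d := u d + extent s d B)) c" using prem2 B by simp
      obtain e where e: "extent ?s e ?LA \<le> max 0 (extent s e A - max 0 (f - (u(d := u d + extent s d B)) e))"
        using IHA[of "u(d := u d + extent s d B)", OF u'] by blast
      show ?thesis
      proof (cases "e = d")
        case True
        have "extent ?s d ?LA \<le> max 0 (extent s d A - max 0 (f - (u d + extent s d B)))"
          using e True by simp
        then have "extent ?s d ?LA + extent ?s d ?LB \<le> max 0 (extent s d A + extent s d B - max 0 (f - u d))"
          using LB0[of d] A[of d] B[of d] prem2[of d] False by linarith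
        then show ?thesis unfolding eq by (intro exI[of _ d]) simp
      next
        case ne: False
        have "extent ?s e ?LA \<le> max 0 (extent s e A - max 0 (f - u e))"
          using e ne by simp
        then have "max (extent ?s e ?LA) (extent ?s e ?LB) \<le> max 0 (max (extent s e A) (extent s e B) - max 0 (f - u e))"
          using LB0[of e] A[of e] B[of e] by linarith
        then show ?thesis unfolding eq using ne by (intro exI[of _ e]) simp
      qed
    qed
  next
    case balanced
    have eq: "offsets s ori u (Cut d A B) = Cut d (offsets s ori (\<lambda>_. 0) A) (offsets s ori (\<lambda>_. 0) B)"
      using balanced by simp
    let ?LA = "?k (offsets s ori (\<lambda>_. 0) A)" and ?LB = "?k (offsets s ori (\<lambda>_. 0) B)"
    \<comment> \<open>A side of a balanced cut is at least \<rho>, hence at least \<open>f\<close>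
      wide, so when it shrinks along \<open>d\<close> it shrinks by the full \<open>f\<close> and is
      not truncated at 0.\<close>
    have rA: "\<rho> \<le> extent s d A" using balanced ltA assms(2) by (intro impure_extent) auto
    have rB: "\<rho> \<le> extent s d B" using balanced ltB assms(2) by (intro impure_extent) auto
    have kA: "extent ?s d ?LA \<le> extent s d A" using posA by (intro extent_keep_offsets_le) auto
    have kB: "extent ?s d ?LB \<le> extent s d B" using posB by (intro extent_keep_offsets_le) auto
    obtain e1 where e1: "extent ?s e1 ?LA \<le> max 0 (extent s e1 A - max 0 (f - 0))"
      using IHA[of "\<lambda>_. 0"] by auto
    obtain e2 where e2: "extent ?s e2 ?LB \<le> max 0 (extent s e2 B - max 0 (f - 0))"
      using IHB[of "\<lambda>_. 0"] by auto
    consider "e1 = d" | "e2 = d" | "e1 = (\<not> d)" "e2 = (\<not> d)" by auto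
    then show ?thesis
    proof cases
      case 1
      have "extent ?s d ?LA + extent ?s d ?LB \<le> max 0 (extent s d A + extent s d B - max 0 (f - u d))"
        using e1[unfolded 1] kB rA assms(3,4) prem2[of d] A[of d] B[of d] by linarith
      then show ?thesis unfolding eq by (intro exI[of _ d]) simp
    next
      case 2
      have "extent ?s d ?LA + extent ?s d ?LB \<le> max 0 (extent s d A + extent s d B - max 0 (f - u d))"
        using e2[unfolded 2] kA rB assms(3,4) prem2[of d] A[of d] B[of d] by linarith
      then show ?thesis unfolding eq by (intro exI[of _ d]) simp
    next
      case 3
      have "max (extent ?s (\<not> d) ?LA) (extent ?s (\<not> d) ?LB) \<le> max 0 (max (extent s (\<not> d) A) (extent s (\<not> d) B) - max 0 (f - u (\<not> d)))"
        using e1[unfolded 3(1)] e2[unfolded 3(2)] assms(3) prem2[of "\<not> d"] A[of "\<not> d"] B[of "\<not> d"]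
        by linarith
      then show ?thesis unfolding eq by (intro exI[of _ "\<not> d"]) simp
    qed
  qed
qed

text \<open>The recursion behind the bound on the number of nested balanced cuts.\<close>

lemma balanced_growth:
  assumes "0 < \<rho>" "\<rho> \<le> extent s d A" "\<rho> \<le> extent s d B" "\<And>e. 0 \<le> extent s e A" "\<And>e. 0 \<le> extent s e B"
  shows "2 + 4 powr ((extent s True A + extent s False A) / \<rho>) +
      4 powr ((extent s True B + extent s False B) / \<rho>)
    \<le> 4 powr ((extent s True (Cut d A B) + extent s False (Cut d A B)) / \<rho>)"
proof -
  define S where "S = extent s True (Cut d A B) + extent s False (Cut d A B)"
  have SA: "extent s True A + extent s False A \<le> S - \<rho>"
    unfolding S_def using assms by (cases d) (auto intro: add_mono)
  have SB: "extent s True B + extent s False B \<le> S - \<rho>"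
    unfolding S_def using assms by (cases d) (auto intro: add_mono)
  have "S = extent s d (Cut d A B) + extent s (\<not> d) (Cut d A B)"
    by (cases d) (simp_all add: S_def add.commute)
  moreover have "0 \<le> extent s (\<not> d) (Cut d A B)" using assms(4)[of "\<not> d"] by (simp add: le_max_iff_disj)
  ultimately have S2: "2 * \<rho> \<le> S" using assms by simp
  \<comment> \<open>Either side lacks at least \<rho> of the combined extent, which is a factor 4 in
    the bound. The two sides use at most half of it; the other half is at least 8 and covers the
    summand 2.\<close>
  have q: "4 powr ((S - \<rho>) / \<rho>) = 4 powr (S / \<rho>) / 4"
    using assms(1) by (simp add: diff_divide_distrib powr_diff)
  have "4 powr ((extent s True A + extent s False A) / \<rho>) \<le> 4 powr (S / \<rho>) / 4"
    unfolding q[symmetric] using SA assms(1) by (intro powr_mono divide_right_mono) auto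
  moreover have "4 powr ((extent s True B + extent s False B) / \<rho>) \<le> 4 powr (S / \<rho>) / 4"
    unfolding q[symmetric] using SB assms(1) by (intro powr_mono divide_right_mono) auto
  moreover have "4 powr 2 \<le> 4 powr (S / \<rho>)"
    using S2 assms(1) by (intro powr_mono) (auto simp: field_simps)
  ultimately show ?thesis unfolding S_def[symmetric] by simp
qed

section \<open>Thickness of the items peeled off early\<close>

definition low_thickness ::
    "(bool \<Rightarrow> 'a \<Rightarrow> real) \<Rightarrow> ('a \<Rightarrow> bool) \<Rightarrow> real \<Rightarrow> ('a \<times> real) slicing \<Rightarrow> real" where
  "low_thickness s ori e L =
     (\<Sum>p\<leftarrow>filter (\<lambda>p. snd p + s (ori (fst p)) (fst p) \<le> e) (pieces L). s (ori (fst p)) (fst p))"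

lemma low_thickness_Cut [simp]:
  "low_thickness s ori e (Cut d A B) = low_thickness s ori e A + low_thickness s ori e B"
  by (simp add: low_thickness_def)

text \<open>An area argument: items ending by \<open>e\<close> have length at least \<rho> and lie
  in the part of the slab between \<open>v\<close> and \<open>e\<close>, whose area is at most the
  right-hand side.\<close>

lemma low_thickness_pure:
  assumes "\<And>a. a \<in> set (pieces T) \<Longrightarrow> long_thin s ori \<rho> a" "0 < \<rho>" "pure ori d T"
  shows "low_thickness s ori e (offsets_pure s d v T) * \<rho>
    \<le> extent s (\<not> d) T * min (extent s d T) (max 0 (e - v))"
  using assms(1,3)
proof (induction T arbitrary: v)
  case Blank
  then show ?case by (simp add: low_thickness_def)
next
  case (Piece a)
  then have a: "ori a = d" "0 < s d a" "\<rho> \<le> s (\<not> d) a" by (auto simp: pure_def long_thin_def)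
  have "s d a * \<rho> \<le> s (\<not> d) a * s d a" using a by simp
  then show ?case using a assms(2) by (auto simp: low_thickness_def min_def max_def)
next
  case (Cut c A B)
  have pos: "0 \<le> s e a" if "a \<in> set (pieces (Cut c A B))" for e a
    using long_thin_nonneg[OF Cut.prems(1)[OF that] assms(2)] by (rule less_imp_le)
  have A: "0 \<le> extent s e A" and B: "0 \<le> extent s e B" for e
    using pos by (auto intro!: extent_nonneg)
  have pA: "pure ori d A" and pB: "pure ori d B" using Cut.prems(2) by (auto simp: pure_def)
  define mA where "mA = min (extent s d A) (max 0 (e - v))"
  define v' where "v' = (if c = d then v + extent s d A else v)"
  define mB where "mB = min (extent s d B) (max 0 (e - v'))"
  have mnn: "0 \<le> mA" "0 \<le> mB" using A B by (auto simp: mA_def mB_def)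
  have iA: "low_thickness s ori e (offsets_pure s d v A) * \<rho> \<le> extent s (\<not> d) A * mA"
    unfolding mA_def using Cut.prems(1) pA by (intro Cut.IH(1)) auto
  have iB: "low_thickness s ori e (offsets_pure s d v' B) * \<rho> \<le> extent s (\<not> d) B * mB"
    unfolding mB_def using Cut.prems(1) pB by (intro Cut.IH(2)) auto
  have "low_thickness s ori e (offsets_pure s d v (Cut c A B)) * \<rho>
      \<le> extent s (\<not> d) A * mA + extent s (\<not> d) B * mB"
    using iA iB by (simp add: v'_def distrib_right)
  also have "\<dots> \<le> extent s (\<not> d) (Cut c A B) * min (extent s d (Cut c A B)) (max 0 (e - v))"
  proof (cases "c = d")
    case True
    have "extent s (\<not> d) A * mA + extent s (\<not> d) B * mB \<le>
        extent s (\<not> d) (Cut c A B) * mA + extent s (\<not> d) (Cut c A B) * mB"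
      using True mnn by (intro add_mono mult_right_mono) auto
    also have "\<dots> = extent s (\<not> d) (Cut c A B) * (mA + mB)" by (simp add: distrib_left)
    also have "mA + mB = min (extent s d (Cut c A B)) (max 0 (e - v))"
      using True A[of d] B[of d] by (auto simp: mA_def mB_def v'_def min_def max_def)
    finally show ?thesis .
  next
    case False
    then have eq: "extent s (\<not> d) (Cut c A B) = extent s (\<not> d) A + extent s (\<not> d) B"
      "extent s d (Cut c A B) = max (extent s d A) (extent s d B)" by auto
    have "mA \<le> min (extent s d (Cut c A B)) (max 0 (e - v))" "mB \<le> min (extent s d (Cut c A B)) (max 0 (e - v))"
      unfolding eq(2) using False by (auto simp: mA_def mB_def v'_def)
    then show ?thesis unfolding eq(1) distrib_right using A B by (intro add_mono mult_left_mono) auto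
  qed
  finally show ?case .
qed

text \<open>Until the next balanced cut, each orientation has a budget \<open>e - u d\<close> of
  depth, and extents at most 1 turn depth into area. A balanced cut opens fresh budgets
  \<open>e\<close> for both orientations on both sides, \<open>4 * e\<close> in all, which the
  potential of \<open>balanced_growth\<close> pays for.\<close>

lemma low_thickness_offsets:
  assumes "\<forall>a\<in>set (pieces T). long_thin s ori \<rho> a" "0 < \<rho>" "0 \<le> e"
    and "\<forall>d. extent s d T \<le> 1" "\<forall>d. 0 \<le> u d"
  shows "low_thickness s ori e (offsets s ori u T) * \<rho> \<le> max 0 (e - u True) + max 0 (e - u False) +
    2 * e * 4 powr ((extent s True T + extent s False T) / \<rho>)"
  using assms(1,4,5)
proof (induction T arbitrary: u)
  case Blank
  then show ?case using assms(3) by (simp add: low_thickness_def)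
next
  case (Piece a)
  have "pure ori (ori a) (Piece a)" by (simp add: pure_def)
  from low_thickness_pure[OF bspec[OF Piece.prems(1)] assms(2) this, of e "u (ori a)"]
  have "low_thickness s ori e (offsets s ori u (Piece a)) * \<rho> \<le>
      extent s (\<not> ori a) (Piece a) * min (extent s (ori a) (Piece a)) (max 0 (e - u (ori a)))" by simp
  also have "\<dots> \<le> 1 * max 0 (e - u (ori a))"
    using Piece.prems(1) spec[OF Piece.prems(2), of "\<not> ori a"] by (intro mult_mono) (auto simp: long_thin_def)
  also have "\<dots> \<le> max 0 (e - u True) + max 0 (e - u False)" by (cases "ori a") auto
  finally show ?case using assms(3) by (smt (verit) mult_nonneg_nonneg powr_ge_zero)
next
  case (Cut d A B)
  note prem1 = bspec[OF Cut.prems(1)] and prem2 = spec[OF Cut.prems(2)] and prem3 = spec[OF Cut.prems(3)]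
  let ?lo = "low_thickness s ori e"
  let ?g = "\<lambda>T. 4 powr ((extent s True T + extent s False T) / \<rho>)"
  have pos: "0 \<le> s e a" if "a \<in> set (pieces (Cut d A B))" for e a
    using long_thin_nonneg[OF prem1[OF that] assms(2)] by (rule less_imp_le)
  have A: "0 \<le> extent s e A" and B: "0 \<le> extent s e B" for e
    using pos by (auto intro!: extent_nonneg)
  have leA: "extent s c A \<le> extent s c (Cut d A B)" and leB: "extent s c B \<le> extent s c (Cut d A B)" for c
    using A B by auto
  have A1: "extent s c A \<le> 1" and B1: "extent s c B \<le> 1" for c
    using leA[of c] leB[of c] prem2[of c] by linarith+
  have ltA: "\<forall>a\<in>set (pieces A). long_thin s ori \<rho> a"
    and ltB: "\<forall>a\<in>set (pieces B). long_thin s ori \<rho> a" using prem1 by auto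
  note IHA = Cut.IH(1)[OF ltA allI[OF A1]] and IHB = Cut.IH(2)[OF ltB allI[OF B1]]
  have gA: "2 * e * ?g A \<le> 2 * e * ?g (Cut d A B)"
    using leA[of True] leA[of False] assms(2,3) by (intro mult_left_mono powr_mono divide_right_mono) auto
  have gB: "2 * e * ?g B \<le> 2 * e * ?g (Cut d A B)"
    using leB[of True] leB[of False] assms(2,3) by (intro mult_left_mono powr_mono divide_right_mono) auto
  consider (pure) c where "pure ori c (Cut d A B)"
    | (peelA) "\<And>e. \<not> pure ori e (Cut d A B)" "pure ori d A"
    | (peelB) "\<And>e. \<not> pure ori e (Cut d A B)" "\<not> pure ori d A" "pure ori d B"
    | (balanced) "\<And>e. \<not> pure ori e (Cut d A B)" "\<not> pure ori d A" "\<not> pure ori d B" by blast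
  then show ?case
  proof cases
    case pure
    then obtain c where c: "pure ori c (Cut d A B)"
      "offsets s ori u (Cut d A B) = offsets_pure s c (u c) (Cut d A B)"
      using offsets_of_pure by blast
    have "?lo (offsets_pure s c (u c) (Cut d A B)) * \<rho>
        \<le> extent s (\<not> c) (Cut d A B) * min (extent s c (Cut d A B)) (max 0 (e - u c))"
      using prem1 assms(2) c(1) by (rule low_thickness_pure)
    also have "\<dots> \<le> 1 * max 0 (e - u c)"
      using prem2[of "\<not> c"] pos by (intro mult_mono) (auto intro!: extent_nonneg simp del: extent.simps)
    also have "\<dots> \<le> max 0 (e - u True) + max 0 (e - u False)" by (cases c) auto
    finally show ?thesis unfolding c(2) using assms(3) by (smt (verit) mult_nonneg_nonneg powr_ge_zero)
  next
    case peelA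
    let ?u = "u(d := u d + extent s d A)"
    have u': "\<forall>c. 0 \<le> ?u c" using prem3 A by simp
    have eq: "offsets s ori u (Cut d A B) = Cut d (offsets_pure s d (u d) A) (offsets s ori ?u B)"
      using peelA by simp
    have "?lo (offsets_pure s d (u d) A) * \<rho> \<le> extent s (\<not> d) A * min (extent s d A) (max 0 (e - u d))"
      using bspec[OF ltA] assms(2) peelA(2) by (rule low_thickness_pure)
    also have "\<dots> \<le> 1 * min (extent s d A) (max 0 (e - u d))"
      using A1 A by (intro mult_right_mono) auto
    finally have "?lo (offsets_pure s d (u d) A) * \<rho> \<le> min (extent s d A) (max 0 (e - u d))" by simp
    moreover have "?lo (offsets s ori ?u B) * \<rho> \<le> max 0 (e - ?u True) + max 0 (e - ?u False) + 2 * e * ?g B"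
      using u' by (rule IHB)
    \<comment> \<open>The budget of direction \<open>d\<close> splits exactly: the slab
      \<open>A\<close> uses \<open>min (extent s d A) (max 0 (e - u d))\<close>, and the raised
      offset leaves the remainder to \<open>B\<close>.\<close>
    moreover have "max 0 (e - ?u True) + max 0 (e - ?u False) + min (extent s d A) (max 0 (e - u d))
        = max 0 (e - u True) + max 0 (e - u False)"
      using A[of d] by (cases d) (auto simp: max_def min_def)
    ultimately show ?thesis unfolding eq low_thickness_Cut distrib_right using gB by linarith
  next
    case peelB
    let ?u = "u(d := u d + extent s d B)"
    have u': "\<forall>c. 0 \<le> ?u c" using prem3 B by simp
    have eq: "offsets s ori u (Cut d A B) = Cut d (offsets s ori ?u A) (offsets_pure s d (u d) B)"
      using peelB by simp
    have "?lo (offsets_pure s d (u d) B) * \<rho> \<le> extent s (\<not> d) B * min (extent s d B) (max 0 (e - u d))"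
      using bspec[OF ltB] assms(2) peelB(3) by (rule low_thickness_pure)
    also have "\<dots> \<le> 1 * min (extent s d B) (max 0 (e - u d))"
      using B1 B by (intro mult_right_mono) auto
    finally have "?lo (offsets_pure s d (u d) B) * \<rho> \<le> min (extent s d B) (max 0 (e - u d))" by simp
    moreover have "?lo (offsets s ori ?u A) * \<rho> \<le> max 0 (e - ?u True) + max 0 (e - ?u False) + 2 * e * ?g A"
      using u' by (rule IHA)
    moreover have "max 0 (e - ?u True) + max 0 (e - ?u False) + min (extent s d B) (max 0 (e - u d))
        = max 0 (e - u True) + max 0 (e - u False)"
      using B[of d] by (cases d) (auto simp: max_def min_def)
    ultimately show ?thesis unfolding eq low_thickness_Cut distrib_right using gA by linarith
  next
    case balanced
    have eq: "offsets s ori u (Cut d A B) = Cut d (offsets s ori (\<lambda>_. 0) A) (offsets s ori (\<lambda>_. 0) B)"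
      using balanced by simp
    have rA: "\<rho> \<le> extent s d A" using balanced ltA assms(2) by (intro impure_extent) auto
    have rB: "\<rho> \<le> extent s d B" using balanced ltB assms(2) by (intro impure_extent) auto
    have "2 + ?g A + ?g B \<le> ?g (Cut d A B)"
      using rA rB A B assms(2) by (intro balanced_growth) auto
    then have "2 * e * (2 + ?g A + ?g B) \<le> 2 * e * ?g (Cut d A B)" using assms(3) by (intro mult_left_mono) auto
    then have key: "4 * e + 2 * e * ?g A + 2 * e * ?g B \<le> 2 * e * ?g (Cut d A B)" by (simp add: algebra_simps)
    have "?lo (offsets s ori (\<lambda>_. 0) A) * \<rho> \<le> 2 * e + 2 * e * ?g A"
      using IHA[of "\<lambda>_. 0"] assms(3) by simp
    moreover have "?lo (offsets s ori (\<lambda>_. 0) B) * \<rho> \<le> 2 * e + 2 * e * ?g B"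
      using IHB[of "\<lambda>_. 0"] assms(3) by simp
    ultimately show ?thesis unfolding eq low_thickness_Cut distrib_right using key by linarith
  qed
qed

section \<open>Few slots suffice for finitely many lengths\<close>

text \<open>A slot \<open>(g, t)\<close> has thickness \<open>t\<close>; its type \<open>g\<close> fixes its orientation \<open>fst g\<close> and its length.\<close>

type_synonym slot = "(bool \<times> nat) \<times> real"

definition slot_size :: "(bool \<times> nat \<Rightarrow> real) \<Rightarrow> bool \<Rightarrow> slot \<Rightarrow> real" where
  "slot_size len d p = (if d = fst (fst p) then snd p else len (fst p))"

definition slot_total :: "slot slicing \<Rightarrow> bool \<times> nat \<Rightarrow> real" where
  "slot_total T g = (\<Sum>p\<leftarrow>pieces T. if fst p = g then snd p else 0)"

lemma slot_total_simps [simp]: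
  "slot_total Blank g = 0"
  "slot_total (Piece p) g = (if fst p = g then snd p else 0)"
  "slot_total (Cut d A B) g = slot_total A g + slot_total B g"
  by (simp_all add: slot_total_def)

definition slots_over :: "(bool \<times> nat) set \<Rightarrow> slot slicing \<Rightarrow> bool" where
  "slots_over \<Gamma> T \<longleftrightarrow> (\<forall>p\<in>set (pieces T). fst p \<in> \<Gamma> \<and> 0 \<le> snd p)"

lemma slots_over_simps [simp]:
  "slots_over \<Gamma> Blank"
  "slots_over \<Gamma> (Piece p) \<longleftrightarrow> fst p \<in> \<Gamma> \<and> 0 \<le> snd p"
  "slots_over \<Gamma> (Cut d A B) \<longleftrightarrow> slots_over \<Gamma> A \<and> slots_over \<Gamma> B"
  by (auto simp: slots_over_def)

lemma slot_extent_nonneg: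
  assumes "slots_over \<Gamma> T" "\<forall>g\<in>\<Gamma>. 0 \<le> len g"
  shows "0 \<le> extent (slot_size len) d T"
  using assms by (intro extent_nonneg) (auto simp: slots_over_def slot_size_def)

lemma sum_list_product:
  "(\<Sum>p\<leftarrow>List.product xs ys. f (fst p) (snd p)) = (\<Sum>x\<leftarrow>xs. \<Sum>y\<leftarrow>ys. f x (y :: 'b) :: real)"
  by (induction xs) (simp_all add: comp_def)

lemma count_list_append: "count_list (xs @ ys) g = count_list xs g + count_list ys g"
  by (induction xs) auto

text \<open>A column \<open>(w, c)\<close> is a stack of slots of types \<open>c\<close> and of common thickness \<open>w\<close>.\<close>

lemma pure_columns:
  assumes "\<forall>g\<in>\<Gamma>. 0 \<le> len g" "slots_over \<Gamma> T" "\<forall>p\<in>set (pieces T). fst (fst p) = d"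
  shows "\<exists>xs :: (real \<times> (bool \<times> nat) list) list.
    (\<forall>x\<in>set xs. 0 \<le> fst x \<and> set (snd x) \<subseteq> \<Gamma> \<inter> {g. fst g = d} \<and>
       sum_list (map len (snd x)) \<le> extent (slot_size len) (\<not> d) T) \<and>
    sum_list (map fst xs) \<le> extent (slot_size len) d T \<and>
    (\<forall>g. (\<Sum>x\<leftarrow>xs. fst x * real (count_list (snd x) g)) = slot_total T g)"
  using assms(2,3)
proof (induction T)
  case Blank
  then show ?case by (intro exI[of _ "[]"]) simp
next
  case (Piece p)
  then show ?case by (intro exI[of _ "[(snd p, [fst p])]"]) (auto simp: slot_size_def prod_eq_iff)
next
  case (Cut c A B)
  let ?e = "extent (slot_size len)"
  have oA: "slots_over \<Gamma> A" "\<forall>p\<in>set (pieces A). fst (fst p) = d"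
    and oB: "slots_over \<Gamma> B" "\<forall>p\<in>set (pieces B). fst (fst p) = d"
    using Cut.prems by auto
  have A: "0 \<le> ?e e A" and B: "0 \<le> ?e e B" for e
    using oA oB assms(1) by (auto intro: slot_extent_nonneg)
  obtain xs where xs: "\<forall>x\<in>set xs. 0 \<le> fst x \<and> set (snd x) \<subseteq> \<Gamma> \<inter> {g. fst g = d} \<and>
       sum_list (map len (snd x)) \<le> ?e (\<not> d) A"
    "sum_list (map fst xs) \<le> ?e d A"
    "\<forall>g. (\<Sum>x\<leftarrow>xs. fst x * real (count_list (snd x) g)) = slot_total A g"
    using Cut.IH(1)[OF oA] by blast
  obtain ys where ys: "\<forall>x\<in>set ys. 0 \<le> fst x \<and> set (snd x) \<subseteq> \<Gamma> \<inter> {g. fst g = d} \<and>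
       sum_list (map len (snd x)) \<le> ?e (\<not> d) B"
    "sum_list (map fst ys) \<le> ?e d B"
    "\<forall>g. (\<Sum>x\<leftarrow>ys. fst x * real (count_list (snd x) g)) = slot_total B g"
    using Cut.IH(2)[OF oB] by blast
  show ?case
  proof (cases "c = d")
    case True
    have "sum_list (map len (snd x)) \<le> ?e (\<not> d) (Cut c A B)" if "x \<in> set (xs @ ys)" for x
      using that xs(1) ys(1) True by (auto simp: le_max_iff_disj)
    then show ?thesis using xs ys True by (intro exI[of _ "xs @ ys"]) auto
  next
    case False
    define W where "W = ?e d (Cut c A B)"
    have W: "W = max (?e d A) (?e d B)" using False by (simp add: W_def)
    have ext: "?e (\<not> d) (Cut c A B) = ?e (\<not> d) A + ?e (\<not> d) B" using False by auto
    \<comment> \<open>An empty column pads each list to total width exactly \<open>W\<close>, so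
      that widths divided by \<open>W\<close> are probabilities. The product list may be long, but
      later only the number of distinct stacks counts.\<close>
    define xs' where "xs' = (W - sum_list (map fst xs), []) # xs"
    define ys' where "ys' = (W - sum_list (map fst ys), []) # ys"
    have sx: "sum_list (map fst xs') = W" and sy: "sum_list (map fst ys') = W"
      by (simp_all add: xs'_def ys'_def)
    have cx: "(\<Sum>x\<leftarrow>xs'. fst x * real (count_list (snd x) g)) = slot_total A g"
      and cy: "(\<Sum>x\<leftarrow>ys'. fst x * real (count_list (snd x) g)) = slot_total B g" for g
      using spec[OF xs(3), of g] spec[OF ys(3), of g] by (simp_all add: xs'_def ys'_def)
    have px: "\<forall>x\<in>set xs'. 0 \<le> fst x \<and> set (snd x) \<subseteq> \<Gamma> \<inter> {g. fst g = d} \<and>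
       sum_list (map len (snd x)) \<le> ?e (\<not> d) A"
      using xs(1,2) W A by (auto simp: xs'_def)
    have py: "\<forall>x\<in>set ys'. 0 \<le> fst x \<and> set (snd x) \<subseteq> \<Gamma> \<inter> {g. fst g = d} \<and>
       sum_list (map len (snd x)) \<le> ?e (\<not> d) B"
      using ys(1,2) W B by (auto simp: ys'_def)
    \<comment> \<open>overlay the two column lists as independent random columns\<close>
    define zs where "zs = map (\<lambda>(x, y). (fst x * fst y / W, snd x @ snd y)) (List.product xs' ys')"
    have W0: "0 \<le> W" using A[of d] W by simp
    have pz: "\<forall>x\<in>set zs. 0 \<le> fst x \<and> set (snd x) \<subseteq> \<Gamma> \<inter> {g. fst g = d} \<and>
       sum_list (map len (snd x)) \<le> ?e (\<not> d) (Cut c A B)"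
      unfolding ext using px py W0 by (fastforce simp: zs_def intro: add_mono)
    have sz: "sum_list (map fst zs) \<le> W"
    proof -
      have "sum_list (map fst zs) = (\<Sum>p\<leftarrow>List.product xs' ys'. fst (fst p) * fst (snd p) / W)"
        by (simp add: zs_def comp_def case_prod_beta)
      also have "\<dots> = (\<Sum>x\<leftarrow>xs'. \<Sum>y\<leftarrow>ys'. fst x * fst y / W)" by (rule sum_list_product)
      also have "\<dots> = (\<Sum>x\<leftarrow>xs'. fst x / W * sum_list (map fst ys'))"
        by (simp add: sum_list_const_mult[symmetric])
      also have "\<dots> = (\<Sum>x\<leftarrow>xs'. fst x * (W / W))" by (simp add: sy)
      also have "\<dots> = sum_list (map fst xs') * (W / W)" by (rule sum_list_mult_const)
      also have "\<dots> \<le> W" using sx W0 by (cases "W = 0") simp_all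
      finally show ?thesis .
    qed
    have tz: "(\<Sum>x\<leftarrow>zs. fst x * real (count_list (snd x) g)) = slot_total (Cut c A B) g" for g
    proof (cases "W = 0")
      case True
      \<comment> \<open>With \<open>W = 0\<close> the quotients by \<open>W\<close> are 0 by
        convention; nothing is lost, since all columns then have width 0 and the totals
        vanish.\<close>
      have z: "(\<Sum>x\<leftarrow>us. fst x * real (count_list (snd x) g)) = 0"
        if "sum_list (map fst us) = 0" "\<forall>x\<in>set us. 0 \<le> fst x" for us :: "(real \<times> (bool \<times> nat) list) list"
      proof -
        have "\<forall>x\<in>set us. fst x = 0"
          using that sum_list_nonneg_eq_0_iff[of "map fst us"] by auto
        then show ?thesis by (simp add: map_idI cong: map_cong)
      qed
      have "slot_total A g = 0" "slot_total B g = 0"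
        using z[of xs'] z[of ys'] cx cy sx sy px py True by auto
      moreover have "(\<Sum>x\<leftarrow>zs. fst x * real (count_list (snd x) g)) = 0"
        using True by (simp add: zs_def comp_def case_prod_beta)
      ultimately show ?thesis by simp
    next
      case False
      have "(\<Sum>x\<leftarrow>zs. fst x * real (count_list (snd x) g)) =
          (\<Sum>p\<leftarrow>List.product xs' ys'. fst (fst p) * fst (snd p) / W *
            real (count_list (snd (fst p) @ snd (snd p)) g))"
        by (simp add: zs_def comp_def case_prod_beta)
      also have "\<dots> = (\<Sum>x\<leftarrow>xs'. \<Sum>y\<leftarrow>ys'. fst x * fst y / W * real (count_list (snd x @ snd y) g))"
        by (rule sum_list_product)
      also have "\<dots> = (\<Sum>x\<leftarrow>xs'. \<Sum>y\<leftarrow>ys'. (fst x * real (count_list (snd x) g) / W) * fst y +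
          (fst x / W) * (fst y * real (count_list (snd y) g)))"
        by (simp add: count_list_append algebra_simps)
      also have "\<dots> = (\<Sum>x\<leftarrow>xs'. (fst x * real (count_list (snd x) g) / W) * W + (fst x / W) * slot_total B g)"
        by (simp only: sum_list_addf sum_list_const_mult sy cy)
      also have "\<dots> = (\<Sum>x\<leftarrow>xs'. fst x * real (count_list (snd x) g) + fst x * (slot_total B g / W))"
        using False by simp
      also have "\<dots> = slot_total A g + W * (slot_total B g / W)"
        by (simp only: sum_list_addf sum_list_mult_const cx sx)
      also have "\<dots> = slot_total (Cut c A B) g" using False by simp
      finally show ?thesis .
    qed
    show ?thesis using pz sz tz unfolding W_def by blast
  qed
qed

section \<open>Nested columns as a normal form\<close>

definition column :: "bool \<Rightarrow> (bool \<times> nat) list \<Rightarrow> real \<Rightarrow> slot slicing" where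
  "column d c w = foldr (\<lambda>g T. Cut (\<not> d) (Piece (g, w)) T) c Blank"

lemma column_simps [simp]:
  "column d [] w = Blank"
  "column d (g # c) w = Cut (\<not> d) (Piece (g, w)) (column d c w)"
  by (simp_all add: column_def)

lemma extent_column_across:
  "\<forall>g\<in>set c. fst g = d \<Longrightarrow> 0 \<le> w \<Longrightarrow>
    extent (slot_size len) d (column d c w) = (if c = [] then 0 else w)"
  by (induction c) (auto simp: slot_size_def)

lemma extent_column_along:
  "\<forall>g\<in>set c. fst g = d \<Longrightarrow> extent (slot_size len) (\<not> d) (column d c w) = sum_list (map len c)"
  by (induction c) (auto simp: slot_size_def)

lemma slot_total_column: "slot_total (column d c w) g = w * real (count_list c g)"
  by (induction c) (auto simp: algebra_simps)

lemma blocks_column: "blocks (column d c w) = Suc (length c)"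
  by (induction c) auto

lemma slots_over_column: "set c \<subseteq> \<Gamma> \<Longrightarrow> 0 \<le> w \<Longrightarrow> slots_over \<Gamma> (column d c w)"
  by (induction c) auto

text \<open>A core with \<open>n\<close> leaves, surrounded by columns with at most one layer per
  key, a key being a direction and a stack of types. A further column with a key already in
  \<open>Ks\<close> widens the existing layer, so the number of layers is bounded by the number of
  keys.\<close>

inductive nest ::
    "(bool \<times> nat) set \<Rightarrow> (bool \<times> (bool \<times> nat) list) set \<Rightarrow> nat \<Rightarrow> slot slicing \<Rightarrow> bool" for \<Gamma> where
  core: "slots_over \<Gamma> T \<Longrightarrow> nest \<Gamma> {} (blocks T) T"
| layer: "nest \<Gamma> Ks n T \<Longrightarrow> (d, c) \<notin> Ks \<Longrightarrow> set c \<subseteq> \<Gamma> \<inter> {g. fst g = d} \<Longrightarrow> 0 \<le> w \<Longrightarrow>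
    nest \<Gamma> (insert (d, c) Ks) n (Cut d (column d c w) T)"

lemma nest_slots_over: "nest \<Gamma> Ks n T \<Longrightarrow> slots_over \<Gamma> T"
  by (induction rule: nest.induct) (auto intro!: slots_over_column)

lemma nest_blocks:
  assumes "nest \<Gamma> Ks n T" "\<forall>k\<in>Ks. length (snd k) \<le> m"
  shows "finite Ks \<and> blocks T \<le> n + card Ks * Suc m"
  using assms
proof (induction rule: nest.induct)
  case (layer Ks n T d c w)
  then have IH: "finite Ks" "blocks T \<le> n + card Ks * Suc m" and c: "length c \<le> m" by auto
  have "card (insert (d, c) Ks) = Suc (card Ks)" using IH layer.hyps by simp
  then show ?case using IH c by (simp add: blocks_column)
qed auto

text \<open>Widening a layer, however deep, by \<open>w\<close> raises the extent in direction
  \<open>d\<close> by at most \<open>w\<close>, because sums and maxima pass an increase outwards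
  without enlarging it. The stack is unchanged, so the other extent does not grow.\<close>

lemma nest_widen:
  assumes "nest \<Gamma> Ks n T" "(d, c) \<in> Ks" "0 \<le> w"
  shows "\<exists>T'. nest \<Gamma> Ks n T' \<and> extent (slot_size len) d T' \<le> extent (slot_size len) d T + w \<and>
    extent (slot_size len) (\<not> d) T' \<le> extent (slot_size len) (\<not> d) T \<and>
    (\<forall>g. slot_total T' g = slot_total T g + w * real (count_list c g))"
  using assms(1,2)
proof (induction rule: nest.induct)
  case (core T)
  then show ?case by simp
next
  case (layer Ks n T d' c' w')
  let ?e = "extent (slot_size len)"
  have c': "\<forall>g\<in>set c'. fst g = d'" using layer.hyps(3) by auto
  show ?case
  proof (cases "(d, c) = (d', c')")
    case True
    let ?T = "Cut d (column d c (w' + w)) T"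
    have "nest \<Gamma> (insert (d, c) Ks) n ?T"
      using layer.hyps True assms(3) by (intro nest.layer) auto
    moreover have "?e d ?T \<le> ?e d (Cut d (column d c w') T) + w"
      using c' True layer.hyps(4) assms(3) by (simp add: extent_column_across)
    moreover have "?e (\<not> d) ?T \<le> ?e (\<not> d) (Cut d (column d c w') T)"
      using c' True by (simp add: extent_column_along)
    moreover have "\<forall>g. slot_total ?T g = slot_total (Cut d (column d c w') T) g + w * real (count_list c g)"
      by (simp add: slot_total_column algebra_simps)
    ultimately show ?thesis using True by blast
  next
    case False
    then obtain T' where T': "nest \<Gamma> Ks n T'" "?e d T' \<le> ?e d T + w" "?e (\<not> d) T' \<le> ?e (\<not> d) T"
      "\<forall>g. slot_total T' g = slot_total T g + w * real (count_list c g)"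
      using layer.IH layer.prems by auto
    let ?T = "Cut d' (column d' c' w') T'"
    have "nest \<Gamma> (insert (d', c') Ks) n ?T" using layer.hyps T'(1) by (intro nest.layer)
    moreover have "?e d ?T \<le> ?e d (Cut d' (column d' c' w') T) + w"
      using T'(2) assms(3) by auto
    moreover have "?e (\<not> d) ?T \<le> ?e (\<not> d) (Cut d' (column d' c' w') T)"
      using T'(3) by auto
    moreover have "\<forall>g. slot_total ?T g = slot_total (Cut d' (column d' c' w') T) g + w * real (count_list c g)"
      using T'(4) by simp
    ultimately show ?thesis by blast
  qed
qed

lemma nest_insert_column:
  assumes "nest \<Gamma> Ks n T" "set c \<subseteq> \<Gamma> \<inter> {g. fst g = d}" "0 \<le> w" "sum_list (map len c) \<le> h"
  shows "\<exists>T'. nest \<Gamma> (insert (d, c) Ks) n T' \<and> extent (slot_size len) d T' \<le> extent (slot_size len) d T + w \<and>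
    extent (slot_size len) (\<not> d) T' \<le> max h (extent (slot_size len) (\<not> d) T) \<and>
    (\<forall>g. slot_total T' g = slot_total T g + w * real (count_list c g))"
proof (cases "(d, c) \<in> Ks")
  case True
  then have "insert (d, c) Ks = Ks" by auto
  then show ?thesis using nest_widen[OF assms(1) True assms(3), of len] by (auto simp: le_max_iff_disj)
next
  case False
  have c: "\<forall>g\<in>set c. fst g = d" using assms(2) by auto
  let ?T = "Cut d (column d c w) T"
  have "nest \<Gamma> (insert (d, c) Ks) n ?T" using assms False by (intro nest.layer)
  moreover have "extent (slot_size len) d ?T \<le> extent (slot_size len) d T + w"
    using c assms(3) by (simp add: extent_column_across)
  moreover have "extent (slot_size len) (\<not> d) ?T \<le> max h (extent (slot_size len) (\<not> d) T)"
    using c assms(4) by (auto simp: extent_column_along)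
  moreover have "\<forall>g. slot_total ?T g = slot_total T g + w * real (count_list c g)"
    by (simp add: slot_total_column)
  ultimately show ?thesis by blast
qed

lemma nest_insert_columns:
  assumes "nest \<Gamma> Ks n T" "\<forall>x\<in>set xs. 0 \<le> fst x \<and> set (snd x) \<subseteq> \<Gamma> \<inter> {g. fst g = d} \<and> sum_list (map len (snd x)) \<le> h"
  shows "\<exists>T'. nest \<Gamma> (Ks \<union> Pair d ` snd ` set xs) n T' \<and>
    extent (slot_size len) d T' \<le> extent (slot_size len) d T + sum_list (map fst xs) \<and>
    extent (slot_size len) (\<not> d) T' \<le> max h (extent (slot_size len) (\<not> d) T) \<and>
    (\<forall>g. slot_total T' g = slot_total T g + (\<Sum>x\<leftarrow>xs. fst x * real (count_list (snd x) g)))"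
  using assms
proof (induction xs arbitrary: Ks T)
  case Nil
  then show ?case by (intro exI[of _ T]) simp
next
  case (Cons x xs)
  let ?e = "extent (slot_size len)"
  have "set (snd x) \<subseteq> \<Gamma> \<inter> {g. fst g = d}" "0 \<le> fst x" "sum_list (map len (snd x)) \<le> h"
    using Cons.prems(2) by auto
  from nest_insert_column[OF Cons.prems(1) this]
  obtain T1 where T1: "nest \<Gamma> (insert (d, snd x) Ks) n T1" "?e d T1 \<le> ?e d T + fst x"
    "?e (\<not> d) T1 \<le> max h (?e (\<not> d) T)" "\<forall>g. slot_total T1 g = slot_total T g + fst x * real (count_list (snd x) g)"
    by blast
  have "\<forall>x\<in>set xs. 0 \<le> fst x \<and> set (snd x) \<subseteq> \<Gamma> \<inter> {g. fst g = d} \<and> sum_list (map len (snd x)) \<le> h"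
    using Cons.prems(2) by simp
  from Cons.IH[OF T1(1) this]
  obtain T2 where T2: "nest \<Gamma> (insert (d, snd x) Ks \<union> Pair d ` snd ` set xs) n T2"
    "?e d T2 \<le> ?e d T1 + sum_list (map fst xs)" "?e (\<not> d) T2 \<le> max h (?e (\<not> d) T1)"
    "\<forall>g. slot_total T2 g = slot_total T1 g + (\<Sum>x\<leftarrow>xs. fst x * real (count_list (snd x) g))"
    by blast
  have eq: "insert (d, snd x) Ks \<union> Pair d ` snd ` set xs = Ks \<union> Pair d ` snd ` set (x # xs)" by auto
  show ?case
  proof (intro exI[of _ T2] conjI)
    show "nest \<Gamma> (Ks \<union> Pair d ` snd ` set (x # xs)) n T2" using T2(1) eq by simp
    show "?e d T2 \<le> ?e d T + sum_list (map fst (x # xs))" using T2(2) T1(2) by simp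
    show "?e (\<not> d) T2 \<le> max h (?e (\<not> d) T)" using T2(3) T1(3) by linarith
    show "\<forall>g. slot_total T2 g = slot_total T g + (\<Sum>x\<leftarrow>x # xs. fst x * real (count_list (snd x) g))"
      using T2(4) T1(4) by simp
  qed
qed

definition keys :: "(bool \<times> nat) set \<Rightarrow> nat \<Rightarrow> (bool \<times> (bool \<times> nat) list) set" where
  "keys \<Gamma> m = UNIV \<times> {c. set c \<subseteq> \<Gamma> \<and> length c \<le> m}"

lemma finite_keys: "finite \<Gamma> \<Longrightarrow> finite (keys \<Gamma> m)"
  by (simp add: keys_def finite_lists_length_le)

text \<open>Types have length at least \<rho>, so a stack within height 1 is short. Therefore the
  finite set \<open>keys\<close> contains all stacks that can occur.\<close>

lemma column_length_le:
  fixes len :: "bool \<times> nat \<Rightarrow> real"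
  assumes "0 < \<rho>" "\<forall>g\<in>\<Gamma>. \<rho> \<le> len g" "set c \<subseteq> \<Gamma>" "sum_list (map len c) \<le> 1"
  shows "length c \<le> nat \<lfloor>1 / \<rho>\<rfloor>"
proof -
  have "real (length c) * \<rho> \<le> sum_list (map len c)"
    using assms(2,3) by (induction c) (auto simp: algebra_simps)
  then have "real (length c) \<le> 1 / \<rho>" using assms(1,4) by (simp add: field_simps)
  then show ?thesis using assms(1) by (simp add: le_nat_iff le_floor_iff)
qed

text \<open>At a cut with a pure side, that side dissolves into columns, which are inserted into the
  nest of the other side and leave its core untouched. Only at a balanced cut do two nests become a
  new core. \<open>X\<close> exceeds by 1 the number of leaves that all layers can have together, a
  layer with stack \<open>c\<close> having \<open>length c + 1\<close> of them.\<close>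

lemma slicing_imp_nest:
  assumes "0 < \<rho>" "finite \<Gamma>" "\<forall>g\<in>\<Gamma>. \<rho> \<le> len g"
    and "slots_over \<Gamma> T" "\<forall>d. extent (slot_size len) d T \<le> 1"
  defines "m \<equiv> nat \<lfloor>1 / \<rho>\<rfloor>"
  defines "X \<equiv> real (card (keys \<Gamma> m) * Suc m + 1)"
  shows "\<exists>Ks n T'. nest \<Gamma> Ks n T' \<and> Ks \<subseteq> keys \<Gamma> m \<and>
    (\<forall>d. extent (slot_size len) d T' \<le> extent (slot_size len) d T) \<and> (\<forall>g. slot_total T' g = slot_total T g) \<and>
    real n \<le> X * 4 powr ((extent (slot_size len) True T + extent (slot_size len) False T) / \<rho>)"
  using assms(4,5)
proof (induction T)
  case Blank
  have "nest \<Gamma> {} 1 Blank" using nest.core[of \<Gamma> Blank] by simp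
  then show ?case by (intro exI[of _ "{}"] exI[of _ 1] exI[of _ Blank]) (simp add: X_def)
next
  case (Piece p)
  have "nest \<Gamma> {} 1 (Piece p)" using nest.core[of \<Gamma> "Piece p"] Piece.prems by simp
  moreover have "1 \<le> X * 4 powr ((extent (slot_size len) True (Piece p) + extent (slot_size len) False (Piece p)) / \<rho>)"
  proof -
    have len0: "\<forall>g\<in>\<Gamma>. 0 \<le> len g" using assms(1,3) by force
    have "0 \<le> extent (slot_size len) d (Piece p)" for d
      using Piece.prems(1) len0 by (rule slot_extent_nonneg)
    then have "1 \<le> 4 powr ((extent (slot_size len) True (Piece p) + extent (slot_size len) False (Piece p)) / \<rho>)"
      using assms(1) by (intro ge_one_powr_ge_zero) (auto intro!: divide_nonneg_pos add_nonneg_nonneg)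
    moreover have "1 \<le> X" by (simp add: X_def)
    ultimately show ?thesis using mult_mono[of 1 X 1] by simp
  qed
  ultimately show ?case by (intro exI[of _ "{}"] exI[of _ 1] exI[of _ "Piece p"]) simp
next
  case (Cut d A B)
  let ?e = "extent (slot_size len)"
  let ?g = "\<lambda>T. 4 powr ((?e True T + ?e False T) / \<rho>)"
  have len0: "\<forall>g\<in>\<Gamma>. 0 \<le> len g" using assms(1,3) by force
  have oA: "slots_over \<Gamma> A" and oB: "slots_over \<Gamma> B" using Cut.prems(1) by auto
  have A: "0 \<le> ?e c A" and B: "0 \<le> ?e c B" for c
    using oA oB len0 by (auto intro: slot_extent_nonneg)
  have leA: "?e c A \<le> ?e c (Cut d A B)" and leB: "?e c B \<le> ?e c (Cut d A B)" for c
    using A[of c] B[of c] by auto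
  have A1: "\<forall>c. ?e c A \<le> 1" and B1: "\<forall>c. ?e c B \<le> 1"
    using leA leB Cut.prems(2) by (meson order_trans)+
  have X0: "0 \<le> X" by (simp add: X_def)
  have gA: "X * ?g A \<le> X * ?g (Cut d A B)" and gB: "X * ?g B \<le> X * ?g (Cut d A B)"
    using leA[of True] leA[of False] leB[of True] leB[of False] assms(1) X0
    by (auto intro!: mult_left_mono powr_mono divide_right_mono simp del: extent.simps)
  obtain KA nA TA where TA: "nest \<Gamma> KA nA TA" "KA \<subseteq> keys \<Gamma> m" "\<forall>c. ?e c TA \<le> ?e c A"
    "\<forall>g. slot_total TA g = slot_total A g" "real nA \<le> X * ?g A"
    using Cut.IH(1)[OF oA A1] by blast
  obtain KB nB TB where TB: "nest \<Gamma> KB nB TB" "KB \<subseteq> keys \<Gamma> m" "\<forall>c. ?e c TB \<le> ?e c B"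
    "\<forall>g. slot_total TB g = slot_total B g" "real nB \<le> X * ?g B"
    using Cut.IH(2)[OF oB B1] by blast
  let ?ori = "\<lambda>p :: slot. fst (fst p)"
  \<comment> \<open>\<open>P\<close> is the pure side and \<open>Q\<close> the other one; the last
    assumptions let either of \<open>A\<close> and \<open>B\<close> play the role of
    \<open>P\<close>.\<close>
  have peel: "\<exists>Ks n T'. nest \<Gamma> Ks n T' \<and> Ks \<subseteq> keys \<Gamma> m \<and>
    (\<forall>c. ?e c T' \<le> ?e c (Cut d A B)) \<and> (\<forall>g. slot_total T' g = slot_total (Cut d A B) g) \<and>
    real n \<le> X * ?g (Cut d A B)"
    if P: "pure ?ori d P" "slots_over \<Gamma> P" "\<forall>c. ?e c P \<le> 1"
      and Q: "nest \<Gamma> Ks n Q'" "Ks \<subseteq> keys \<Gamma> m" "\<forall>c. ?e c Q' \<le> ?e c Q" "\<forall>g. slot_total Q' g = slot_total Q g"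
      "real n \<le> X * ?g (Cut d A B)"
      and PQ: "\<And>c. ?e c (Cut d P Q) = ?e c (Cut d A B)" "\<And>g. slot_total P g + slot_total Q g = slot_total (Cut d A B) g"
    for P Q Q' Ks n
  proof -
    have "\<forall>p\<in>set (pieces P). fst (fst p) = d" using P(1) by (auto simp: pure_def)
    from pure_columns[OF len0 P(2) this]
    obtain xs :: "(real \<times> (bool \<times> nat) list) list" where xs:
      "\<forall>x\<in>set xs. 0 \<le> fst x \<and> set (snd x) \<subseteq> \<Gamma> \<inter> {g. fst g = d} \<and> sum_list (map len (snd x)) \<le> ?e (\<not> d) P"
      "sum_list (map fst xs) \<le> ?e d P"
      "\<forall>g. (\<Sum>x\<leftarrow>xs. fst x * real (count_list (snd x) g)) = slot_total P g"
      by blast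
    obtain T' where T': "nest \<Gamma> (Ks \<union> Pair d ` snd ` set xs) n T'"
      "?e d T' \<le> ?e d Q' + sum_list (map fst xs)" "?e (\<not> d) T' \<le> max (?e (\<not> d) P) (?e (\<not> d) Q')"
      "\<forall>g. slot_total T' g = slot_total Q' g + (\<Sum>x\<leftarrow>xs. fst x * real (count_list (snd x) g))"
      using nest_insert_columns[OF Q(1) xs(1)] by blast
    have "length (snd x) \<le> m \<and> set (snd x) \<subseteq> \<Gamma>" if "x \<in> set xs" for x
    proof -
      have "sum_list (map len (snd x)) \<le> 1" using xs(1) that P(3) by (meson order_trans)
      moreover have "set (snd x) \<subseteq> \<Gamma>" using xs(1) that by auto
      ultimately show ?thesis unfolding m_def using column_length_le[OF assms(1,3)] by blast
    qed
    then have K: "Ks \<union> Pair d ` snd ` set xs \<subseteq> keys \<Gamma> m" using Q(2) by (auto simp: keys_def)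
    have "?e d T' \<le> ?e d (Cut d P Q)" using T'(2) Q(3)[rule_format, of d] xs(2) by simp
    moreover have "?e (\<not> d) T' \<le> ?e (\<not> d) (Cut d P Q)"
      using T'(3) Q(3)[rule_format, of "\<not> d"] by simp
    ultimately have "?e c T' \<le> ?e c (Cut d A B)" for c
      unfolding PQ(1) by (cases "c = d") (simp_all del: extent.simps)
    moreover have "slot_total T' g = slot_total (Cut d A B) g" for g
      using spec[OF T'(4), of g] spec[OF Q(4), of g] spec[OF xs(3), of g] PQ(2)[of g] by linarith
    ultimately show ?thesis using T'(1) K Q(5) by blast
  qed
  consider (peelA) "pure ?ori d A" | (peelB) "pure ?ori d B" | (balanced) "\<not> pure ?ori d A" "\<not> pure ?ori d B" by blast
  then show ?case
  proof cases
    case peelA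
    show ?thesis by (rule peel[OF peelA oA A1 TB(1-4)]) (use TB(5) gB in simp_all)
  next
    case peelB
    show ?thesis
      by (rule peel[OF peelB oB B1 TA(1-4)]) (use TA(5) gA in \<open>simp_all add: add.commute max.commute\<close>)
  next
    case balanced
    have long: "\<rho> \<le> ?e d T" if T: "\<not> pure ?ori d T" "slots_over \<Gamma> T" for T
    proof -
      obtain p where p: "p \<in> set (pieces T)" "fst (fst p) \<noteq> d" using T(1) unfolding pure_def by blast
      then have "\<rho> \<le> slot_size len d p" using T(2) assms(3) by (auto simp: slots_over_def slot_size_def)
      also have "\<dots> \<le> ?e d T"
        using p(1) T(2) len0 by (intro extent_ge_piece) (auto simp: slots_over_def slot_size_def)
      finally show ?thesis .
    qed
    have rA: "\<rho> \<le> ?e d A" and rB: "\<rho> \<le> ?e d B" using balanced oA oB long by auto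
    let ?T = "Cut d TA TB"
    have fin: "finite (keys \<Gamma> m)" using assms(2) by (rule finite_keys)
    have kl: "\<forall>k\<in>keys \<Gamma> m. length (snd k) \<le> m" by (auto simp: keys_def)
    have bA: "blocks TA \<le> nA + card (keys \<Gamma> m) * Suc m"
    proof -
      have "blocks TA \<le> nA + card KA * Suc m" using nest_blocks[OF TA(1)] TA(2) kl by blast
      moreover have "card KA \<le> card (keys \<Gamma> m)" using TA(2) fin by (rule card_mono[rotated])
      ultimately show ?thesis by (meson add_le_mono le_refl mult_le_mono1 order_trans)
    qed
    have bB: "blocks TB \<le> nB + card (keys \<Gamma> m) * Suc m"
    proof -
      have "blocks TB \<le> nB + card KB * Suc m" using nest_blocks[OF TB(1)] TB(2) kl by blast
      moreover have "card KB \<le> card (keys \<Gamma> m)" using TB(2) fin by (rule card_mono[rotated])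
      ultimately show ?thesis by (meson add_le_mono le_refl mult_le_mono1 order_trans)
    qed
    have "real (blocks ?T) \<le> real (nA + card (keys \<Gamma> m) * Suc m) + real (nB + card (keys \<Gamma> m) * Suc m)"
      using bA bB by (metis add_mono blocks.simps(3) of_nat_add of_nat_le_iff)
    \<comment> \<open>In the new core the layers of both nests are counted as well, fewer than
      \<open>X\<close> leaves on either side; \<open>balanced_growth\<close> absorbs the summand
      \<open>2 * X\<close>.\<close>
    also have "\<dots> \<le> X * ?g A + X * ?g B + 2 * X"
      using TA(5) TB(5) by (simp add: X_def)
    also have "\<dots> = X * (2 + ?g A + ?g B)" by (simp add: algebra_simps)
    also have "\<dots> \<le> X * ?g (Cut d A B)"
      using X0 rA rB A B assms(1) by (intro mult_left_mono balanced_growth) auto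
    finally have "real (blocks ?T) \<le> X * ?g (Cut d A B)" .
    moreover have "nest \<Gamma> {} (blocks ?T) ?T"
      using TA(1) TB(1) nest_slots_over by (intro nest.core) auto
    moreover have "?e c ?T \<le> ?e c (Cut d A B)" for c
      using spec[OF TA(3), of c] spec[OF TB(3), of c] by (auto simp: le_max_iff_disj)
    moreover have "slot_total ?T g = slot_total (Cut d A B) g" for g
      using spec[OF TA(4), of g] spec[OF TB(4), of g] by simp
    ultimately show ?thesis by blast
  qed
qed

text \<open>\<open>K\<close> is fixed before \<open>len\<close>: only the number of types and the
  lower bound \<rho> enter. This matters because the lengths will be read off from the
  items.\<close>

lemma few_slots:
  assumes "0 < \<rho>" "finite \<Gamma>"
  shows "\<exists>K. \<forall>len T. (\<forall>g\<in>\<Gamma>. \<rho> \<le> len g) \<longrightarrow> slots_over \<Gamma> T \<longrightarrow> (\<forall>d. extent (slot_size len) d T \<le> 1) \<longrightarrow>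
    (\<exists>T'. blocks T' \<le> K \<and> slots_over \<Gamma> T' \<and>
      (\<forall>d. extent (slot_size len) d T' \<le> extent (slot_size len) d T) \<and> (\<forall>g. slot_total T' g = slot_total T g))"
proof -
  define m where "m = nat \<lfloor>1 / \<rho>\<rfloor>"
  define X where "X = real (card (keys \<Gamma> m) * Suc m + 1)"
  define K where "K = nat \<lceil>X * 4 powr (2 / \<rho>)\<rceil> + card (keys \<Gamma> m) * Suc m"
  have "\<exists>T'. blocks T' \<le> K \<and> slots_over \<Gamma> T' \<and>
      (\<forall>d. extent (slot_size len) d T' \<le> extent (slot_size len) d T) \<and> (\<forall>g. slot_total T' g = slot_total T g)"
    if len: "\<forall>g\<in>\<Gamma>. \<rho> \<le> len g" and T: "slots_over \<Gamma> T" "\<forall>d. extent (slot_size len) d T \<le> 1" for len T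
  proof -
    obtain Ks n T' where T': "nest \<Gamma> Ks n T'" "Ks \<subseteq> keys \<Gamma> m"
      "\<forall>d. extent (slot_size len) d T' \<le> extent (slot_size len) d T" "\<forall>g. slot_total T' g = slot_total T g"
      "real n \<le> X * 4 powr ((extent (slot_size len) True T + extent (slot_size len) False T) / \<rho>)"
      using slicing_imp_nest[OF assms len T] unfolding m_def X_def by blast
    have "finite Ks \<and> blocks T' \<le> n + card Ks * Suc m"
      using T'(1,2) by (intro nest_blocks) (auto simp: keys_def)
    moreover have "card Ks \<le> card (keys \<Gamma> m)" using T'(2) finite_keys[OF assms(2)] by (rule card_mono[rotated])
    ultimately have "blocks T' \<le> n + card (keys \<Gamma> m) * Suc m"
      by (meson add_le_mono le_refl mult_le_mono1 order_trans)
    moreover have "real n \<le> X * 4 powr (2 / \<rho>)"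
    proof -
      have "extent (slot_size len) True T + extent (slot_size len) False T \<le> 2"
        using T(2)[rule_format, of True] T(2)[rule_format, of False] by linarith
      then have "X * 4 powr ((extent (slot_size len) True T + extent (slot_size len) False T) / \<rho>) \<le> X * 4 powr (2 / \<rho>)"
        using assms(1) by (intro mult_left_mono powr_mono divide_right_mono) (auto simp: X_def)
      then show ?thesis using T'(5) by linarith
    qed
    then have "n \<le> nat \<lceil>X * 4 powr (2 / \<rho>)\<rceil>" by linarith
    ultimately have "blocks T' \<le> K" by (simp add: K_def)
    then show ?thesis using T'(3,4) nest_slots_over[OF T'(1)] by blast
  qed
  then show ?thesis by blast
qed

section \<open>Packing long items\<close>

lemma maximal_prefix:
  fixes t :: "'a \<Rightarrow> real"
  assumes "\<forall>a\<in>set xs. 0 < t a" "0 \<le> cap"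
  shows "\<exists>ys zs. xs = ys @ zs \<and> sum_list (map t ys) \<le> cap \<and>
    (zs = [] \<or> cap < sum_list (map t ys) + t (hd zs))"
  using assms
proof (induction xs arbitrary: cap)
  case (Cons a xs)
  show ?case
  proof (cases "t a \<le> cap")
    case True
    have "\<forall>b\<in>set xs. 0 < t b" "0 \<le> cap - t a" using Cons.prems True by auto
    from Cons.IH[OF this] obtain ys zs where "xs = ys @ zs" "sum_list (map t ys) \<le> cap - t a"
      "zs = [] \<or> cap - t a < sum_list (map t ys) + t (hd zs)" by blast
    then show ?thesis by (intro exI[of _ "a # ys"] exI[of _ zs]) auto
  next
    case False
    then show ?thesis using Cons.prems by (intro exI[of _ "[]"] exI[of _ "a # xs"]) auto
  qed
qed auto

text \<open>Linear grouping by decreasing length, with non-increasing group thicknesses, so that the pieces of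
  each group fit into the slots of the previous one.\<close>

lemma grouping_list:
  fixes t l :: "'a \<Rightarrow> real"
  assumes "sorted_wrt (\<lambda>a b. l b \<le> l a) xs" "distinct xs" "\<forall>a\<in>set xs. 0 < t a \<and> t a \<le> \<delta>" "0 \<le> \<delta>"
    and "0 \<le> cap" "sum t (set xs) \<le> real G * (cap - real G * \<delta>)"
  shows "\<exists>grp. (\<forall>a\<in>set xs. grp a < G) \<and>
    (\<forall>a\<in>set xs. \<forall>b\<in>set xs. grp a < grp b \<longrightarrow> l b \<le> l a) \<and>
    (\<forall>g. sum t {a \<in> set xs. grp a = Suc g} \<le> sum t {a \<in> set xs. grp a = g}) \<and>
    sum t {a \<in> set xs. grp a = 0} \<le> cap"
  using assms(1-3,5,6)
proof (induction G arbitrary: xs cap)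
  case 0
  have "xs = []"
  proof (rule ccontr)
    assume "xs \<noteq> []"
    then have "0 < sum t (set xs)" using "0.prems"(3) by (intro sum_pos) auto
    then show False using "0.prems"(5) by simp
  qed
  then show ?case using "0.prems" by simp
next
  case (Suc G)
  obtain ys zs where xs: "xs = ys @ zs" and ys: "sum_list (map t ys) \<le> cap"
    and zs: "zs = [] \<or> cap < sum_list (map t ys) + t (hd zs)"
    using maximal_prefix[of xs t cap] Suc.prems by auto
  have dys: "distinct ys" "distinct zs" and disj: "set ys \<inter> set zs = {}" using Suc.prems(2) xs by auto
  have sys: "sum_list (map t ys) = sum t (set ys)" using dys by (simp add: sum_list_distinct_conv_sum_set)
  show ?case
  proof (cases "zs = []")
    case True
    have "0 \<le> sum t (set xs)" using Suc.prems(3) by (intro sum_nonneg) (auto intro: less_imp_le)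
    moreover have "sum t {a \<in> set xs. (0::nat) = Suc g} \<le> sum t {a \<in> set xs. 0 = g}" for g
      using calculation by (cases "g = 0") simp_all
    ultimately show ?thesis using ys sys True xs by (intro exI[of _ "\<lambda>_. 0"]) simp
  next
    case False
    have "hd zs \<in> set xs" using False xs by auto
    then have big: "cap - \<delta> < sum t (set ys)" using zs False sys Suc.prems(3) by force
    have s: "sum t (set xs) = sum t (set ys) + sum t (set zs)"
      unfolding xs using disj by (simp add: sum.union_disjoint)
    \<comment> \<open>The capacity passed on is the actual thickness of \<open>ys\<close>, so no
      later group is thicker than this one. It may fall short of \<open>cap\<close> by up to
      \<delta>, and the \<delta>-term in the hypothesis absorbs these shortfalls over all
      groups.\<close>
    have "real G * (cap - \<delta>) \<le> real G * sum t (set ys)" using big by (intro mult_left_mono) auto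
    moreover have "sum t (set zs) \<le> real G * (cap - \<delta>) - real G * (real G * \<delta>) - real G * \<delta>"
      using Suc.prems(5) s big by (simp add: algebra_simps)
    moreover have "0 \<le> real G * \<delta>" using assms(4) by simp
    ultimately have "sum t (set zs) \<le> real G * (sum t (set ys) - real G * \<delta>)"
      unfolding right_diff_distrib by linarith
    moreover have "sorted_wrt (\<lambda>a b. l b \<le> l a) zs" using Suc.prems(1) xs by (simp add: sorted_wrt_append)
    moreover have "\<forall>a\<in>set zs. 0 < t a \<and> t a \<le> \<delta>" using Suc.prems(3) xs by simp
    moreover have "0 \<le> sum t (set ys)" using Suc.prems(3) xs by (intro sum_nonneg) (auto intro: less_imp_le)
    ultimately obtain grp where grp: "\<forall>a\<in>set zs. grp a < G"
      "\<forall>a\<in>set zs. \<forall>b\<in>set zs. grp a < grp b \<longrightarrow> l b \<le> l a"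
      "\<forall>g. sum t {a \<in> set zs. grp a = Suc g} \<le> sum t {a \<in> set zs. grp a = g}"
      "sum t {a \<in> set zs. grp a = 0} \<le> sum t (set ys)"
      using Suc.IH[of zs "sum t (set ys)"] dys(2) by blast
    define grp' where "grp' = (\<lambda>a. if a \<in> set ys then 0 else Suc (grp a))"
    have g0: "{a \<in> set xs. grp' a = 0} = set ys" using xs by (auto simp: grp'_def)
    have gS: "{a \<in> set xs. grp' a = Suc g} = {a \<in> set zs. grp a = g}" for g
      using xs disj by (auto simp: grp'_def)
    have order: "\<forall>a\<in>set xs. \<forall>b\<in>set xs. grp' a < grp' b \<longrightarrow> l b \<le> l a"
    proof (intro ballI impI)
      fix a b assume ab: "a \<in> set xs" "b \<in> set xs" "grp' a < grp' b"
      then have b: "b \<notin> set ys" "b \<in> set zs" using xs by (auto simp: grp'_def split: if_splits)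
      show "l b \<le> l a"
      proof (cases "a \<in> set ys")
        case True
        then show ?thesis using Suc.prems(1) xs b by (simp add: sorted_wrt_append)
      next
        case False
        then show ?thesis using ab b grp(2) xs by (auto simp: grp'_def)
      qed
    qed
    show ?thesis
    proof (intro exI[of _ grp'] conjI)
      show "\<forall>a\<in>set xs. grp' a < Suc G" using grp(1) xs by (auto simp: grp'_def)
      show "\<forall>g. sum t {a \<in> set xs. grp' a = Suc g} \<le> sum t {a \<in> set xs. grp' a = g}"
      proof
        fix g show "sum t {a \<in> set xs. grp' a = Suc g} \<le> sum t {a \<in> set xs. grp' a = g}"
          using grp(3,4) by (cases g) (simp_all add: gS g0)
      qed
      show "sum t {a \<in> set xs. grp' a = 0} \<le> cap" using g0 ys sys by simp
    qed (rule order)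
  qed
qed

lemma grouping:
  fixes t l :: "'a \<Rightarrow> real"
  assumes "finite A" "\<forall>a\<in>A. 0 < t a \<and> t a \<le> \<delta>" "0 \<le> \<delta>"
    and "0 \<le> cap" "sum t A \<le> real G * (cap - real G * \<delta>)"
  shows "\<exists>grp. (\<forall>a\<in>A. grp a < G) \<and> (\<forall>a\<in>A. \<forall>b\<in>A. grp a < grp b \<longrightarrow> l b \<le> l a) \<and>
    (\<forall>g. sum t {a \<in> A. grp a = Suc g} \<le> sum t {a \<in> A. grp a = g}) \<and> sum t {a \<in> A. grp a = 0} \<le> cap"
proof -
  obtain xs where xs: "set xs = A" "distinct xs" using finite_distinct_list[OF assms(1)] by blast
  define ys where "ys = sort_key (\<lambda>a. - l a) xs"
  have "sorted (map (\<lambda>a. - l a) ys)" by (simp add: ys_def)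
  then have "sorted_wrt (\<lambda>a b. l b \<le> l a) ys" by (simp add: sorted_map)
  moreover have "set ys = A" "distinct ys" using xs by (simp_all add: ys_def)
  ultimately show ?thesis using grouping_list[of l ys t \<delta> cap G] assms by blast
qed

text \<open>The first item that no longer fits is sacrificed as \<open>X\<close>. Together with the
  packed items it exceeds \<open>c\<close>, so the unserved thickness drops by the full
  \<open>c\<close>.\<close>

lemma fill_box:
  fixes t :: "'a \<Rightarrow> real"
  assumes "finite A" "\<forall>a\<in>A. 0 < t a" "0 \<le> c"
  shows "\<exists>P X. P \<subseteq> A \<and> X \<subseteq> A - P \<and> card X \<le> 1 \<and> sum t P \<le> c \<and>
    sum t (A - P - X) \<le> max 0 (sum t A - c)"
proof -
  obtain xs where xs: "set xs = A" "distinct xs" using finite_distinct_list[OF assms(1)] by blast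
  obtain ys zs where yz: "xs = ys @ zs" and ys: "sum_list (map t ys) \<le> c"
    and zs: "zs = [] \<or> c < sum_list (map t ys) + t (hd zs)"
    using maximal_prefix[of xs t c] assms xs by auto
  have dys: "distinct ys" "distinct zs" and disj: "set ys \<inter> set zs = {}" using xs yz by auto
  have sys: "sum_list (map t ys) = sum t (set ys)" using dys by (simp add: sum_list_distinct_conv_sum_set)
  have A: "A = set ys \<union> set zs" using xs yz by auto
  show ?thesis
  proof (cases zs)
    case Nil
    then show ?thesis using A ys sys by (intro exI[of _ "set ys"] exI[of _ "{}"]) auto
  next
    case (Cons z zs')
    have rest: "A - set ys - {z} = set zs'" using A disj dys(2) Cons by auto
    have "sum t A = sum t (set ys) + (t z + sum t (set zs'))"
      unfolding A using disj dys(2) Cons by (simp add: sum.union_disjoint)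
    then have "sum t (set zs') \<le> sum t A - c" using zs Cons sys by simp
    then have "sum t (A - set ys - {z}) \<le> max 0 (sum t A - c)" unfolding rest by simp
    moreover have "{z} \<subseteq> A - set ys" "set ys \<subseteq> A" using A disj Cons by auto
    ultimately show ?thesis using ys sys by (intro exI[of _ "set ys"] exI[of _ "{z}"]) simp
  qed
qed

section \<open>Filling slots with one-directional containers\<close>

definition chain :: "bool \<Rightarrow> 'a list \<Rightarrow> 'a slicing" where
  "chain d xs = foldr (\<lambda>a T. Cut d (Piece a) T) xs Blank"

lemma chain_simps [simp]:
  "chain d [] = Blank"
  "chain d (a # xs) = Cut d (Piece a) (chain d xs)"
  by (simp_all add: chain_def)

lemma pieces_chain [simp]: "pieces (chain d xs) = xs"
  by (induction xs) auto

lemma only_cuts_chain [simp]: "only_cuts d (chain d xs)"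
  by (induction xs) auto

lemma extent_chain_along: "extent s d (chain d xs) = sum_list (map (s d) xs)"
  by (induction xs) auto

lemma extent_chain_across: "0 \<le> h \<Longrightarrow> \<forall>a\<in>set xs. s (\<not> d) a \<le> h \<Longrightarrow> extent s (\<not> d) (chain d xs) \<le> h"
  by (induction xs) auto

text \<open>\<open>w\<close> is the side along \<open>d\<close>, where the items line up, and
  \<open>h\<close> the side across it, whichever of the two is horizontal.\<close>

definition strip_plan :: "bool \<Rightarrow> 'l list \<Rightarrow> real \<Rightarrow> real \<Rightarrow> 'l plan" where
  "strip_plan d xs w h = (if d then Vertical else Horizontal, chain d xs, if d then w else h, if d then h else w)"

lemma strip_plan_simps [simp]:
  "plan_size e (strip_plan d xs w h) = (if e = d then w else h)"
  "contents (strip_plan d xs w h) = xs"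
  by (auto simp: strip_plan_def plan_size_def contents_def)

lemma plan_ok_strip:
  assumes "0 < w" "0 < h" "sum_list (map (s d) xs) \<le> w" "\<forall>a\<in>set xs. s (\<not> d) a \<le> h"
  shows "plan_ok \<epsilon> s (strip_plan d xs w h)"
proof -
  have "extent s d (chain d xs) \<le> w" "extent s (\<not> d) (chain d xs) \<le> h"
    using assms by (simp_all add: extent_chain_along extent_chain_across)
  then show ?thesis using assms by (cases d) (auto simp: plan_ok_def strip_plan_def)
qed

lemma slot_total_nonneg: "slots_over \<Gamma> T \<Longrightarrow> 0 \<le> slot_total T g"
  by (induction T) auto

text \<open>The slots are served one after another, and \<open>A'\<close> is what is still waiting.
  Each slot sacrifices at most one item into \<open>X\<close>, so the waiting thickness of a type
  drops by the full thickness of its slots.\<close>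

lemma fill_slots:
  fixes s :: "bool \<Rightarrow> 'l \<Rightarrow> real" and t :: "'l \<Rightarrow> real" and ty :: "'l \<Rightarrow> bool \<times> nat"
  assumes "\<forall>g\<in>\<Gamma>. 0 < len g" "slots_over \<Gamma> T" "finite A"
    and "\<forall>a\<in>A. 0 < t a \<and> s (fst (ty a)) a = t a \<and> s (\<not> fst (ty a)) a \<le> len (ty a)"
  shows "\<exists>C X A'. (\<forall>c\<in>set (pieces C). plan_ok \<epsilon> s c) \<and>
    (\<forall>d. extent plan_size d C \<le> extent (slot_size len) d T) \<and> blocks C \<le> blocks T \<and>
    area plan_size C \<le> area (slot_size len) T \<and>
    distinct (all_contents C) \<and> set (all_contents C) \<subseteq> A \<and> A' \<subseteq> A \<and> set (all_contents C) \<inter> A' = {} \<and>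
    A \<subseteq> set (all_contents C) \<union> X \<union> A' \<and> finite X \<and> card X \<le> blocks T \<and>
    (\<forall>g. sum t {a \<in> A'. ty a = g} \<le> max 0 (sum t {a \<in> A. ty a = g} - slot_total T g))"
  using assms(2-4)
proof (induction T arbitrary: A)
  case Blank
  then show ?case by (intro exI[of _ Blank] exI[of _ "{}"] exI[of _ A]) (auto simp: area_def)
next
  case (Piece p)
  obtain g w where p: "p = (g, w)" by (cases p)
  have g: "g \<in> \<Gamma>" "0 < len g" "0 \<le> w" using Piece.prems(1) assms(1) p by auto
  show ?case
  proof (cases "w = 0")
    case True
    \<comment> \<open>A slot of thickness 0 would be a degenerate container, so it is left
      \<open>Blank\<close>.\<close>
    have "0 \<le> slot_size len d p" for d using p g by (auto simp: slot_size_def)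
    moreover have "sum t {a \<in> A. ty a = g'} \<le> max 0 (sum t {a \<in> A. ty a = g'} - slot_total (Piece p) g')" for g'
      using p True by simp
    ultimately show ?thesis using p True Piece.prems
      by (intro exI[of _ Blank] exI[of _ "{}"] exI[of _ A]) (simp add: area_def)
  next
    case False
    let ?B = "{a \<in> A. ty a = g}"
    obtain P X where PX: "P \<subseteq> ?B" "X \<subseteq> ?B - P" "card X \<le> 1" "sum t P \<le> w"
      "sum t (?B - P - X) \<le> max 0 (sum t ?B - w)"
      using fill_box[of ?B t w] Piece.prems g(3) by auto
    have fin: "finite P" "finite X" using PX(1,2) Piece.prems(2) by (auto intro: finite_subset)
    obtain xs where xs: "set xs = P" "distinct xs" using finite_distinct_list[OF fin(1)] by blast
    define c where "c = strip_plan (fst g) xs w (len g)"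
    have "map (s (fst g)) xs = map t xs" using xs(1) PX(1) Piece.prems(3) by auto
    then have "sum_list (map (s (fst g)) xs) = sum t P"
      using xs by (simp add: sum_list_distinct_conv_sum_set)
    then have ok: "plan_ok \<epsilon> s c"
      unfolding c_def using g False PX(1,4) xs(1) Piece.prems(3) by (intro plan_ok_strip) auto
    have size: "plan_size d c = slot_size len d p" for d by (auto simp: c_def p slot_size_def)
    define A' where "A' = A - P - X"
    have sums: "sum t {a \<in> A'. ty a = g'} \<le> max 0 (sum t {a \<in> A. ty a = g'} - slot_total (Piece p) g')" for g'
    proof (cases "g' = g")
      case True
      have "{a \<in> A'. ty a = g} = ?B - P - X" by (auto simp: A'_def)
      then show ?thesis using PX(5) True p by simp
    next
      case ne: False
      have "{a \<in> A'. ty a = g'} = {a \<in> A. ty a = g'}" using ne PX(1,2) by (auto simp: A'_def)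
      then show ?thesis using ne p by simp
    qed
    have "set (all_contents (Piece c)) = P" "distinct (all_contents (Piece c))" using xs by (simp_all add: c_def)
    moreover have "P \<subseteq> A" "A' \<subseteq> A" "P \<inter> A' = {}" "A \<subseteq> P \<union> X \<union> A'" using PX(1) by (auto simp: A'_def)
    ultimately show ?thesis using ok size fin PX(3) sums
      by (intro exI[of _ "Piece c"] exI[of _ X] exI[of _ A']) (simp add: area_def)
  qed
next
  case (Cut d S T)
  have S: "slots_over \<Gamma> S" and T: "slots_over \<Gamma> T" using Cut.prems(1) by auto
  obtain C1 X1 A1 where 1: "\<forall>c\<in>set (pieces C1). plan_ok \<epsilon> s c"
    "\<forall>d. extent plan_size d C1 \<le> extent (slot_size len) d S" "blocks C1 \<le> blocks S"
    "area plan_size C1 \<le> area (slot_size len) S"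
    "distinct (all_contents C1)" "set (all_contents C1) \<subseteq> A" "A1 \<subseteq> A" "set (all_contents C1) \<inter> A1 = {}"
    "A \<subseteq> set (all_contents C1) \<union> X1 \<union> A1" "finite X1" "card X1 \<le> blocks S"
    "\<forall>g. sum t {a \<in> A1. ty a = g} \<le> max 0 (sum t {a \<in> A. ty a = g} - slot_total S g)"
    using Cut.IH(1)[OF S Cut.prems(2,3)] by (elim exE conjE) (rule that)
  have A1: "finite A1" "\<forall>a\<in>A1. 0 < t a \<and> s (fst (ty a)) a = t a \<and> s (\<not> fst (ty a)) a \<le> len (ty a)"
    using 1(7) Cut.prems(2,3) by (auto intro: finite_subset)
  obtain C2 X2 A2 where 2: "\<forall>c\<in>set (pieces C2). plan_ok \<epsilon> s c"
    "\<forall>d. extent plan_size d C2 \<le> extent (slot_size len) d T" "blocks C2 \<le> blocks T"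
    "area plan_size C2 \<le> area (slot_size len) T"
    "distinct (all_contents C2)" "set (all_contents C2) \<subseteq> A1" "A2 \<subseteq> A1" "set (all_contents C2) \<inter> A2 = {}"
    "A1 \<subseteq> set (all_contents C2) \<union> X2 \<union> A2" "finite X2" "card X2 \<le> blocks T"
    "\<forall>g. sum t {a \<in> A2. ty a = g} \<le> max 0 (sum t {a \<in> A1. ty a = g} - slot_total T g)"
    using Cut.IH(2)[OF T A1] by (elim exE conjE) (rule that)
  have "\<forall>c\<in>set (pieces (Cut d C1 C2)). plan_ok \<epsilon> s c" using 1(1) 2(1) by auto
  moreover have "\<forall>e. extent plan_size e (Cut d C1 C2) \<le> extent (slot_size len) e (Cut d S T)"
  proof
    fix e show "extent plan_size e (Cut d C1 C2) \<le> extent (slot_size len) e (Cut d S T)"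
      using spec[OF 1(2), of e] spec[OF 2(2), of e] by (auto simp: le_max_iff_disj)
  qed
  moreover have "blocks (Cut d C1 C2) \<le> blocks (Cut d S T)" using 1(3) 2(3) by simp
  moreover have "area plan_size (Cut d C1 C2) \<le> area (slot_size len) (Cut d S T)"
    using 1(4) 2(4) by (simp add: area_def)
  moreover have "distinct (all_contents (Cut d C1 C2))" using 1(5,8) 2(5,6) by auto
  moreover have "set (all_contents (Cut d C1 C2)) \<subseteq> A" using 1(6,7) 2(6) by auto
  moreover have "A2 \<subseteq> A" using 1(7) 2(7) by blast
  moreover have "set (all_contents (Cut d C1 C2)) \<inter> A2 = {}" using 1(8) 2(7,8) by auto
  moreover have "A \<subseteq> set (all_contents (Cut d C1 C2)) \<union> (X1 \<union> X2) \<union> A2" using 1(9) 2(9) by auto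
  moreover have "finite (X1 \<union> X2)" using 1(10) 2(10) by simp
  moreover have "card (X1 \<union> X2) \<le> blocks (Cut d S T)"
    using card_Un_le[of X1 X2] 1(11) 2(11) by simp
  moreover have "\<forall>g. sum t {a \<in> A2. ty a = g} \<le> max 0 (sum t {a \<in> A. ty a = g} - slot_total (Cut d S T) g)"
  proof
    fix g show "sum t {a \<in> A2. ty a = g} \<le> max 0 (sum t {a \<in> A. ty a = g} - slot_total (Cut d S T) g)"
      using spec[OF 1(12), of g] spec[OF 2(12), of g] slot_total_nonneg[OF S, of g] slot_total_nonneg[OF T, of g]
      unfolding slot_total_simps by linarith
  qed
  ultimately show ?case by (intro exI[of _ "Cut d C1 C2"] exI[of _ "X1 \<union> X2"] exI[of _ A2] conjI)
qed

text \<open>The area depends on the totals per type only, so rearranging slots preserves it.\<close>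

lemma area_slots:
  assumes "finite \<Gamma>" "slots_over \<Gamma> T"
  shows "area (slot_size len) T = (\<Sum>g\<in>\<Gamma>. slot_total T g * len g)"
  using assms(2)
proof (induction T)
  case Blank
  then show ?case by (simp add: area_def)
next
  case (Piece p)
  have "(\<Sum>g\<in>\<Gamma>. slot_total (Piece p) g * len g) = (\<Sum>g\<in>\<Gamma>. if fst p = g then snd p * len g else 0)"
    by (intro sum.cong) auto
  also have "\<dots> = snd p * len (fst p)" using Piece.prems assms(1) by simp
  finally show ?case by (auto simp: area_def slot_size_def)
next
  case (Cut d A B)
  then show ?case by (simp add: area_def distrib_right sum.distrib)
qed

text \<open>Items of group \<open>g + 1\<close> are put into the rounded slots of group
  \<open>g\<close>, which are long enough and thick enough in total. The first group of each
  orientation remains homeless and forms \<open>Lo\<close>; \<open>X\<close> collects the items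
  sacrificed while filling slots.\<close>

lemma pack_long:
  assumes "0 < \<rho>" "\<rho> \<le> 1" "0 < \<tau>"
  shows "\<exists>K. \<exists>\<delta>>0. \<forall>\<epsilon> (s :: bool \<Rightarrow> 'l \<Rightarrow> real) ori T.
    (\<forall>a\<in>set (pieces T). long_thin s ori \<rho> a \<and> s (ori a) a \<le> \<delta>) \<longrightarrow> distinct (pieces T) \<longrightarrow>
    (\<forall>d. extent s d T \<le> 1) \<longrightarrow>
    (\<exists>C Lo X. (\<forall>c\<in>set (pieces C). plan_ok \<epsilon> s c) \<and> (\<forall>d. extent plan_size d C \<le> extent s d T) \<and>
      blocks C \<le> K \<and> area plan_size C \<le> area s T \<and>
      distinct (all_contents C) \<and> set (all_contents C) \<subseteq> set (pieces T) \<and>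
      Lo \<subseteq> set (pieces T) \<and> set (all_contents C) \<inter> Lo = {} \<and>
      set (pieces T) \<subseteq> set (all_contents C) \<union> X \<union> Lo \<and> finite X \<and> card X \<le> K \<and>
      (\<Sum>a\<in>Lo. s (ori a) a) \<le> 2 * \<tau>)"
proof -
  \<comment> \<open>Long items have area at most 1, hence total thickness at most
    \<open>1 / \<rho>\<close>. With this \<open>G\<close> and \<delta>, grouping with capacity
    \<tau> can take \<open>real G * \<tau> / 2\<close>, which is at least that much.\<close>
  define G where "G = nat \<lceil>2 / (\<rho> * \<tau>)\<rceil> + 1"
  define \<delta> where "\<delta> = \<tau> / (2 * real G)"
  define \<Gamma> where "\<Gamma> = (UNIV :: bool set) \<times> {..<G}"
  have G: "0 < G" "2 / (\<rho> * \<tau>) \<le> real G" by (simp_all add: G_def) linarith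
  have \<delta>: "0 < \<delta>" "real G * (\<tau> - real G * \<delta>) = real G * \<tau> / 2" using assms(3) G by (simp_all add: \<delta>_def)
  have cap: "1 / \<rho> \<le> real G * (\<tau> - real G * \<delta>)"
    unfolding \<delta>(2) using G(2) assms by (simp add: field_simps)
  have fin\<Gamma>: "finite \<Gamma>" by (simp add: \<Gamma>_def)
  obtain K where K: "\<forall>len T. (\<forall>g\<in>\<Gamma>. \<rho> \<le> len g) \<longrightarrow> slots_over \<Gamma> T \<longrightarrow> (\<forall>d. extent (slot_size len) d T \<le> 1) \<longrightarrow>
    (\<exists>T'. blocks T' \<le> K \<and> slots_over \<Gamma> T' \<and>
      (\<forall>d. extent (slot_size len) d T' \<le> extent (slot_size len) d T) \<and> (\<forall>g. slot_total T' g = slot_total T g))"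
    using few_slots[OF assms(1) fin\<Gamma>] by blast
  have "\<exists>C Lo X. (\<forall>c\<in>set (pieces C). plan_ok \<epsilon> s c) \<and> (\<forall>d. extent plan_size d C \<le> extent s d T) \<and>
      blocks C \<le> K \<and> area plan_size C \<le> area s T \<and>
      distinct (all_contents C) \<and> set (all_contents C) \<subseteq> set (pieces T) \<and>
      Lo \<subseteq> set (pieces T) \<and> set (all_contents C) \<inter> Lo = {} \<and>
      set (pieces T) \<subseteq> set (all_contents C) \<union> X \<union> Lo \<and> finite X \<and> card X \<le> K \<and>
      (\<Sum>a\<in>Lo. s (ori a) a) \<le> 2 * \<tau>"
    if lt: "\<forall>a\<in>set (pieces T). long_thin s ori \<rho> a \<and> s (ori a) a \<le> \<delta>" and dist: "distinct (pieces T)"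
      and ext: "\<forall>d. extent s d T \<le> 1" for \<epsilon> and s :: "bool \<Rightarrow> 'l \<Rightarrow> real" and ori T
  proof -
    define A where "A = set (pieces T)"
    define t where "t = (\<lambda>a. s (ori a) a)"
    define l where "l = (\<lambda>a. s (\<not> ori a) a)"
    have t: "0 < t a" "t a \<le> \<delta>" and l: "\<rho> \<le> l a" if "a \<in> A" for a
      using lt that by (auto simp: A_def t_def l_def long_thin_def)
    have pos: "0 < s d a" if "a \<in> A" for d a
      using that lt long_thin_nonneg[of s ori \<rho> a] assms(1) by (auto simp: A_def)
    have finA: "finite A" by (simp add: A_def)
    have prod: "s True a * s False a = t a * l a" for a by (cases "ori a") (simp_all add: t_def l_def)
    have areaT: "area s T = (\<Sum>a\<in>A. t a * l a)"
      unfolding area_def prod A_def using dist by (simp add: sum_list_distinct_conv_sum_set)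
    have "area s T \<le> extent s True T * extent s False T"
      using pos by (intro area_le_extents) (auto simp: A_def intro: less_imp_le)
    also have "\<dots> \<le> 1 * 1"
      using ext pos by (intro mult_mono extent_nonneg) (auto simp: A_def intro: less_imp_le)
    finally have "(\<Sum>a\<in>A. t a * l a) \<le> 1" using areaT by simp
    moreover have "(\<Sum>a\<in>A. t a * \<rho>) \<le> (\<Sum>a\<in>A. t a * l a)"
      using t l by (intro sum_mono mult_left_mono) (auto intro: less_imp_le)
    ultimately have "sum t A * \<rho> \<le> 1" by (simp add: sum_distrib_right)
    then have sumt: "sum t A \<le> 1 / \<rho>" using assms(1) by (simp add: field_simps)
    define Q where "Q d grp \<longleftrightarrow> (\<forall>a\<in>{a \<in> A. ori a = d}. grp a < G) \<and>
      (\<forall>a\<in>{a \<in> A. ori a = d}. \<forall>b\<in>{a \<in> A. ori a = d}. grp a < grp b \<longrightarrow> l b \<le> l a) \<and>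
      (\<forall>g. sum t {a \<in> {a \<in> A. ori a = d}. grp a = Suc g} \<le> sum t {a \<in> {a \<in> A. ori a = d}. grp a = g}) \<and>
      sum t {a \<in> {a \<in> A. ori a = d}. grp a = 0} \<le> \<tau>" for d and grp :: "'l \<Rightarrow> nat"
    have "\<exists>grp. Q d grp" for d
      unfolding Q_def
    proof (rule grouping)
      have "sum t {a \<in> A. ori a = d} \<le> sum t A"
        using t finA by (intro sum_mono2) (auto intro: less_imp_le)
      then show "sum t {a \<in> A. ori a = d} \<le> real G * (\<tau> - real G * \<delta>)" using sumt cap by linarith
    qed (use t \<delta>(1) assms(3) finA in auto)
    then obtain grpo where grpo': "\<And>d. Q d (grpo d)" by metis
    note grpo = grpo'[unfolded Q_def]
    define grp where "grp = (\<lambda>a. grpo (ori a) a)"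
    define ty where "ty = (\<lambda>a. (ori a, grp a))"
    have tyset: "{a \<in> A. ty a = (d, g)} = {a \<in> {a \<in> A. ori a = d}. grpo d a = g}" for d g
      by (auto simp: ty_def grp_def)
    have grpG: "grp a < G" if "a \<in> A" for a using grpo[of "ori a"] that by (auto simp: grp_def)
    have order: "l b \<le> l a" if "a \<in> A" "b \<in> A" "ori a = ori b" "grp a < grp b" for a b
      using grpo[of "ori a"] that by (auto simp: grp_def)
    have shrink: "sum t {a \<in> A. ty a = (d, Suc g)} \<le> sum t {a \<in> A. ty a = (d, g)}" for d g
      unfolding tyset using grpo[of d] by blast
    have first: "sum t {a \<in> A. ty a = (d, 0)} \<le> \<tau>" for d
      unfolding tyset using grpo[of d] by blast
    \<comment> \<open>Rounding down to the shortest item of a group makes the slots fit where the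
      items were. The value 1 for an empty type keeps \<open>\<rho> \<le> len g\<close> true for all
      types.\<close>
    define len where "len = (\<lambda>g. if {a \<in> A. ty a = g} = {} then 1 else Min (l ` {a \<in> A. ty a = g}))"
    have len_le: "len (ty a) \<le> l a" if "a \<in> A" for a
    proof -
      have "{b \<in> A. ty b = ty a} \<noteq> {}" using that by blast
      then show ?thesis using that finA unfolding len_def by (auto intro!: Min_le)
    qed
    have len\<rho>: "\<rho> \<le> len g" for g using assms(2) l finA by (auto simp: len_def)
    define S where "S = map_slicing (\<lambda>a. (ty a, t a)) T"
    have size: "slot_size len d (ty a, t a) \<le> s d a" if "a \<in> A" for d a
      using len_le[OF that] by (cases "d = ori a") (auto simp: slot_size_def ty_def t_def l_def)
    have Sext: "extent (slot_size len) d S \<le> extent s d T" for d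
      unfolding S_def extent_map using size by (intro extent_mono_size) (auto simp: A_def)
    have over: "slots_over \<Gamma> S"
      using grpG t by (auto simp: slots_over_def S_def \<Gamma>_def ty_def A_def[symmetric] intro: less_imp_le)
    have tot: "slot_total S g = sum t {a \<in> A. ty a = g}" for g
    proof -
      have "slot_total S g = (\<Sum>a\<leftarrow>pieces T. if ty a = g then t a else 0)"
        by (simp add: slot_total_def S_def comp_def cong: if_cong)
      also have "\<dots> = (\<Sum>a\<in>A. if ty a = g then t a else 0)"
        using dist by (simp add: sum_list_distinct_conv_sum_set A_def)
      also have "\<dots> = sum t {a \<in> A. ty a = g}" using finA by (simp add: sum.inter_filter)
      finally show ?thesis .
    qed
    have "extent (slot_size len) d S \<le> 1" for d using Sext[of d] ext by (meson order_trans)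
    then obtain S' where S': "blocks S' \<le> K" "slots_over \<Gamma> S'"
      "\<forall>d. extent (slot_size len) d S' \<le> extent (slot_size len) d S" "\<forall>g. slot_total S' g = slot_total S g"
      using K[rule_format, of len S] len\<rho> over by blast
    \<comment> \<open>\<open>ty'\<close> assigns to an item the slot type of the preceding group of
      its orientation; on \<open>B\<close> the subtraction is not truncated.\<close>
    define B where "B = {a \<in> A. 0 < grp a}"
    define ty' where "ty' = (\<lambda>a. (ori a, grp a - 1))"
    have finB: "finite B" using finA by (simp add: B_def)
    have "0 < t a \<and> s (fst (ty' a)) a = t a \<and> s (\<not> fst (ty' a)) a \<le> len (ty' a)" if "a \<in> B" for a
    proof -
      have a: "a \<in> A" "0 < grp a" using that by (auto simp: B_def)
      have "ty a = (ori a, Suc (grp a - 1))" using a by (simp add: ty_def)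
      \<comment> \<open>The preceding group is at least as thick as that of \<open>a\<close>, hence
        nonempty. So \<open>len (ty' a)\<close> is a genuine minimum over items at least as long as
        \<open>a\<close>.\<close>
      then have "0 < sum t {b \<in> A. ty b = (ori a, Suc (grp a - 1))}"
        using a t finA by (intro sum_pos) auto
      then have "0 < sum t {b \<in> A. ty b = ty' a}" using shrink[of "ori a" "grp a - 1"] by (simp add: ty'_def)
      then have ne: "{b \<in> A. ty b = ty' a} \<noteq> {}" by (metis less_irrefl sum.empty)
      have "l a \<le> l b" if "b \<in> {b \<in> A. ty b = ty' a}" for b
        using that a by (intro order) (auto simp: ty_def ty'_def)
      then have "l a \<le> len (ty' a)" unfolding len_def if_not_P[OF ne] using ne finA by simp
      then show ?thesis using t a by (simp add: ty'_def t_def l_def)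
    qed
    then have "\<exists>C X A'. (\<forall>c\<in>set (pieces C). plan_ok \<epsilon> s c) \<and>
      (\<forall>d. extent plan_size d C \<le> extent (slot_size len) d S') \<and> blocks C \<le> blocks S' \<and>
      area plan_size C \<le> area (slot_size len) S' \<and>
      distinct (all_contents C) \<and> set (all_contents C) \<subseteq> B \<and> A' \<subseteq> B \<and> set (all_contents C) \<inter> A' = {} \<and>
      B \<subseteq> set (all_contents C) \<union> X \<union> A' \<and> finite X \<and> card X \<le> blocks S' \<and>
      (\<forall>g. sum t {a \<in> A'. ty' a = g} \<le> max 0 (sum t {a \<in> B. ty' a = g} - slot_total S' g))"
      using S'(2) finB len\<rho> assms(1) by (intro fill_slots[where \<Gamma> = \<Gamma>]) (auto intro: less_le_trans)
    then obtain C X A' where C: "\<forall>c\<in>set (pieces C). plan_ok \<epsilon> s c"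
      "\<forall>d. extent plan_size d C \<le> extent (slot_size len) d S'" "blocks C \<le> blocks S'"
      "area plan_size C \<le> area (slot_size len) S'"
      "distinct (all_contents C)" "set (all_contents C) \<subseteq> B" "A' \<subseteq> B" "set (all_contents C) \<inter> A' = {}"
      "B \<subseteq> set (all_contents C) \<union> X \<union> A'" "finite X" "card X \<le> blocks S'"
      "\<forall>g. sum t {a \<in> A'. ty' a = g} \<le> max 0 (sum t {a \<in> B. ty' a = g} - slot_total S' g)"
      by (elim exE conjE) (rule that)
    \<comment> \<open>The items waiting for slots of a type form the next group, which is no thicker
      than those slots together; so no positive thickness can be left over.\<close>
    have "A' = {}"
    proof (rule ccontr)
      assume "A' \<noteq> {}"
      then obtain a where a: "a \<in> A'" by blast
      then have aA: "a \<in> A" "0 < grp a" using C(7) by (auto simp: B_def)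
      have finA': "finite A'" using C(7) finB by (rule finite_subset)
      have "0 < sum t {b \<in> A'. ty' b = ty' a}"
        using a finA' C(7) t by (intro sum_pos) (auto simp: B_def)
      moreover have "{b \<in> B. ty' b = ty' a} = {b \<in> A. ty b = (ori a, Suc (grp a - 1))}"
        using aA by (auto simp: B_def ty_def ty'_def)
      then have "sum t {b \<in> B. ty' b = ty' a} \<le> slot_total S' (ty' a)"
        using shrink[of "ori a" "grp a - 1"] spec[OF S'(4), of "ty' a"] tot[of "ty' a"] by (simp add: ty'_def)
      ultimately show False using spec[OF C(12), of "ty' a"] by linarith
    qed
    define Lo where "Lo = {a \<in> A. grp a = 0}"
    have LoU: "Lo = {a \<in> A. ty a = (True, 0)} \<union> {a \<in> A. ty a = (False, 0)}" by (auto simp: Lo_def ty_def)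
    have "sum t ({a \<in> A. ty a = (True, 0)} \<union> {a \<in> A. ty a = (False, 0)}) =
        sum t {a \<in> A. ty a = (True, 0)} + sum t {a \<in> A. ty a = (False, 0)}"
      using finA by (intro sum.union_disjoint) auto
    then have "sum t Lo \<le> 2 * \<tau>" unfolding LoU using first[of True] first[of False] by linarith
    then have Lo: "(\<Sum>a\<in>Lo. s (ori a) a) \<le> 2 * \<tau>" by (simp add: t_def)
    have "area (slot_size len) S' = area (slot_size len) S"
      unfolding area_slots[OF fin\<Gamma> S'(2)] area_slots[OF fin\<Gamma> over] by (simp only: spec[OF S'(4)])
    also have "\<dots> = (\<Sum>a\<in>A. slot_size len True (ty a, t a) * slot_size len False (ty a, t a))"
      unfolding area_def S_def A_def using dist by (simp add: comp_def sum_list_distinct_conv_sum_set)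
    also have "\<dots> \<le> (\<Sum>a\<in>A. s True a * s False a)"
    proof (intro sum_mono mult_mono size)
      fix a assume a: "a \<in> A"
      show "0 \<le> slot_size len False (ty a, t a)"
        using t(1)[OF a] len\<rho>[of "ty a"] assms(1) by (simp add: slot_size_def)
      show "0 \<le> s True a" using pos[OF a] by (rule less_imp_le)
    qed
    also have "\<dots> = area s T" unfolding areaT by (intro sum.cong) (auto simp: prod)
    finally have area: "area plan_size C \<le> area s T" using C(4) by simp
    have "\<forall>d. extent plan_size d C \<le> extent s d T" using C(2) S'(3) Sext by (meson order_trans)
    moreover have "blocks C \<le> K" "card X \<le> K" using C(3,11) S'(1) by auto
    moreover have "set (all_contents C) \<subseteq> set (pieces T)" using C(6) by (auto simp: B_def A_def)
    moreover have "Lo \<subseteq> set (pieces T)" by (auto simp: Lo_def A_def)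
    moreover have "set (all_contents C) \<inter> Lo = {}" using C(6) by (auto simp: Lo_def B_def)
    moreover have "set (pieces T) \<subseteq> set (all_contents C) \<union> X \<union> Lo"
      using C(9) \<open>A' = {}\<close> by (auto simp: A_def[symmetric] B_def Lo_def)
    ultimately show ?thesis using C(1,5,10) area Lo by blast
  qed
  then show ?thesis using \<delta>(1) by (intro exI[of _ K] exI[of _ \<delta>]) blast
qed

section \<open>Packing small items by area\<close>

definition list_area :: "(bool \<Rightarrow> 'a \<Rightarrow> real) \<Rightarrow> 'a list \<Rightarrow> real" where
  "list_area s xs = (\<Sum>a\<leftarrow>xs. s True a * s False a)"

lemma list_area_append [simp]: "list_area s (xs @ ys) = list_area s xs + list_area s ys"
  by (simp add: list_area_def)

text \<open>Next-fit decreasing height: the area of a full shelf is charged against the height of the next one.\<close>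

lemma shelf_packing:
  fixes s :: "bool \<Rightarrow> 'a \<Rightarrow> real"
  assumes "sorted_wrt (\<lambda>a b. s False b \<le> s False a) xs" "\<forall>a\<in>set xs. 0 < s True a \<and> s True a \<le> \<sigma> \<and> 0 < s False a"
    and "\<sigma> \<le> p" "0 \<le> p" "0 \<le> q"
  shows "\<exists>T ys zs. xs = ys @ zs \<and> pieces T = ys \<and> extent s True T \<le> p \<and> extent s False T \<le> q \<and>
    (zs = [] \<or> (p - \<sigma>) * (q - s False (hd xs)) \<le> list_area s ys)"
  using assms(1,2,5)
proof (induction "length xs" arbitrary: xs q rule: less_induct)
  case less
  show ?case
  proof (cases xs)
    case Nil
    then show ?thesis using assms(4) less.prems by (intro exI[of _ Blank] exI[of _ "[]"]) simp
  next
    case (Cons a as)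
    show ?thesis
    proof (cases "s False a \<le> q")
      case False
      \<comment> \<open>If the first item is already too tall, the required area is not positive and
        the empty packing will do.\<close>
      have "(p - \<sigma>) * (q - s False a) \<le> 0" using False assms(3) by (intro mult_nonneg_nonpos) auto
      then show ?thesis using Cons assms(4) less.prems
        by (intro exI[of _ Blank] exI[of _ "[]"] exI[of _ xs]) (simp add: list_area_def)
    next
      case True
      obtain us vs where uv: "xs = us @ vs" and us: "sum_list (map (s True) us) \<le> p"
        and vs: "vs = [] \<or> p < sum_list (map (s True) us) + s True (hd vs)"
        using maximal_prefix[of xs "s True" p] less.prems(2) assms(4) by auto
      have ne: "us \<noteq> []"
      proof
        assume "us = []"
        then have "vs = xs" "p < s True a" using uv vs Cons by auto
        then show False using less.prems(2) Cons assms(3) by auto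
      qed
      then obtain us' where us': "us = a # us'" using uv Cons by (cases us) auto
      have heights: "s False b \<le> s False a" if "b \<in> set xs" for b
        using that less.prems(1) Cons by auto
      have ext1: "extent s True (chain True us) \<le> p" using us by (simp add: extent_chain_along)
      have "extent s (\<not> True) (chain True us) \<le> s False a"
        using heights uv less.prems(2)[unfolded Cons] by (intro extent_chain_across) (auto intro: less_imp_le)
      then have ext2: "extent s False (chain True us) \<le> s False a" by simp
      show ?thesis
      proof (cases "vs = []")
        case True
        then show ?thesis using uv ext1 ext2 \<open>s False a \<le> q\<close>
          by (intro exI[of _ "chain True us"] exI[of _ us] exI[of _ "[]"]) simp
      next
        case False
        have "length vs < length xs" using uv ne by simp
        moreover have "sorted_wrt (\<lambda>a b. s False b \<le> s False a) vs"
          using less.prems(1) uv by (simp add: sorted_wrt_append)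
        moreover have "\<forall>a\<in>set vs. 0 < s True a \<and> s True a \<le> \<sigma> \<and> 0 < s False a"
          using less.prems(2) uv by simp
        ultimately obtain T ys zs where T: "vs = ys @ zs" "pieces T = ys" "extent s True T \<le> p"
          "extent s False T \<le> q - s False a"
          "zs = [] \<or> (p - \<sigma>) * (q - s False a - s False (hd vs)) \<le> list_area s ys"
          using less.hyps[of vs "q - s False a"] True by auto
        have hv: "hd vs \<in> set vs" using False by simp
        then have hvs: "s True (hd vs) \<le> \<sigma>" "0 < s False (hd vs)" using less.prems(2) uv by auto
        have full: "p - \<sigma> \<le> sum_list (map (s True) us)" using vs False hvs(1) by linarith
        have "(p - \<sigma>) * s False (hd vs) \<le> sum_list (map (s True) us) * s False (hd vs)"
          using full hvs(2) by (intro mult_right_mono) auto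
        also have "\<dots> = (\<Sum>b\<leftarrow>us. s True b * s False (hd vs))" by (simp add: sum_list_mult_const)
        also have "\<dots> \<le> list_area s us"
          unfolding list_area_def using less.prems(1,2) uv hv
          by (intro sum_list_mono mult_left_mono) (auto simp: sorted_wrt_append intro: less_imp_le)
        finally have shelf: "(p - \<sigma>) * s False (hd vs) \<le> list_area s us" .
        have "zs = [] \<or> (p - \<sigma>) * (q - s False (hd xs)) \<le> list_area s (us @ ys)"
        proof (cases "zs = []")
          case False
          have "(p - \<sigma>) * (q - s False a) =
              (p - \<sigma>) * (q - s False a - s False (hd vs)) + (p - \<sigma>) * s False (hd vs)"
            by (simp add: algebra_simps)
          then show ?thesis using T(5) False shelf Cons by simp
        qed simp
        then show ?thesis using T uv ext1 ext2
          by (intro exI[of _ "Cut False (chain True us) T"] exI[of _ "us @ ys"] exI[of _ zs]) auto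
      qed
    qed
  qed
qed

text \<open>A rectangle with a side below \<zeta> has area at most \<zeta> and is given up.
  Otherwise it is a legitimate \<open>Area\<close> container because
  \<open>\<sigma> \<le> \<epsilon> * \<zeta>\<close>, and the shelves waste at most
  \<open>2 * \<sigma> \<le> \<zeta>\<close>.\<close>

lemma fill_rectangle:
  fixes s :: "bool \<Rightarrow> 'a \<Rightarrow> real"
  assumes "sorted_wrt (\<lambda>a b. s False b \<le> s False a) xs" "\<forall>a\<in>set xs. \<forall>d. 0 < s d a \<and> s d a \<le> \<sigma>"
    and "0 < \<sigma>" "2 * \<sigma> \<le> \<zeta>" "\<sigma> \<le> \<epsilon> * \<zeta>" "0 < \<epsilon>" "0 \<le> p" "p \<le> 1" "0 \<le> q" "q \<le> 1"
  shows "\<exists>R ys zs. xs = ys @ zs \<and> (\<forall>c\<in>set (pieces R). plan_ok \<epsilon> s c) \<and>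
    extent plan_size True R \<le> p \<and> extent plan_size False R \<le> q \<and> blocks R = 1 \<and> all_contents R = ys \<and>
    (zs = [] \<or> p * q - \<zeta> \<le> list_area s ys)"
proof (cases "p < \<zeta> \<or> q < \<zeta>")
  case True
  then have "p * q \<le> \<zeta>"
  proof
    assume "p < \<zeta>"
    then show ?thesis using mult_mono[of p \<zeta> q 1] assms by simp
  next
    assume "q < \<zeta>"
    then show ?thesis using mult_mono[of p 1 q \<zeta>] assms by simp
  qed
  then show ?thesis using assms by (intro exI[of _ Blank] exI[of _ "[]"] exI[of _ xs]) (simp add: list_area_def)
next
  case False
  have \<sigma>: "\<sigma> \<le> p" "\<sigma> \<le> q" using False assms by auto
  have "\<forall>a\<in>set xs. 0 < s True a \<and> s True a \<le> \<sigma> \<and> 0 < s False a" using assms(2) by blast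
  from shelf_packing[OF assms(1) this \<sigma>(1) assms(7,9)]
  obtain T ys zs where T: "xs = ys @ zs" "pieces T = ys" "extent s True T \<le> p" "extent s False T \<le> q"
    "zs = [] \<or> (p - \<sigma>) * (q - s False (hd xs)) \<le> list_area s ys" by blast
  have "s d a \<le> \<epsilon> * p" "s d a \<le> \<epsilon> * q" if "a \<in> set xs" for d a
  proof -
    have "s d a \<le> \<epsilon> * \<zeta>" using that assms(2,5) by (meson order_trans)
    moreover have "\<epsilon> * \<zeta> \<le> \<epsilon> * p" "\<epsilon> * \<zeta> \<le> \<epsilon> * q" using False assms(6) by auto
    ultimately show "s d a \<le> \<epsilon> * p" "s d a \<le> \<epsilon> * q" by linarith+
  qed
  then have ok: "plan_ok \<epsilon> s (Area, T, p, q)"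
    using T False assms by (auto simp: plan_ok_def)
  have "zs = [] \<or> p * q - \<zeta> \<le> list_area s ys"
  proof (cases "zs = []")
    case zs: False
    have "xs \<noteq> []" using zs T(1) by simp
    then have "hd xs \<in> set xs" by simp
    then have "s False (hd xs) \<le> \<sigma>" using assms(2) by blast
    then have "(p - \<sigma>) * (q - \<sigma>) \<le> (p - \<sigma>) * (q - s False (hd xs))" using \<sigma> by (intro mult_left_mono) auto
    moreover have "p * q - \<zeta> \<le> (p - \<sigma>) * (q - \<sigma>)"
    proof -
      have "\<sigma> * p + \<sigma> * q \<le> \<sigma> * 1 + \<sigma> * 1" using assms by (intro add_mono mult_left_mono) auto
      moreover have "0 \<le> \<sigma> * \<sigma>" by simp
      moreover have "(p - \<sigma>) * (q - \<sigma>) = p * q - (\<sigma> * p + \<sigma> * q) + \<sigma> * \<sigma>" by (simp add: algebra_simps)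
      ultimately show ?thesis using assms(4) by linarith
    qed
    ultimately show ?thesis using T(5) zs by linarith
  qed simp
  then show ?thesis using T ok
    by (intro exI[of _ "Piece (Area, T, p, q)"] exI[of _ ys] exI[of _ zs]) (simp add: plan_size_def contents_def)
qed

text \<open>A container in a leaf leaves two free rectangles, one above it and one beside it. This
  explains three leaves for one and a waste of at most \<open>2 * \<zeta>\<close> per leaf. If items
  remain, all other free area must have been used.\<close>

lemma fill_free_space:
  fixes s :: "bool \<Rightarrow> 'a \<Rightarrow> real"
  assumes "0 < \<sigma>" "2 * \<sigma> \<le> \<zeta>" "\<sigma> \<le> \<epsilon> * \<zeta>" "0 < \<epsilon>"
    and "sorted_wrt (\<lambda>a b. s False b \<le> s False a) xs" "\<forall>a\<in>set xs. \<forall>d. 0 < s d a \<and> s d a \<le> \<sigma>"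
    and "\<forall>c\<in>set (pieces C). plan_ok \<epsilon> s c" "a \<le> 1" "b \<le> 1"
    and "extent plan_size True C \<le> a" "extent plan_size False C \<le> b"
  shows "\<exists>C' ys zs. xs = ys @ zs \<and> (\<forall>c\<in>set (pieces C'). plan_ok \<epsilon> s c) \<and>
    extent plan_size True C' \<le> a \<and> extent plan_size False C' \<le> b \<and> blocks C' \<le> 3 * blocks C \<and>
    mset (all_contents C') = mset (all_contents C) + mset ys \<and>
    (zs = [] \<or> a * b - area plan_size C - 2 * real (blocks C) * \<zeta> \<le> list_area s ys)"
  using assms(5-)
proof (induction C arbitrary: a b xs)
  case Blank
  then have "0 \<le> a" "0 \<le> b" by auto
  from fill_rectangle[OF Blank.prems(1,2) assms(1-4) this(1) Blank.prems(4) this(2) Blank.prems(5)]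
  obtain R ys zs where R: "xs = ys @ zs" "\<forall>c\<in>set (pieces R). plan_ok \<epsilon> s c"
    "extent plan_size True R \<le> a" "extent plan_size False R \<le> b" "blocks R = 1" "all_contents R = ys"
    "zs = [] \<or> a * b - \<zeta> \<le> list_area s ys" by blast
  have "0 \<le> \<zeta>" using assms by linarith
  then show ?case using R by (intro exI[of _ R] exI[of _ ys] exI[of _ zs]) (auto simp: area_def)
next
  case (Piece c)
  define p where "p = plan_size True c"
  define q where "q = plan_size False c"
  have pq: "0 < p" "0 < q" "p \<le> a" "q \<le> b"
    using Piece.prems by (auto simp: p_def q_def plan_ok_def plan_size_def split: prod.splits)
  have "0 \<le> p" "p \<le> 1" "0 \<le> b - q" "b - q \<le> 1" using pq Piece.prems(4,5) by auto
  from fill_rectangle[OF Piece.prems(1,2) assms(1-4) this]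
  obtain R1 y1 z1 where R1: "xs = y1 @ z1" "\<forall>c\<in>set (pieces R1). plan_ok \<epsilon> s c"
    "extent plan_size True R1 \<le> p" "extent plan_size False R1 \<le> b - q" "blocks R1 = 1" "all_contents R1 = y1"
    "z1 = [] \<or> p * (b - q) - \<zeta> \<le> list_area s y1" by blast
  have "sorted_wrt (\<lambda>a b. s False b \<le> s False a) z1" "\<forall>a\<in>set z1. \<forall>d. 0 < s d a \<and> s d a \<le> \<sigma>"
    "0 \<le> a - p" "a - p \<le> 1" "0 \<le> b" "b \<le> 1"
    using pq Piece.prems R1(1) by (auto simp: sorted_wrt_append)
  from fill_rectangle[OF this(1,2) assms(1-4) this(3-6)]
  obtain R2 y2 z2 where R2: "z1 = y2 @ z2" "\<forall>c\<in>set (pieces R2). plan_ok \<epsilon> s c"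
    "extent plan_size True R2 \<le> a - p" "extent plan_size False R2 \<le> b" "blocks R2 = 1" "all_contents R2 = y2"
    "z2 = [] \<or> (a - p) * b - \<zeta> \<le> list_area s y2" by blast
  have "z2 = [] \<or> a * b - p * q - 2 * \<zeta> \<le> list_area s (y1 @ y2)"
    using R1(7) R2(1,7) by (auto simp: algebra_simps)
  then show ?case using R1 R2 Piece.prems(3) pq
    by (intro exI[of _ "Cut True (Cut False (Piece c) R1) R2"] exI[of _ "y1 @ y2"] exI[of _ z2])
      (auto simp: area_def p_def[symmetric] q_def[symmetric])
next
  case (Cut d A B)
  have okA: "\<forall>c\<in>set (pieces A). plan_ok \<epsilon> s c" and okB: "\<forall>c\<in>set (pieces B). plan_ok \<epsilon> s c"
    using Cut.prems(3) by auto
  have pos: "0 \<le> plan_size e c" if "c \<in> set (pieces A) \<union> set (pieces B)" for e c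
    using that okA okB by (fastforce simp: plan_ok_def plan_size_def split: prod.splits)
  have A: "0 \<le> extent plan_size e A" and B: "0 \<le> extent plan_size e B" for e
    using pos by (auto intro!: extent_nonneg)
  \<comment> \<open>Along the cut \<open>A\<close> keeps its extent and all slack goes to
    \<open>B\<close>, so the two regions tile the \<open>a\<close> by \<open>b\<close> rectangle and
    no free area escapes the count.\<close>
  define a1 where "a1 = (if d then extent plan_size True A else a)"
  define b1 where "b1 = (if d then b else extent plan_size False A)"
  define a2 where "a2 = (if d then a - extent plan_size True A else a)"
  define b2 where "b2 = (if d then b else b - extent plan_size False A)"
  have 1: "a1 \<le> 1" "b1 \<le> 1" "extent plan_size True A \<le> a1" "extent plan_size False A \<le> b1"
    using Cut.prems(4-7) B[of True] B[of False] by (auto simp: a1_def b1_def)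
  have 2: "a2 \<le> 1" "b2 \<le> 1" "extent plan_size True B \<le> a2" "extent plan_size False B \<le> b2"
    using Cut.prems(4-7) A[of True] A[of False] by (auto simp: a2_def b2_def)
  obtain CA y1 z1 where CA: "xs = y1 @ z1" "\<forall>c\<in>set (pieces CA). plan_ok \<epsilon> s c"
    "extent plan_size True CA \<le> a1" "extent plan_size False CA \<le> b1" "blocks CA \<le> 3 * blocks A"
    "mset (all_contents CA) = mset (all_contents A) + mset y1"
    "z1 = [] \<or> a1 * b1 - area plan_size A - 2 * real (blocks A) * \<zeta> \<le> list_area s y1"
    using Cut.IH(1)[OF Cut.prems(1,2) okA 1] by blast
  have "sorted_wrt (\<lambda>a b. s False b \<le> s False a) z1" "\<forall>a\<in>set z1. \<forall>d. 0 < s d a \<and> s d a \<le> \<sigma>"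
    using Cut.prems(1,2) CA(1) by (auto simp: sorted_wrt_append)
  from Cut.IH(2)[OF this okB 2]
  obtain CB y2 z2 where CB: "z1 = y2 @ z2" "\<forall>c\<in>set (pieces CB). plan_ok \<epsilon> s c"
    "extent plan_size True CB \<le> a2" "extent plan_size False CB \<le> b2" "blocks CB \<le> 3 * blocks B"
    "mset (all_contents CB) = mset (all_contents B) + mset y2"
    "z2 = [] \<or> a2 * b2 - area plan_size B - 2 * real (blocks B) * \<zeta> \<le> list_area s y2" by blast
  have "a1 * b1 + a2 * b2 = a * b" by (auto simp: a1_def b1_def a2_def b2_def algebra_simps)
  moreover have "area plan_size (Cut d A B) = area plan_size A + area plan_size B" by (simp add: area_def)
  moreover have "2 * real (blocks (Cut d A B)) * \<zeta> = 2 * real (blocks A) * \<zeta> + 2 * real (blocks B) * \<zeta>"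
    by (simp add: algebra_simps)
  ultimately have area: "z2 = [] \<or>
      a * b - area plan_size (Cut d A B) - 2 * real (blocks (Cut d A B)) * \<zeta> \<le> list_area s (y1 @ y2)"
    using CA(7) CB(1,7) by auto
  have "extent plan_size True (Cut d CA CB) \<le> a" "extent plan_size False (Cut d CA CB) \<le> b"
    using CA(3,4) CB(3,4) by (auto simp: a1_def b1_def a2_def b2_def split: if_splits)
  moreover have "xs = (y1 @ y2) @ z2" using CA(1) CB(1) by simp
  moreover have "\<forall>c\<in>set (pieces (Cut d CA CB)). plan_ok \<epsilon> s c" using CA(2) CB(2) by auto
  moreover have "blocks (Cut d CA CB) \<le> 3 * blocks (Cut d A B)" using CA(5) CB(5) by simp
  moreover have "mset (all_contents (Cut d CA CB)) = mset (all_contents (Cut d A B)) + mset (y1 @ y2)"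
    using CA(6) CB(6) by simp
  ultimately show ?case using area
    by (intro exI[of _ "Cut d CA CB"] exI[of _ "y1 @ y2"] exI[of _ z2] conjI)
qed

section \<open>Averaging and pigeonhole\<close>

lemma drop_largest_steps:
  fixes w :: "'a \<Rightarrow> real"
  assumes "finite S" "k \<le> card S"
  shows "\<exists>A\<subseteq>S. card A = card S - k \<and> real (card S) * sum w A \<le> real (card S - k) * sum w S"
  using assms(2)
proof (induction k)
  case 0
  then show ?case by auto
next
  case (Suc k)
  then obtain A where A: "A \<subseteq> S" "card A = card S - k" "real (card S) * sum w A \<le> real (card S - k) * sum w S"
    by auto
  have finA: "finite A" using A(1) assms(1) by (rule finite_subset)
  define n where "n = card S - Suc k"
  have cA: "card A = Suc n" using A(2) Suc.prems by (simp add: n_def)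
  then have "A \<noteq> {}" by auto
  then have "Max (w ` A) \<in> w ` A" using finA by (intro Max_in) auto
  \<comment> \<open>Removing a heaviest element does not raise the average weight.\<close>
  then obtain m where m: "m \<in> A" "w m = Max (w ` A)" by auto
  have wm: "\<forall>a\<in>A. w a \<le> w m" unfolding m(2) using finA by auto
  have sA: "sum w A = w m + sum w (A - {m})" using finA m(1) by (rule sum.remove)
  have "sum w A \<le> real (card A) * w m" using sum_bounded_above[of A w "w m"] wm by simp
  then have "real (Suc n) * sum w (A - {m}) \<le> real n * sum w A"
    unfolding cA using sA by (simp add: algebra_simps)
  then have "real (card S) * (real (Suc n) * sum w (A - {m})) \<le> real (card S) * (real n * sum w A)"
    by (intro mult_left_mono) auto
  also have "\<dots> = real n * (real (card S) * sum w A)" by simp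
  also have "\<dots> \<le> real n * (real (card S - k) * sum w S)" using A(3) by (intro mult_left_mono) auto
  also have "card S - k = Suc n" using Suc.prems by (simp add: n_def)
  finally have "real (Suc n) * (real (card S) * sum w (A - {m})) \<le> real (Suc n) * (real n * sum w S)"
    by (simp add: mult.left_commute)
  then have "real (card S) * sum w (A - {m}) \<le> real n * sum w S"
    by (rule mult_left_le_imp_le) simp
  moreover have "card (A - {m}) = n" using cA m(1) finA by simp
  ultimately show ?case using A(1) by (intro exI[of _ "A - {m}"]) (auto simp: n_def)
qed

text \<open>Removing the heaviest \<epsilon>-share of the elements removes at least an
  \<epsilon>-share of the weight; rounding their number up costs the extra 1.\<close>

lemma drop_largest:
  fixes w :: "'a \<Rightarrow> real"
  assumes "finite S" "\<forall>a\<in>S. 0 \<le> w a" "0 \<le> \<epsilon>" "\<epsilon> \<le> 1"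
  shows "\<exists>A\<subseteq>S. (1 - \<epsilon>) * real (card S) - 1 \<le> real (card A) \<and> sum w A \<le> (1 - \<epsilon>) * sum w S"
proof (cases "S = {}")
  case True
  then show ?thesis by auto
next
  case False
  define n where "n = card S"
  have n: "0 < n" using False assms(1) by (simp add: n_def card_gt_0_iff)
  define k where "k = nat \<lceil>\<epsilon> * real n\<rceil>"
  have "0 \<le> \<epsilon> * real n" using assms(3) by simp
  then have ck: "real k = of_int \<lceil>\<epsilon> * real n\<rceil>" by (simp add: k_def)
  have k1: "\<epsilon> * real n \<le> real k" and k2: "real k < \<epsilon> * real n + 1"
    using ceiling_correct[of "\<epsilon> * real n"] unfolding ck by linarith+
  have "\<epsilon> * real n \<le> real n" using assms(3,4) by (simp add: mult_left_le_one_le)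
  then have kn: "k \<le> n" by (simp add: k_def ceiling_le_iff nat_le_iff)
  obtain A where A: "A \<subseteq> S" "card A = n - k" "real n * sum w A \<le> real (n - k) * sum w S"
    using drop_largest_steps[OF assms(1), of k w] kn n_def by blast
  have "real (n - k) \<le> (1 - \<epsilon>) * real n" using k1 kn by (simp add: of_nat_diff algebra_simps)
  then have "real (n - k) * sum w S \<le> (1 - \<epsilon>) * real n * sum w S"
    using assms(2) by (intro mult_right_mono sum_nonneg) auto
  then have "real n * sum w A \<le> real n * ((1 - \<epsilon>) * sum w S)" using A(3) by (simp add: mult_ac)
  then have "sum w A \<le> (1 - \<epsilon>) * sum w S" using n by simp
  moreover have "(1 - \<epsilon>) * real (card S) - 1 \<le> real (card A)"
    using k2 kn A(2) by (simp add: of_nat_diff algebra_simps n_def)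
  ultimately show ?thesis using A(1) by blast
qed

lemma pigeonhole_disjoint:
  assumes "finite A" "\<forall>k<J. D k \<subseteq> A" "disjoint_family_on D {..<J}" "0 < J"
  shows "\<exists>k<J. real J * real (card (D k)) \<le> real (card A)"
proof (rule ccontr)
  assume "\<not> ?thesis"
  then have *: "\<forall>k<J. real (card A) < real J * real (card (D k))" by auto
  have fin: "\<forall>k\<in>{..<J}. finite (D k)" using assms(1,2) by (auto intro: finite_subset)
  have "real J * real (card A) = (\<Sum>k<J. real (card A))" by simp
  also have "\<dots> < (\<Sum>k<J. real J * real (card (D k)))"
    using * assms(4) by (intro sum_strict_mono) auto
  also have "\<dots> = real J * real (\<Sum>k<J. card (D k))" by (simp add: sum_distrib_left)
  also have "(\<Sum>k<J. card (D k)) = card (\<Union>k<J. D k)"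
    using fin assms(3) by (intro card_UN_disjoint[symmetric]) (auto simp: disjoint_family_on_def)
  also have "real J * real (card (\<Union>k<J. D k)) \<le> real J * real (card A)"
    using assms(1,2) by (intro mult_left_mono) (auto intro!: card_mono)
  finally show False by simp
qed

section \<open>Combining long and small items\<close>

text \<open>This is the direction of the shorter side, with ties going to \<open>False\<close>; thus
  \<open>thickness\<close> is the smaller and \<open>length_of\<close> the larger side in either
  orientation.\<close>

definition lean :: "(bool \<Rightarrow> 'l \<Rightarrow> real) \<Rightarrow> 'l \<Rightarrow> bool" where
  "lean s a \<longleftrightarrow> s True a < s False a"

abbreviation thickness :: "(bool \<Rightarrow> 'l \<Rightarrow> real) \<Rightarrow> 'l \<Rightarrow> real" where
  "thickness s a \<equiv> s (lean s a) a"

abbreviation length_of :: "(bool \<Rightarrow> 'l \<Rightarrow> real) \<Rightarrow> 'l \<Rightarrow> real" where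
  "length_of s a \<equiv> s (\<not> lean s a) a"

lemma thickness_le_length: "thickness s a \<le> length_of s a"
  by (cases "s True a < s False a") (simp_all add: lean_def)

lemma size_le_length: "s d a \<le> length_of s a"
  by (cases d; cases "s True a < s False a") (simp_all add: lean_def)

definition turnable :: "(bool \<Rightarrow> nat \<times> bool \<Rightarrow> real) \<Rightarrow> bool" where
  "turnable s \<longleftrightarrow> (\<forall>d i b. s d (i, \<not> b) = s (\<not> d) (i, b))"

definition turn :: "(bool \<Rightarrow> nat \<times> bool \<Rightarrow> real) \<Rightarrow> bool \<Rightarrow> nat \<times> bool \<Rightarrow> nat \<times> bool" where
  "turn s d a = (if lean s a = d then a else (fst a, \<not> snd a))"

lemma fst_turn [simp]: "fst (turn s d a) = fst a"
  by (simp add: turn_def)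

lemma size_turn:
  assumes "turnable s"
  shows "s d (turn s d a) = thickness s a" "s (\<not> d) (turn s d a) = length_of s a"
  using assms by (cases a; cases d; cases "lean s a"; auto simp: turn_def turnable_def)+

text \<open>\<open>T\<close> consists of long pieces and leaves a strip of width \<open>f\<close> free, \<open>S\<close> of small pieces. The pieces \<open>Out\<close>
  have tiny total thickness and all go into the strip, turned to be parallel to it.\<close>

definition strip_packs :: "real \<Rightarrow> real \<Rightarrow> real \<Rightarrow> real \<Rightarrow> real \<Rightarrow> real \<Rightarrow> nat \<Rightarrow> bool" where
  "strip_packs \<rho> \<epsilon> f e \<sigma> \<delta> K \<longleftrightarrow> (\<forall>s T d Out S. turnable s \<longrightarrow>
      (\<forall>a\<in>set (pieces T) \<union> Out \<union> S. \<forall>d. 0 < s d a \<and> s d a \<le> 1) \<longrightarrow>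
      (\<forall>a\<in>set (pieces T). \<rho> \<le> length_of s a \<and> thickness s a \<le> \<delta>) \<longrightarrow>
      (\<forall>a\<in>S. length_of s a \<le> \<sigma>) \<longrightarrow>
      distinct (pieces T) \<longrightarrow> finite Out \<longrightarrow> finite S \<longrightarrow>
      set (pieces T) \<inter> Out = {} \<longrightarrow> set (pieces T) \<inter> S = {} \<longrightarrow> Out \<inter> S = {} \<longrightarrow>
      inj_on fst (set (pieces T) \<union> Out \<union> S) \<longrightarrow>
      extent s d T \<le> 1 - f \<longrightarrow> extent s (\<not> d) T \<le> 1 \<longrightarrow>
      (\<Sum>a\<in>Out. thickness s a) * \<rho> \<le> 2 * e + 2 * e * 4 powr (2 / \<rho>) \<longrightarrow>
      area s T + (\<Sum>a\<in>S. s True a * s False a) \<le> 1 \<longrightarrow>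
      (\<exists>C. (\<forall>c\<in>set (pieces C). plan_ok \<epsilon> s c) \<and> (\<forall>d. extent plan_size d C \<le> 1) \<and> blocks C \<le> K \<and>
        distinct (map fst (all_contents C)) \<and>
        fst ` set (all_contents C) \<subseteq> fst ` (set (pieces T) \<union> Out \<union> S) \<and>
        real (length (pieces T)) + real (card Out) + (1 - \<epsilon>) * real (card S) - 1 - real K
          \<le> real (length (all_contents C))))"

text \<open>Only a part \<mu> of the freed width \<open>f\<close> goes to the items set aside. The
  rest is needed as area for the small items, which otherwise could not all be placed even after an
  \<epsilon>-share of them is dropped.\<close>

lemma ex_strip_packs:
  assumes "0 < \<rho>" "\<rho> \<le> 1" "0 < f" "f \<le> 1" "0 < \<epsilon>" "\<epsilon> \<le> 1"
  shows "\<exists>e \<sigma> \<delta> K. 0 < e \<and> e < f \<and> 0 < \<sigma> \<and> 0 < \<delta> \<and> strip_packs \<rho> \<epsilon> f e \<sigma> \<delta> K"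
proof -
  \<comment> \<open>Chosen so that \<open>4 * \<mu> = \<epsilon> * (f / 2)\<close>, to be compared
    with a loss of \<open>2 * \<mu>\<close> in the final case distinction.\<close>
  define \<mu> where "\<mu> = \<epsilon> * f / 8"
  define M where "M = 2 + 2 * 4 powr (2 / \<rho>)"
  \<comment> \<open>The bound on the thickness of \<open>Out\<close> equals
    \<open>e * M / \<rho>\<close>, which this choice makes at most \<open>\<mu> / 2\<close>. The
    other half of \<mu> is for \<open>Lo\<close>.\<close>
  define e where "e = min (f / 2) (\<rho> * \<mu> / (2 * M))"
  have \<mu>: "0 < \<mu>" "2 * \<mu> \<le> f / 4" using assms by (simp_all add: \<mu>_def)
  have M: "0 < M" by (simp add: M_def add_pos_nonneg)
  have e: "0 < e" "e < f" "e * M \<le> \<rho> * (\<mu> / 2)"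
  proof -
    show "0 < e" using assms \<mu> M by (simp add: e_def)
    show "e < f" using assms by (simp add: e_def min_less_iff_disj)
    have "e \<le> \<rho> * \<mu> / (2 * M)" by (simp add: e_def)
    then show "e * M \<le> \<rho> * (\<mu> / 2)" using M by (simp add: field_simps)
  qed
  have "0 < \<mu> / 4" using \<mu> by simp
  from pack_long[OF assms(1,2) this, where 'l = "nat \<times> bool"]
  obtain K1 \<delta> where \<delta>: "0 < \<delta>" and long: "\<forall>\<epsilon> (s :: bool \<Rightarrow> nat \<times> bool \<Rightarrow> real) ori T.
    (\<forall>a\<in>set (pieces T). long_thin s ori \<rho> a \<and> s (ori a) a \<le> \<delta>) \<longrightarrow> distinct (pieces T) \<longrightarrow>
    (\<forall>d. extent s d T \<le> 1) \<longrightarrow>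
    (\<exists>C Lo X. (\<forall>c\<in>set (pieces C). plan_ok \<epsilon> s c) \<and> (\<forall>d. extent plan_size d C \<le> extent s d T) \<and>
      blocks C \<le> K1 \<and> area plan_size C \<le> area s T \<and>
      distinct (all_contents C) \<and> set (all_contents C) \<subseteq> set (pieces T) \<and>
      Lo \<subseteq> set (pieces T) \<and> set (all_contents C) \<inter> Lo = {} \<and>
      set (pieces T) \<subseteq> set (all_contents C) \<union> X \<union> Lo \<and> finite X \<and> card X \<le> K1 \<and>
      (\<Sum>a\<in>Lo. s (ori a) a) \<le> 2 * (\<mu> / 4))" by blast
  \<comment> \<open>There are at most two wasted rectangles for each of the \<open>K1 + 1\<close>
    leaves, so the total waste is at most \<mu>.\<close>
  define \<zeta> where "\<zeta> = \<mu> / (2 * real (K1 + 1))"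
  define \<sigma> where "\<sigma> = min (\<zeta> / 2) (\<epsilon> * \<zeta>)"
  \<comment> \<open>One more leaf for the strip container, and a factor 3 from
    \<open>fill_free_space\<close>.\<close>
  define K where "K = 3 * (K1 + 1)"
  have \<zeta>: "0 < \<zeta>" using \<mu>(1) unfolding \<zeta>_def by (intro divide_pos_pos mult_pos_pos) simp_all
  have loss: "2 * real (K1 + 1) * \<zeta> = \<mu>" by (simp add: \<zeta>_def)
  have \<sigma>: "0 < \<sigma>" "2 * \<sigma> \<le> \<zeta>" "\<sigma> \<le> \<epsilon> * \<zeta>" using \<zeta> assms(5) by (auto simp: \<sigma>_def)
  have "\<exists>C. (\<forall>c\<in>set (pieces C). plan_ok \<epsilon> s c) \<and> (\<forall>d. extent plan_size d C \<le> 1) \<and> blocks C \<le> K \<and>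
        distinct (map fst (all_contents C)) \<and>
        fst ` set (all_contents C) \<subseteq> fst ` (set (pieces T) \<union> Out \<union> S) \<and>
        real (length (pieces T)) + real (card Out) + (1 - \<epsilon>) * real (card S) - 1 - real K
          \<le> real (length (all_contents C))"
    if turnable: "turnable s"
      and pos: "\<forall>a\<in>set (pieces T) \<union> Out \<union> S. \<forall>d. 0 < s d a \<and> s d a \<le> 1"
      and T: "\<forall>a\<in>set (pieces T). \<rho> \<le> length_of s a \<and> thickness s a \<le> \<delta>"
      and S: "\<forall>a\<in>S. length_of s a \<le> \<sigma>"
      and dist: "distinct (pieces T)" and fin: "finite Out" "finite S"
      and disj: "set (pieces T) \<inter> Out = {}" "set (pieces T) \<inter> S = {}" "Out \<inter> S = {}"
      and inj: "inj_on fst (set (pieces T) \<union> Out \<union> S)"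
      and ext: "extent s d T \<le> 1 - f" "extent s (\<not> d) T \<le> 1"
      and out: "(\<Sum>a\<in>Out. thickness s a) * \<rho> \<le> 2 * e + 2 * e * 4 powr (2 / \<rho>)"
      and area1: "area s T + (\<Sum>a\<in>S. s True a * s False a) \<le> 1"
    for s T d Out S
  proof -
    have ext1: "\<forall>c. extent s c T \<le> 1"
    proof
      fix c show "extent s c T \<le> 1" using ext assms(3) by (cases "c = d") auto
    qed
    have "\<forall>a\<in>set (pieces T). long_thin s (lean s) \<rho> a \<and> thickness s a \<le> \<delta>"
      using T pos by (auto simp: long_thin_def)
    with long[rule_format, of T s "lean s" \<epsilon>] dist ext1
    obtain C1 Lo X where C1: "\<forall>c\<in>set (pieces C1). plan_ok \<epsilon> s c" "\<forall>d. extent plan_size d C1 \<le> extent s d T"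
      "blocks C1 \<le> K1" "area plan_size C1 \<le> area s T"
      "distinct (all_contents C1)" "set (all_contents C1) \<subseteq> set (pieces T)"
      "Lo \<subseteq> set (pieces T)" "set (all_contents C1) \<inter> Lo = {}"
      "set (pieces T) \<subseteq> set (all_contents C1) \<union> X \<union> Lo" "finite X" "card X \<le> K1"
      "(\<Sum>a\<in>Lo. thickness s a) \<le> 2 * (\<mu> / 4)" by auto
    have finLo: "finite Lo" using C1(7) by (rule finite_subset) simp
    have LoOut: "Lo \<inter> Out = {}" using C1(7) disj(1) by blast
    obtain us where us: "set us = Lo \<union> Out" "distinct us"
      using finite_distinct_list[of "Lo \<union> Out"] finLo fin(1) by auto
    define strip where "strip = strip_plan d (map (turn s d) us) \<mu> 1"
    have sum_us: "(\<Sum>a\<leftarrow>us. thickness s a) \<le> \<mu>"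
    proof -
      have "(\<Sum>a\<leftarrow>us. thickness s a) = (\<Sum>a\<in>Lo \<union> Out. thickness s a)"
        using us by (simp add: sum_list_distinct_conv_sum_set)
      also have "\<dots> = (\<Sum>a\<in>Lo. thickness s a) + (\<Sum>a\<in>Out. thickness s a)"
        using finLo fin(1) LoOut by (rule sum.union_disjoint)
      also have "(\<Sum>a\<in>Out. thickness s a) \<le> \<mu> / 2"
      proof -
        have "(\<Sum>a\<in>Out. thickness s a) * \<rho> \<le> e * M" using out by (simp add: M_def algebra_simps)
        also have "\<dots> \<le> \<mu> / 2 * \<rho>" using e(3) by (simp add: mult.commute)
        finally show ?thesis using assms(1) by simp
      qed
      finally show ?thesis using C1(12) by simp
    qed
    have strip: "plan_ok \<epsilon> s strip"
      unfolding strip_def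
    proof (rule plan_ok_strip)
      show "sum_list (map (s d) (map (turn s d) us)) \<le> \<mu>"
        using sum_us size_turn(1)[OF turnable] by (simp add: comp_def)
      show "\<forall>a\<in>set (map (turn s d) us). s (\<not> d) a \<le> 1"
        using us(1) C1(7) pos size_turn(2)[OF turnable] by auto
    qed (use \<mu> in simp_all)
    \<comment> \<open>The long containers take at most \<open>1 - f\<close> along \<open>d\<close>,
      so a strip of width \<mu> fits beside them.\<close>
    define C2 where "C2 = Cut d C1 (Piece strip)"
    have C2ok: "\<forall>c\<in>set (pieces C2). plan_ok \<epsilon> s c" using C1(1) strip by (simp add: C2_def)
    have C2ext: "extent plan_size c C2 \<le> 1" for c
    proof (cases "c = d")
      case True
      have "extent plan_size d C1 + \<mu> \<le> 1" using spec[OF C1(2), of d] ext(1) \<mu> assms(3) by linarith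
      then show ?thesis using True by (simp add: C2_def strip_def)
    next
      case False
      then show ?thesis using spec[OF C1(2), of c] spec[OF ext1, of c] by (auto simp: C2_def strip_def)
    qed
    have C2blocks: "blocks C2 \<le> K1 + 1" using C1(3) by (simp add: C2_def)
    have C2area: "area plan_size C2 \<le> area s T + \<mu>"
      using C1(4) by (cases d) (simp_all add: C2_def strip_def area_def)
    have C2contents: "all_contents C2 = all_contents C1 @ map (turn s d) us"
      by (simp add: C2_def strip_def)
    let ?w = "\<lambda>a. s True a * s False a"
    have w: "0 < ?w a" if "a \<in> S" for a using pos that by auto
    have "\<forall>a\<in>S. 0 \<le> ?w a" using w by (auto intro: less_imp_le)
    from drop_largest[OF fin(2) this less_imp_le[OF assms(5)] assms(6)]
    obtain A where A: "A \<subseteq> S" "(1 - \<epsilon>) * real (card S) - 1 \<le> real (card A)" "sum ?w A \<le> (1 - \<epsilon>) * sum ?w S"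
      by blast
    have finA: "finite A" using A(1) fin(2) by (rule finite_subset)
    obtain vs where vs: "set vs = A" "distinct vs" using finite_distinct_list[OF finA] by blast
    define xs where "xs = sort_key (\<lambda>a. - s False a) vs"
    have xs: "set xs = A" "distinct xs" using vs by (simp_all add: xs_def)
    have "sorted (map (\<lambda>a. - s False a) xs)" by (simp add: xs_def)
    then have sorted: "sorted_wrt (\<lambda>a b. s False b \<le> s False a) xs" by (simp add: sorted_map)
    have small: "\<forall>a\<in>set xs. \<forall>d. 0 < s d a \<and> s d a \<le> \<sigma>"
    proof (intro ballI allI conjI)
      fix a c assume "a \<in> set xs"
      then have a: "a \<in> S" using xs A(1) by auto
      then show "0 < s c a" using pos by blast
      show "s c a \<le> \<sigma>" using size_le_length[of s c a] S a by force
    qed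
    from fill_free_space[OF \<sigma> assms(5) sorted small C2ok, of 1 1] C2ext
    obtain C3 ys zs where C3: "xs = ys @ zs" "\<forall>c\<in>set (pieces C3). plan_ok \<epsilon> s c"
      "extent plan_size True C3 \<le> 1" "extent plan_size False C3 \<le> 1" "blocks C3 \<le> 3 * blocks C2"
      "mset (all_contents C3) = mset (all_contents C2) + mset ys"
      "zs = [] \<or> 1 * 1 - area plan_size C2 - 2 * real (blocks C2) * \<zeta> \<le> list_area s ys" by auto
    have "zs = []"
    proof (rule ccontr)
      assume zs: "zs \<noteq> []"
      have la: "list_area s xs = sum ?w A"
        unfolding list_area_def using xs by (simp add: sum_list_distinct_conv_sum_set)
      have "0 < list_area s zs"
      proof -
        have "distinct zs" "set zs \<subseteq> S" using xs C3(1) A(1) by auto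
        then show ?thesis unfolding list_area_def using zs w
          by (simp add: sum_list_distinct_conv_sum_set) (intro sum_pos, auto)
      qed
      then have less: "list_area s ys < sum ?w A" using la C3(1) by simp
      have "real (blocks C2) \<le> real (K1 + 1)" using C2blocks by (simp only: of_nat_le_iff)
      then have "2 * real (blocks C2) * \<zeta> \<le> 2 * real (K1 + 1) * \<zeta>"
        using \<zeta> by (intro mult_right_mono mult_left_mono) auto
      then have ge: "1 - area s T - 2 * \<mu> \<le> list_area s ys" using C3(7) zs C2area loss by linarith
      have SA: "sum ?w A \<le> sum ?w S - \<epsilon> * sum ?w S" using A(3) by (simp add: algebra_simps)
      show False
      \<comment> \<open>The strip and the waste cost \<open>2 * \<mu>\<close> of area. If the small
        items have area at least \<open>f / 2\<close>, dropping the largest ones gains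
        \<open>4 * \<mu>\<close>. If not, the area \<open>f\<close> freed beside \<open>T\<close>
        exceeds their area by more than the cost.\<close>
      proof (cases "f / 2 \<le> sum ?w S")
        case True
        then have "\<epsilon> * (f / 2) \<le> \<epsilon> * sum ?w S" using assms(5) by (intro mult_left_mono) auto
        then have "4 * \<mu> \<le> \<epsilon> * sum ?w S" by (simp add: \<mu>_def)
        then show False using less ge SA area1 \<mu>(1) by linarith
      next
        case False
        have "area s T \<le> extent s True T * extent s False T"
          using pos by (intro area_le_extents) (auto intro: less_imp_le)
        also have "\<dots> \<le> 1 - f"
        proof -
          have nn: "0 \<le> extent s c T" for c using pos by (intro extent_nonneg) (auto intro: less_imp_le)
          have "extent s d T * extent s (\<not> d) T \<le> (1 - f) * 1"
            using ext nn assms(4) by (intro mult_mono) auto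
          then show ?thesis by (cases d) (simp_all add: mult.commute)
        qed
        finally have "area s T \<le> 1 - f" .
        moreover have "0 \<le> sum ?w S" using w by (intro sum_nonneg less_imp_le)
        then have "0 \<le> \<epsilon> * sum ?w S" using assms(5) by simp
        ultimately show False using less ge SA False \<mu> by linarith
      qed
    qed
    then have ys: "ys = xs" using C3(1) by simp
    have mset3: "mset (all_contents C3) = mset (all_contents C1 @ map (turn s d) us @ xs)"
      using C3(6) C2contents ys by simp
    have len3: "length (all_contents C3) = length (all_contents C1) + length us + length xs"
      using arg_cong[OF mset3, of size] by simp
    have set3: "fst ` set (all_contents C3) = fst ` (set (all_contents C1) \<union> set us \<union> set xs)"
    proof -
      have "set (all_contents C3) = set (all_contents C1) \<union> turn s d ` set us \<union> set xs"
        using arg_cong[OF mset3, of set_mset] by (simp add: Un_assoc)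
      then show ?thesis by (simp add: image_Un image_image)
    qed
    have "mset (map fst (all_contents C3)) = mset (map fst (all_contents C1 @ map (turn s d) us @ xs))"
      by (simp only: mset_map mset3)
    also have "map fst (all_contents C1 @ map (turn s d) us @ xs) = map fst (all_contents C1 @ us @ xs)"
      by (simp add: comp_def)
    finally have "mset (map fst (all_contents C3)) = mset (map fst (all_contents C1 @ us @ xs))" .
    then have "distinct (map fst (all_contents C3)) = distinct (map fst (all_contents C1 @ us @ xs))"
      by (rule mset_eq_imp_distinct_iff)
    moreover have "distinct (map fst (all_contents C1 @ us @ xs))"
    proof -
      have "distinct (all_contents C1 @ us @ xs)"
        using C1(5-8) us xs A(1) disj by auto
      moreover have "set (all_contents C1 @ us @ xs) \<subseteq> set (pieces T) \<union> Out \<union> S"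
        using C1(6,7) us xs A(1) by auto
      ultimately show ?thesis using inj by (simp only: distinct_map) (meson inj_on_subset)
    qed
    ultimately have dist3: "distinct (map fst (all_contents C3))" by simp
    have sub3: "fst ` set (all_contents C3) \<subseteq> fst ` (set (pieces T) \<union> Out \<union> S)"
      unfolding set3 using C1(6,7) us xs A(1) by (intro image_mono) auto
    have "length (pieces T) = card (set (pieces T))" using dist by (simp add: distinct_card)
    also have "\<dots> \<le> card (set (all_contents C1) \<union> X \<union> Lo)"
      using C1(9,10) finLo by (intro card_mono) auto
    also have "\<dots> \<le> card (set (all_contents C1)) + card X + card Lo"
      by (meson add_le_mono card_Un_le le_refl order_trans)
    also have "\<dots> \<le> length (all_contents C1) + K1 + card Lo"
      using C1(11) by (intro add_mono card_length) auto
    finally have cT: "length (pieces T) \<le> length (all_contents C1) + K1 + card Lo" .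
    have cus: "length us = card Lo + card Out"
      using us finLo fin(1) LoOut by (metis card_Un_disjoint distinct_card)
    have cxs: "length xs = card A" using xs by (metis distinct_card)
    have "real (length (pieces T)) \<le> real (length (all_contents C1)) + real K1 + real (card Lo)"
      using cT by (simp flip: of_nat_add)
    then have count: "real (length (pieces T)) + real (card Out) + (1 - \<epsilon>) * real (card S) - 1 - real K
        \<le> real (length (all_contents C3))"
      unfolding len3 cus cxs using A(2) by (simp add: K_def)
    have "blocks C3 \<le> K" using C3(5) C2blocks by (simp add: K_def)
    moreover have "\<forall>c. extent plan_size c C3 \<le> 1"
    proof
      fix c show "extent plan_size c C3 \<le> 1" using C3(3,4) by (cases c) auto
    qed
    ultimately show ?thesis using C3(2) dist3 sub3 count by blast
  qed
  then have "strip_packs \<rho> \<epsilon> f e \<sigma> \<delta> K" unfolding strip_packs_def by blast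
  then show ?thesis using e \<sigma>(1) \<delta> by blast
qed

lemma strip_packsD:
  assumes "strip_packs \<rho> \<epsilon> f e \<sigma> \<delta> K" "turnable s"
    and "\<forall>a\<in>set (pieces T) \<union> Out \<union> S. \<forall>d. 0 < s d a \<and> s d a \<le> 1"
    and "\<forall>a\<in>set (pieces T). \<rho> \<le> length_of s a \<and> thickness s a \<le> \<delta>" "\<forall>a\<in>S. length_of s a \<le> \<sigma>"
    and "distinct (pieces T)" "finite Out" "finite S"
    and "set (pieces T) \<inter> Out = {}" "set (pieces T) \<inter> S = {}" "Out \<inter> S = {}"
    and "inj_on fst (set (pieces T) \<union> Out \<union> S)"
    and "extent s d T \<le> 1 - f" "extent s (\<not> d) T \<le> 1"
    and "(\<Sum>a\<in>Out. thickness s a) * \<rho> \<le> 2 * e + 2 * e * 4 powr (2 / \<rho>)"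
    and "area s T + (\<Sum>a\<in>S. s True a * s False a) \<le> 1"
  shows "\<exists>C. (\<forall>c\<in>set (pieces C). plan_ok \<epsilon> s c) \<and> (\<forall>d. extent plan_size d C \<le> 1) \<and> blocks C \<le> K \<and>
    distinct (map fst (all_contents C)) \<and>
    fst ` set (all_contents C) \<subseteq> fst ` (set (pieces T) \<union> Out \<union> S) \<and>
    real (length (pieces T)) + real (card Out) + (1 - \<epsilon>) * real (card S) - 1 - real K
      \<le> real (length (all_contents C))"
  using assms(1)[unfolded strip_packs_def, rule_format, of s T Out S d] assms(2-) by blast

section \<open>Choosing the width of the strip by pigeonhole\<close>

lemma area_distinct: "distinct (pieces T) \<Longrightarrow> area s T = (\<Sum>a\<in>set (pieces T). s True a * s False a)"
  by (simp add: area_def sum_list_distinct_conv_sum_set)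

text \<open>The gap is between \<sigma> and \<rho>: every item is either long and thin or small in
  both directions. The loss \<open>1 + real K\<close> is additive here and becomes a share only for
  large inputs.\<close>

definition gap_packs :: "real \<Rightarrow> real \<Rightarrow> real \<Rightarrow> real \<Rightarrow> nat \<Rightarrow> bool" where
  "gap_packs \<epsilon> \<rho> \<sigma> \<delta> K \<longleftrightarrow> (\<forall>s T. turnable s \<longrightarrow>
    (\<forall>a\<in>set (pieces T). \<forall>d. 0 < s d a) \<longrightarrow>
    (\<forall>a\<in>set (pieces T). \<rho> \<le> length_of s a \<and> thickness s a \<le> \<delta> \<or> length_of s a \<le> \<sigma>) \<longrightarrow>
    distinct (map fst (pieces T)) \<longrightarrow> (\<forall>d. extent s d T \<le> 1) \<longrightarrow>
    (\<exists>C. (\<forall>c\<in>set (pieces C). plan_ok \<epsilon> s c) \<and> (\<forall>d. extent plan_size d C \<le> 1) \<and> blocks C \<le> K \<and>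
      distinct (map fst (all_contents C)) \<and> fst ` set (all_contents C) \<subseteq> fst ` set (pieces T) \<and>
      (1 - 2 * \<epsilon>) * real (length (pieces T)) - 1 - real K \<le> real (length (all_contents C))))"

lemma ex_gap_packs:
  assumes "0 < \<rho>" "\<rho> \<le> 1" "0 < \<epsilon>" "\<epsilon> \<le> 1"
  shows "\<exists>\<sigma> \<delta> K. 0 < \<sigma> \<and> \<sigma> < \<rho> \<and> 0 < \<delta> \<and> gap_packs \<epsilon> \<rho> \<sigma> \<delta> K"
proof -
  have "\<forall>f. \<exists>e \<sigma> \<delta> K. 0 < f \<longrightarrow> f \<le> 1 \<longrightarrow> 0 < e \<and> e < f \<and> 0 < \<sigma> \<and> 0 < \<delta> \<and> strip_packs \<rho> \<epsilon> f e \<sigma> \<delta> K"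
    using ex_strip_packs[OF assms(1,2) _ _ assms(3,4)] by blast
  then obtain E Sg De Ka where fn: "\<And>f. 0 < f \<Longrightarrow> f \<le> 1 \<Longrightarrow>
      0 < E f \<and> E f < f \<and> 0 < Sg f \<and> 0 < De f \<and> strip_packs \<rho> \<epsilon> f (E f) (Sg f) (De f) (Ka f)"
    by metis
  \<comment> \<open>The next width is half the present depth. The other half makes room for the
    thickness of an item straddling a border, as \<open>\<delta> \<le> E (F k) / 2\<close>.\<close>
  define F where "F k = ((\<lambda>f. E f / 2) ^^ k) \<rho>" for k
  have FS: "F (Suc k) = E (F k) / 2" for k by (simp add: F_def)
  have F: "0 < F k \<and> F k \<le> \<rho>" for k
  proof (induction k)
    case 0
    then show ?case using assms(1) by (simp add: F_def)
  next
    case (Suc k)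
    then show ?case using fn[of "F k"] assms(2) FS[of k] by auto
  qed
  have F1: "0 < F k" "F k \<le> 1" for k using F[of k] assms(2) by auto
  note fnF = fn[OF F1]
  have "F (Suc k) \<le> F k" for k using fnF[of k] FS[of k] by auto
  then have antimono: "F k' \<le> F k" if "k \<le> k'" for k k'
    using that by (rule lift_Suc_antimono_le)
  define J where "J = nat \<lceil>1 / \<epsilon>\<rceil>"
  have J: "1 / \<epsilon> \<le> real J" "0 < J" using assms(3) by (auto simp: J_def)
  \<comment> \<open>The index \<open>k\<close> is known only once the items are given, so \<sigma>,
    \<delta> and \<open>K\<close> must serve all \<open>J\<close> candidates.\<close>
  define \<sigma> where "\<sigma> = Min (insert (\<rho> / 2) ((\<lambda>k. Sg (F k)) ` {..<J}))"
  define \<delta> where "\<delta> = Min ((\<lambda>k. min (De (F k)) (E (F k) / 2)) ` {..<J})"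
  define K where "K = (\<Sum>k<J. Ka (F k))"
  have \<sigma>: "0 < \<sigma>" "\<sigma> \<le> \<rho> / 2"
  proof -
    show "0 < \<sigma>" unfolding \<sigma>_def using fnF assms(1) by (subst Min_gr_iff) auto
    show "\<sigma> \<le> \<rho> / 2" unfolding \<sigma>_def by (intro Min_le) auto
  qed
  have \<sigma>k: "\<sigma> \<le> Sg (F k)" if "k < J" for k unfolding \<sigma>_def using that by (intro Min_le) auto
  have \<delta>: "0 < \<delta>" unfolding \<delta>_def using fnF J by (subst Min_gr_iff) auto
  have \<delta>k: "\<delta> \<le> De (F k)" "\<delta> \<le> E (F k) / 2" if "k < J" for k
  proof -
    have "\<delta> \<le> min (De (F k)) (E (F k) / 2)" unfolding \<delta>_def using that by (intro Min_le) auto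
    then show "\<delta> \<le> De (F k)" "\<delta> \<le> E (F k) / 2" by auto
  qed
  have Kk: "Ka (F k) \<le> K" if "k < J" for k unfolding K_def using that by (intro member_le_sum) auto
  have "\<exists>C. (\<forall>c\<in>set (pieces C). plan_ok \<epsilon> s c) \<and> (\<forall>d. extent plan_size d C \<le> 1) \<and> blocks C \<le> K \<and>
      distinct (map fst (all_contents C)) \<and> fst ` set (all_contents C) \<subseteq> fst ` set (pieces T) \<and>
      (1 - 2 * \<epsilon>) * real (length (pieces T)) - 1 - real K \<le> real (length (all_contents C))"
    if turnable: "turnable s" and pos: "\<forall>a\<in>set (pieces T). \<forall>d. 0 < s d a"
      and kinds: "\<forall>a\<in>set (pieces T). \<rho> \<le> length_of s a \<and> thickness s a \<le> \<delta> \<or> length_of s a \<le> \<sigma>"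
      and distf: "distinct (map fst (pieces T))" and ext: "\<forall>d. extent s d T \<le> 1" for s T
  proof -
    have dist: "distinct (pieces T)" and inj: "inj_on fst (set (pieces T))" using distf by (auto simp: distinct_map)
    define TL where "TL = keep (\<lambda>a. \<rho> \<le> length_of s a) T"
    define S where "S = {a \<in> set (pieces T). \<not> \<rho> \<le> length_of s a}"
    have TLset: "set (pieces TL) = {a \<in> set (pieces T). \<rho> \<le> length_of s a}" by (auto simp: TL_def)
    have distTL: "distinct (pieces TL)" using dist by (simp add: TL_def)
    have small: "\<forall>a\<in>S. length_of s a \<le> \<sigma>" using kinds by (auto simp: S_def)
    have thin: "thickness s a \<le> \<delta>" if "a \<in> set (pieces TL)" for a
      using that kinds \<sigma> assms(1) by (force simp: TLset)
    have long: "\<forall>a\<in>set (pieces TL). long_thin s (lean s) \<rho> a" using pos by (auto simp: TLset long_thin_def)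
    have extTL: "extent s d TL \<le> 1" for d
    proof -
      have "extent s d TL \<le> extent s d T" unfolding TL_def using pos by (intro extent_keep_le) (auto intro: less_imp_le)
      then show ?thesis using ext by (meson order_trans)
    qed
    have extTL0: "0 \<le> extent s d TL" for d using pos by (intro extent_nonneg) (auto simp: TLset intro: less_imp_le)
    have size1: "s d a \<le> 1" if "a \<in> set (pieces T)" for d a
    proof -
      have "s d a \<le> extent s d T" using pos that by (intro extent_ge_piece) (auto intro: less_imp_le)
      then show ?thesis using ext by (meson order_trans)
    qed
    define L where "L = offsets s (lean s) (\<lambda>_. 0) TL"
    have Lfst: "map fst (pieces L) = pieces TL" by (simp only: pieces_fst L_def map_fst_offsets)
    have distLf: "distinct (map fst (pieces L))" using distTL Lfst by simp
    then have distL: "distinct (pieces L)" and injL: "inj_on fst (set (pieces L))" by (auto simp: distinct_map)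
    have LTL: "fst p \<in> set (pieces TL)" if "p \<in> set (pieces L)" for p
      using that Lfst by (metis image_eqI list.set_map)
    let ?t = "\<lambda>p. thickness s (fst p)"
    \<comment> \<open>Items straddling a border of the range belong to \<open>D k\<close> too: those
      across \<open>E (F k)\<close> are not counted by \<open>low_thickness\<close>, and those
      across \<open>F k\<close> would reach into the strip to be freed.\<close>
    define D where "D k = {p \<in> set (pieces L). E (F k) < snd p + ?t p \<and> snd p < F k}" for k
    have Ddisj: "D k \<inter> D k' = {}" if "k < k'" "k' < J" for k k'
    proof (rule ccontr)
      assume "D k \<inter> D k' \<noteq> {}"
      then obtain p where p: "p \<in> set (pieces L)" "E (F k) < snd p + ?t p" "snd p < F k'" by (auto simp: D_def)
      have "F k' \<le> E (F k) / 2" using antimono[of "Suc k" k'] FS[of k] that by simp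
      moreover have "?t p \<le> E (F k) / 2" using thin[OF LTL[OF p(1)]] \<delta>k(2)[of k] that by simp
      ultimately show False using p by linarith
    qed
    have "disjoint_family_on D {..<J}"
      unfolding disjoint_family_on_def
    proof (intro ballI impI)
      fix k k' assume "k \<in> {..<J}" "k' \<in> {..<J}" "k \<noteq> k'"
      then show "D k \<inter> D k' = {}" using Ddisj[of k k'] Ddisj[of k' k] by (cases "k < k'") auto
    qed
    moreover have "\<forall>k<J. D k \<subseteq> set (pieces L)" by (auto simp: D_def)
    ultimately obtain k where k: "k < J" "real J * real (card (D k)) \<le> real (card (set (pieces L)))"
      using pigeonhole_disjoint[of "set (pieces L)" J D] J(2) by auto
    define f where "f = F k"
    define e where "e = E f"
    have f: "0 < f" "f \<le> \<rho>" "f \<le> 1" using F[of k] F1[of k] by (simp_all add: f_def)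
    have e: "0 < e" "e < f" and packs: "strip_packs \<rho> \<epsilon> f e (Sg f) (De f) (Ka f)"
      using fnF[of k] by (auto simp: f_def e_def)
    have cL: "card (set (pieces L)) = length (pieces TL)" using distL Lfst by (metis distinct_card length_map)
    have cD: "real (card (D k)) \<le> \<epsilon> * real (length (pieces TL))"
    proof -
      have "1 \<le> \<epsilon> * real J" using J(1) assms(3) by (simp add: field_simps)
      then have "1 * real (card (D k)) \<le> \<epsilon> * real J * real (card (D k))"
        by (rule mult_right_mono) simp
      also have "\<dots> \<le> \<epsilon> * real (card (set (pieces L)))"
        using k(2) assms(3) by (simp add: mult.assoc)
      finally show ?thesis using cL by simp
    qed
    define T2 where "T2 = map_slicing fst (keep (\<lambda>p. f \<le> snd p) L)"
    define Low where "Low = {p \<in> set (pieces L). snd p + ?t p \<le> e}"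
    define Out where "Out = fst ` Low"
    have p2: "pieces T2 = map fst (filter (\<lambda>p. f \<le> snd p) (pieces L))" by (simp add: T2_def)
    have T2set: "set (pieces T2) = fst ` {p \<in> set (pieces L). f \<le> snd p}" by (simp add: p2)
    have T2sub: "set (pieces T2) \<subseteq> set (pieces TL)" using LTL by (auto simp: T2set)
    have Outsub: "Out \<subseteq> set (pieces TL)" using LTL by (auto simp: Out_def Low_def)
    have dist2: "distinct (pieces T2)" unfolding p2 using distLf by (simp add: distinct_map inj_on_def)
    have posL: "0 < ?t p" if "p \<in> set (pieces L)" for p using LTL[OF that] pos by (auto simp: TLset)
    have disj2: "set (pieces T2) \<inter> Out = {}"
    proof (rule ccontr)
      assume "set (pieces T2) \<inter> Out \<noteq> {}"
      then obtain a where a: "a \<in> set (pieces T2)" "a \<in> Out" by blast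
      obtain p where p: "p \<in> set (pieces L)" "f \<le> snd p" "a = fst p" using a(1) unfolding T2set by blast
      obtain q where q: "q \<in> Low" "a = fst q" using a(2) unfolding Out_def by blast
      note pq = p(1,2) q(1)
      have "q \<in> set (pieces L)" using q(1) by (simp add: Low_def)
      then have "p = q" using inj_onD[OF injL] p q(2) by simp
      then show False using pq e posL[OF pq(1)] by (auto simp: Low_def)
    qed
    have "\<exists>d. extent (\<lambda>d p. s d (fst p)) d (keep (\<lambda>p. f \<le> snd p) L) \<le> max 0 (extent s d TL - max 0 (f - 0))"
      unfolding L_def using keep_offsets_extent[OF long assms(1) less_imp_le[OF f(1)] f(2), of "\<lambda>_. 0"] by simp
    then obtain d where "extent (\<lambda>d p. s d (fst p)) d (keep (\<lambda>p. f \<le> snd p) L) \<le> max 0 (extent s d TL - max 0 (f - 0))"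
      by blast
    then have "extent s d T2 \<le> max 0 (extent s d TL - max 0 (f - 0))" by (simp only: T2_def extent_map)
    then have d: "extent s d T2 \<le> 1 - f" using extTL[of d] f by linarith
    have nd: "extent s (\<not> d) T2 \<le> 1"
    proof -
      have "extent (\<lambda>d p. s d (fst p)) (\<not> d) (keep (\<lambda>p. f \<le> snd p) L) \<le> extent s (\<not> d) TL"
        using pos by (intro extent_keep_offsets_le) (auto simp: TLset L_def intro: less_imp_le)
      then show ?thesis using extTL[of "\<not> d"] by (simp add: T2_def extent_map)
    qed
    have out: "(\<Sum>a\<in>Out. thickness s a) * \<rho> \<le> 2 * e + 2 * e * 4 powr (2 / \<rho>)"
    proof -
      have "(\<Sum>a\<in>Out. thickness s a) = (\<Sum>p\<in>Low. ?t p)"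
        unfolding Out_def by (rule sum.reindex[unfolded comp_def]) (use injL in \<open>auto simp: Low_def inj_on_def\<close>)
      also have "\<dots> = low_thickness s (lean s) e L"
        unfolding low_thickness_def Low_def using distL by (simp add: sum_list_distinct_conv_sum_set)
      finally have "(\<Sum>a\<in>Out. thickness s a) * \<rho> \<le> max 0 (e - 0) + max 0 (e - 0) +
          2 * e * 4 powr ((extent s True TL + extent s False TL) / \<rho>)"
        using low_thickness_offsets[OF long assms(1) less_imp_le[OF e(1)], of "\<lambda>_. 0"] extTL by (simp add: L_def)
      also have "4 powr ((extent s True TL + extent s False TL) / \<rho>) \<le> 4 powr (2 / \<rho>)"
        using extTL[of True] extTL[of False] assms(1) by (intro powr_mono divide_right_mono) auto
      then have "2 * e * 4 powr ((extent s True TL + extent s False TL) / \<rho>) \<le> 2 * e * 4 powr (2 / \<rho>)"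
        using e(1) by (intro mult_left_mono) auto
      finally show ?thesis using e(1) by simp
    qed
    let ?w = "\<lambda>a. s True a * s False a"
    have area: "area s T2 + sum ?w S \<le> 1"
    proof -
      have "area s T2 = sum ?w (set (pieces T2))" using dist2 by (rule area_distinct)
      also have "\<dots> \<le> sum ?w (set (pieces TL))"
        using T2sub pos by (intro sum_mono2) (auto simp: TLset intro!: mult_nonneg_nonneg less_imp_le)
      finally have "area s T2 + sum ?w S \<le> sum ?w (set (pieces TL)) + sum ?w S" by simp
      also have "\<dots> = sum ?w (set (pieces TL) \<union> S)"
        by (rule sum.union_disjoint[symmetric]) (auto simp: TLset S_def)
      also have "set (pieces TL) \<union> S = set (pieces T)" by (auto simp: TLset S_def)
      also have "sum ?w (set (pieces T)) = area s T" using dist by (simp add: area_distinct)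
      also have "\<dots> \<le> extent s True T * extent s False T"
        using pos by (intro area_le_extents) (auto intro: less_imp_le)
      also have "\<dots> \<le> 1 * 1"
        using ext pos by (intro mult_mono extent_nonneg) (auto intro: less_imp_le)
      finally show ?thesis by simp
    qed
    have sub: "set (pieces T2) \<union> Out \<union> S \<subseteq> set (pieces T)"
      using T2sub Outsub by (auto simp: TLset S_def)
    have "\<exists>C. (\<forall>c\<in>set (pieces C). plan_ok \<epsilon> s c) \<and> (\<forall>d. extent plan_size d C \<le> 1) \<and> blocks C \<le> Ka f \<and>
      distinct (map fst (all_contents C)) \<and>
      fst ` set (all_contents C) \<subseteq> fst ` (set (pieces T2) \<union> Out \<union> S) \<and>
      real (length (pieces T2)) + real (card Out) + (1 - \<epsilon>) * real (card S) - 1 - real (Ka f)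
        \<le> real (length (all_contents C))"
    proof (rule strip_packsD[OF packs turnable _ _ _ dist2 _ _ disj2 _ _ _ d nd out area])
      show "\<forall>a\<in>set (pieces T2) \<union> Out \<union> S. \<forall>d. 0 < s d a \<and> s d a \<le> 1"
        using sub pos size1 by blast
      show "\<forall>a\<in>set (pieces T2). \<rho> \<le> length_of s a \<and> thickness s a \<le> De f"
        using T2sub thin \<delta>k(1)[OF k(1)] by (force simp: TLset f_def)
      show "\<forall>a\<in>S. length_of s a \<le> Sg f" using small \<sigma>k[OF k(1)] by (force simp: f_def)
      show "finite Out" by (simp add: Out_def Low_def)
      show "finite S" by (simp add: S_def)
      show "set (pieces T2) \<inter> S = {}" using T2sub by (auto simp: TLset S_def)
      show "Out \<inter> S = {}" using Outsub by (auto simp: TLset S_def)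
      show "inj_on fst (set (pieces T2) \<union> Out \<union> S)" using inj sub by (rule inj_on_subset)
    qed
    then obtain C where C: "\<forall>c\<in>set (pieces C). plan_ok \<epsilon> s c" "\<forall>d. extent plan_size d C \<le> 1" "blocks C \<le> Ka f"
      "distinct (map fst (all_contents C))"
      "fst ` set (all_contents C) \<subseteq> fst ` (set (pieces T2) \<union> Out \<union> S)"
      "real (length (pieces T2)) + real (card Out) + (1 - \<epsilon>) * real (card S) - 1 - real (Ka f)
        \<le> real (length (all_contents C))" by blast
    have Kf: "Ka f \<le> K" using Kk[OF k(1)] by (simp add: f_def)
    have "length (pieces TL) \<le> length (pieces T2) + card (D k) + card Out"
    proof -
      have "set (pieces L) \<subseteq> {p \<in> set (pieces L). f \<le> snd p} \<union> D k \<union> Low"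
        by (auto simp: D_def Low_def f_def e_def)
      then have "card (set (pieces L)) \<le> card ({p \<in> set (pieces L). f \<le> snd p} \<union> D k \<union> Low)"
        by (intro card_mono) (auto simp: D_def Low_def)
      also have "\<dots> \<le> card {p \<in> set (pieces L). f \<le> snd p} + card (D k) + card Low"
        by (meson add_le_mono card_Un_le le_refl order_trans)
      also have "card {p \<in> set (pieces L). f \<le> snd p} = length (pieces T2)"
      proof -
        have "card {p \<in> set (pieces L). f \<le> snd p} = card (set (pieces T2))"
          unfolding T2set by (rule card_image[symmetric]) (use injL in \<open>auto simp: inj_on_def\<close>)
        then show ?thesis using dist2 by (simp add: distinct_card)
      qed
      also have "card Low = card Out"
        unfolding Out_def by (rule card_image[symmetric]) (use injL in \<open>auto simp: Low_def inj_on_def\<close>)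
      finally show ?thesis using cL by simp
    qed
    then have c1: "real (length (pieces TL)) \<le> real (length (pieces T2)) + real (card (D k)) + real (card Out)"
      by (simp flip: of_nat_add)
    have "length (pieces T) = length (pieces TL) + card S"
    proof -
      have "length (pieces T) = card (set (pieces T))" using dist by (simp add: distinct_card)
      also have "set (pieces T) = set (pieces TL) \<union> S" by (auto simp: TLset S_def)
      also have "card \<dots> = card (set (pieces TL)) + card S"
        by (rule card_Un_disjoint) (auto simp: TLset S_def)
      finally show ?thesis using distTL by (simp add: distinct_card)
    qed
    then have c2: "real (length (pieces T)) = real (length (pieces TL)) + real (card S)" by simp
    \<comment> \<open>One \<epsilon>-share pays for \<open>D k\<close> among the long items, the
      other for the small items given up by \<open>strip_packs\<close>.\<close>
    have "(1 - 2 * \<epsilon>) * real (length (pieces T)) =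
        real (length (pieces TL)) - \<epsilon> * real (length (pieces TL)) + (1 - \<epsilon>) * real (card S)
        - \<epsilon> * real (length (pieces TL)) - \<epsilon> * real (card S)"
      unfolding c2 by (simp add: algebra_simps)
    moreover have "0 \<le> \<epsilon> * real (length (pieces TL))" "0 \<le> \<epsilon> * real (card S)" using assms(3) by simp_all
    moreover have "real (Ka f) \<le> real K" using Kf by simp
    ultimately have "(1 - 2 * \<epsilon>) * real (length (pieces T)) - 1 - real K \<le> real (length (all_contents C))"
      using C(6) c1 cD by linarith
    moreover have "fst ` set (all_contents C) \<subseteq> fst ` set (pieces T)" using C(5) sub by blast
    moreover have "blocks C \<le> K" using C(3) Kf by simp
    ultimately show ?thesis using C(1,2,4) by blast
  qed
  then have "gap_packs \<epsilon> \<rho> \<sigma> \<delta> K" unfolding gap_packs_def by blast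
  moreover have "\<sigma> < \<rho>" using \<sigma> assms(1) by simp
  ultimately show ?thesis using \<sigma>(1) \<delta> by blast
qed

text \<open>Two obstacles to \<open>gap_packs\<close> are removed. Items of medium length are an
  \<epsilon>-share for some index by pigeonhole, and items thick in both directions are boundedly
  many by area. Inputs too small for the additive losses get one \<open>Large\<close> container per
  item.\<close>

lemma container_packing_of_slicing:
  assumes "0 < \<epsilon>" "\<epsilon> \<le> 1"
  shows "\<exists>K. \<forall>s T. turnable s \<longrightarrow> (\<forall>a\<in>set (pieces T). \<forall>d. 0 < s d a) \<longrightarrow>
    distinct (map fst (pieces T)) \<longrightarrow> (\<forall>d. extent s d T \<le> 1) \<longrightarrow>
    (\<exists>C. (\<forall>c\<in>set (pieces C). plan_ok \<epsilon> s c) \<and> (\<forall>d. extent plan_size d C \<le> 1) \<and> length (pieces C) \<le> K \<and>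
      distinct (map fst (all_contents C)) \<and> fst ` set (all_contents C) \<subseteq> fst ` set (pieces T) \<and>
      (1 - 4 * \<epsilon>) * real (length (pieces T)) \<le> real (length (all_contents C)))"
proof -
  have "\<forall>\<rho>. \<exists>\<sigma> \<delta> K. 0 < \<rho> \<longrightarrow> \<rho> \<le> 1 \<longrightarrow> 0 < \<sigma> \<and> \<sigma> < \<rho> \<and> 0 < \<delta> \<and> gap_packs \<epsilon> \<rho> \<sigma> \<delta> K"
    using ex_gap_packs[OF _ _ assms] by blast
  then obtain Sg De Ka where fn: "\<And>\<rho>. 0 < \<rho> \<Longrightarrow> \<rho> \<le> 1 \<Longrightarrow>
      0 < Sg \<rho> \<and> Sg \<rho> < \<rho> \<and> 0 < De \<rho> \<and> gap_packs \<epsilon> \<rho> (Sg \<rho>) (De \<rho>) (Ka \<rho>)"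
    by metis
  \<comment> \<open>Each threshold for long items is the previous threshold for small ones, so the
    open length intervals of \<open>medium\<close> are disjoint.\<close>
  define R where "R j = (Sg ^^ j) 1" for j
  have RS: "R (Suc j) = Sg (R j)" for j by (simp add: R_def)
  have R: "0 < R j \<and> R j \<le> 1" for j
  proof (induction j)
    case 0
    then show ?case by (simp add: R_def)
  next
    case (Suc j)
    then show ?case using fn[of "R j"] RS[of j] by auto
  qed
  have R1: "0 < R j" "R j \<le> 1" for j using R[of j] by auto
  note fnR = fn[OF R1]
  have "R (Suc j) \<le> R j" for j using fnR[of j] RS[of j] by auto
  then have antimono: "R j' \<le> R j" if "j \<le> j'" for j j'
    using that by (rule lift_Suc_antimono_le)
  define J where "J = nat \<lceil>1 / \<epsilon>\<rceil>"
  have J: "1 / \<epsilon> \<le> real J" "0 < J" using assms(1) by (auto simp: J_def)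
  define \<delta> where "\<delta> = Min ((\<lambda>j. De (R j)) ` {..<J})"
  define K1 where "K1 = (\<Sum>j<J. Ka (R j))"
  \<comment> \<open>Beyond \<open>N\<close> items the loss 1, the loss \<open>K1\<close> and the
    thick items together amount to at most one \<epsilon>-share.\<close>
  define N where "N = (1 + real K1 + 1 / \<delta>\<^sup>2) / \<epsilon>"
  define K where "K = K1 + nat \<lceil>N\<rceil>"
  have \<delta>: "0 < \<delta>" unfolding \<delta>_def using fnR J by (subst Min_gr_iff) auto
  have \<delta>j: "\<delta> \<le> De (R j)" if "j < J" for j unfolding \<delta>_def using that by (intro Min_le) auto
  have Kj: "Ka (R j) \<le> K1" if "j < J" for j unfolding K1_def using that by (intro member_le_sum) auto
  have "\<exists>C. (\<forall>c\<in>set (pieces C). plan_ok \<epsilon> s c) \<and> (\<forall>d. extent plan_size d C \<le> 1) \<and> length (pieces C) \<le> K \<and>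
      distinct (map fst (all_contents C)) \<and> fst ` set (all_contents C) \<subseteq> fst ` set (pieces T) \<and>
      (1 - 4 * \<epsilon>) * real (length (pieces T)) \<le> real (length (all_contents C))"
    if turnable: "turnable s" and pos: "\<forall>a\<in>set (pieces T). \<forall>d. 0 < s d a"
      and distf: "distinct (map fst (pieces T))" and ext: "\<forall>d. extent s d T \<le> 1" for s T
  proof (cases "real (length (pieces T)) \<le> N")
    case True
    define C where "C = map_slicing (\<lambda>a. (Large, Piece a, s True a, s False a)) T"
    have "extent plan_size d C = extent s d T" for d
    proof -
      have "extent plan_size d C = extent (\<lambda>d a. plan_size d (Large, Piece a, s True a, s False a)) d T"
        by (simp add: C_def extent_map)
      also have "\<dots> = extent s d T" by (intro extent_cong) (simp add: plan_size_def)
      finally show ?thesis .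
    qed
    moreover have "\<forall>c\<in>set (pieces C). plan_ok \<epsilon> s c" using pos by (auto simp: C_def plan_ok_def)
    moreover have "all_contents C = pieces T"
      by (simp add: C_def all_contents_def contents_def comp_def)
    moreover have "length (pieces C) \<le> K" using True unfolding K_def by (simp add: C_def) linarith
    moreover have "(1 - 4 * \<epsilon>) * real (length (pieces T)) \<le> real (length (pieces T))"
      using mult_right_mono[of "1 - 4 * \<epsilon>" 1 "real (length (pieces T))"] assms(1) by simp
    ultimately show ?thesis using ext distf by (intro exI[of _ C]) simp
  next
    case False
    have dist: "distinct (pieces T)" using distf by (simp add: distinct_map)
    define A where "A = set (pieces T)"
    define n where "n = card A"
    have lenT: "length (pieces T) = n" using dist by (simp add: n_def A_def distinct_card)
    have finA: "finite A" by (simp add: A_def)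
    \<comment> \<open>Both sides of such an item exceed \<delta>, so the unit square has area for at
      most \<open>1 / \<delta>\<^sup>2\<close> of them.\<close>
    define big where "big = {a \<in> A. \<delta> < thickness s a}"
    define medium where "medium j = {a \<in> A. R (Suc j) < length_of s a \<and> length_of s a < R j}" for j
    have "real (card big) * \<delta>\<^sup>2 \<le> 1"
    proof -
      have "real (card big) * \<delta>\<^sup>2 = (\<Sum>a\<in>big. \<delta> * \<delta>)" by (simp add: power2_eq_square)
      also have "\<dots> \<le> (\<Sum>a\<in>big. s True a * s False a)"
      proof (rule sum_mono)
        fix a assume "a \<in> big"
        then have "\<delta> < thickness s a" by (simp add: big_def)
        moreover from this have "\<delta> < length_of s a" using thickness_le_length[of s a] by linarith
        ultimately have "\<delta> \<le> s d a" for d by (cases "d = lean s a") auto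
        then show "\<delta> * \<delta> \<le> s True a * s False a" using \<delta> by (intro mult_mono) (auto intro: order_trans[of 0 \<delta>])
      qed
      also have "\<dots> \<le> (\<Sum>a\<in>A. s True a * s False a)"
        using pos finA by (intro sum_mono2) (auto simp: big_def A_def intro!: mult_nonneg_nonneg less_imp_le)
      also have "\<dots> = area s T" using dist by (simp add: area_distinct A_def)
      also have "\<dots> \<le> extent s True T * extent s False T"
        using pos by (intro area_le_extents) (auto intro: less_imp_le)
      also have "\<dots> \<le> 1 * 1"
        using ext pos by (intro mult_mono extent_nonneg) (auto intro: less_imp_le)
      finally show ?thesis by simp
    qed
    then have cbig: "real (card big) \<le> 1 / \<delta>\<^sup>2" using \<delta> by (simp add: field_simps)
    have disj: "medium j \<inter> medium j' = {}" if "j < j'" for j j'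
      using antimono[of "Suc j" j'] that by (auto simp: medium_def)
    have "disjoint_family_on medium {..<J}"
      unfolding disjoint_family_on_def
    proof (intro ballI impI)
      fix j j' assume "j \<in> {..<J}" "j' \<in> {..<J}" "j \<noteq> j'"
      then show "medium j \<inter> medium j' = {}" using disj[of j j'] disj[of j' j] by (cases "j < j'") auto
    qed
    moreover have "\<forall>j<J. medium j \<subseteq> A" by (auto simp: medium_def)
    ultimately obtain j where j: "j < J" "real J * real (card (medium j)) \<le> real n"
      using pigeonhole_disjoint[OF finA _ _ J(2), of medium] by (auto simp: n_def)
    have cmed: "real (card (medium j)) \<le> \<epsilon> * real n"
    proof -
      have "1 \<le> \<epsilon> * real J" using J(1) assms(1) by (simp add: field_simps)
      then have "1 * real (card (medium j)) \<le> \<epsilon> * real J * real (card (medium j))"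
        by (rule mult_right_mono) simp
      also have "\<dots> \<le> \<epsilon> * real n" using j(2) assms(1) by (simp add: mult.assoc)
      finally show ?thesis by simp
    qed
    define T' where "T' = keep (\<lambda>a. a \<notin> big \<union> medium j) T"
    have setT': "set (pieces T') = A - (big \<union> medium j)" by (auto simp: T'_def A_def)
    have distT': "distinct (map fst (pieces T'))" using distf by (simp add: T'_def distinct_map_filter)
    have extT': "\<forall>d. extent s d T' \<le> 1"
    proof
      fix d
      have "extent s d T' \<le> extent s d T"
        unfolding T'_def using pos by (intro extent_keep_le) (auto intro: less_imp_le)
      then show "extent s d T' \<le> 1" using ext by (meson order_trans)
    qed
    have kinds: "\<forall>a\<in>set (pieces T'). R j \<le> length_of s a \<and> thickness s a \<le> De (R j) \<or> length_of s a \<le> Sg (R j)"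
      using \<delta>j[OF j(1)] by (auto simp: setT' big_def medium_def RS)
    have posT': "\<forall>a\<in>set (pieces T'). \<forall>d. 0 < s d a" using pos by (auto simp: setT' A_def)
    have "gap_packs \<epsilon> (R j) (Sg (R j)) (De (R j)) (Ka (R j))" using fnR[of j] by blast
    then obtain C where C: "\<forall>c\<in>set (pieces C). plan_ok \<epsilon> s c" "\<forall>d. extent plan_size d C \<le> 1"
      "blocks C \<le> Ka (R j)" "distinct (map fst (all_contents C))"
      "fst ` set (all_contents C) \<subseteq> fst ` set (pieces T')"
      "(1 - 2 * \<epsilon>) * real (length (pieces T')) - 1 - real (Ka (R j)) \<le> real (length (all_contents C))"
      unfolding gap_packs_def using turnable posT' kinds distT' extT' by blast
    have "length (pieces T') = card (A - (big \<union> medium j))"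
      using distT' setT' by (metis distinct_card distinct_map)
    moreover have "n \<le> card (A - (big \<union> medium j)) + (card big + card (medium j))"
    proof -
      have "n \<le> card ((A - (big \<union> medium j)) \<union> (big \<union> medium j))"
        unfolding n_def using finA by (intro card_mono) (auto simp: big_def medium_def)
      also have "\<dots> \<le> card (A - (big \<union> medium j)) + card (big \<union> medium j)" by (rule card_Un_le)
      also have "card (big \<union> medium j) \<le> card big + card (medium j)" by (rule card_Un_le)
      finally show ?thesis by simp
    qed
    ultimately have "n \<le> length (pieces T') + (card big + card (medium j))" by simp
    then have "real n \<le> real (length (pieces T')) + (real (card big) + real (card (medium j)))"
      by (simp flip: of_nat_add)
    then have cT': "real n - 1 / \<delta>\<^sup>2 - \<epsilon> * real n \<le> real (length (pieces T'))" using cbig cmed by linarith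
    have "length (pieces T') \<le> n" unfolding T'_def lenT[symmetric] by simp
    then have "\<epsilon> * real (length (pieces T')) \<le> \<epsilon> * real n" using assms(1) by simp
    then have c1: "real n - 1 / \<delta>\<^sup>2 - 3 * (\<epsilon> * real n) \<le> (1 - 2 * \<epsilon>) * real (length (pieces T'))"
      using cT' by (simp add: algebra_simps)
    have "N < real n" using False lenT by simp
    then have "\<epsilon> * N \<le> \<epsilon> * real n" using assms(1) by simp
    then have "1 + real K1 + 1 / \<delta>\<^sup>2 \<le> \<epsilon> * real n" using assms(1) by (simp add: N_def)
    moreover have "real (Ka (R j)) \<le> real K1" using Kj[OF j(1)] by simp
    ultimately have "(1 - 4 * \<epsilon>) * real n \<le> real (length (all_contents C))"
      using C(6) c1 by (simp add: algebra_simps)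
    then have "(1 - 4 * \<epsilon>) * real (length (pieces T)) \<le> real (length (all_contents C))" using lenT by simp
    moreover have "length (pieces C) \<le> K"
      using length_pieces_le[of C] C(3) Kj[OF j(1)] by (simp add: K_def)
    moreover have "fst ` set (all_contents C) \<subseteq> fst ` set (pieces T)" using C(5) by (auto simp: setT' A_def)
    ultimately show ?thesis using C(1,2,4) by blast
  qed
  then show ?thesis by blast
qed

section \<open>From instances to slicing trees of the unit square and back\<close>

lemma item_size_flip: "item_size G d (i, \<not> b) = item_size G (\<not> d) (i, b)"
  by (cases d; cases b) (simp_all add: item_size_def placed_size_def)

lemma feasible_imp_slicing:
  assumes "valid_instance G" "feasible G P"
  shows "\<exists>T. distinct (map fst (pieces T)) \<and> fst ` set (pieces T) = dom P \<and>
    (\<forall>d. extent (item_size G) d T \<le> real (side G))"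
proof -
  let ?r = "placed_rect G P"
  have dom: "dom P \<subseteq> items G" and pack: "guillotine_packing ?r (knapsack G) (dom P)"
    using assms(2) by (auto simp: feasible_def)
  have fin: "finite (dom P)" using dom assms(1) by (auto simp: valid_instance_def intro: finite_subset)
  define lab where "lab i = (i, snd (the (P i)))" for i
  have size: "rect_size ?r d i = item_size G d (lab i)" for d i
    by (cases "the (P i)")
      (auto simp: rect_size_def placed_rect_def item_size_def lab_def rect_width_def rect_height_def)
  have proper: "proper_rect (?r i)" if "i \<in> dom P" for i
  proof -
    have "item_size G d (lab i) > 0" for d
      using that dom assms(1) by (auto simp: valid_instance_def item_size_def placed_size_def lab_def)
    then have "rect_size ?r d i > 0" for d using size by simp
    from this[of True] this[of False] show ?thesis by (simp add: proper_rect_def rect_size_def)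
  qed
  have kw: "rect_width (knapsack G) = real (side G)" "rect_height (knapsack G) = real (side G)"
    by (simp_all add: knapsack_def rect_width_def rect_height_def)
  have "\<exists>T. distinct (pieces T) \<and> set (pieces T) = dom P \<and>
    extent (rect_size ?r) True T \<le> rect_width (knapsack G) \<and> extent (rect_size ?r) False T \<le> rect_height (knapsack G)"
    using pack proper fin kw by (intro guillotine_separable_imp_slicing) (auto simp: guillotine_packing_def)
  then obtain T where T: "distinct (pieces T)" "set (pieces T) = dom P"
    "extent (rect_size ?r) True T \<le> real (side G)" "extent (rect_size ?r) False T \<le> real (side G)"
    unfolding kw by blast
  have "extent (item_size G) d (map_slicing lab T) = extent (rect_size ?r) d T" for d
    unfolding extent_map by (intro extent_cong) (simp add: size)
  then have "extent (item_size G) d (map_slicing lab T) \<le> real (side G)" for d using T(3,4) by (cases d) auto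
  moreover have "map fst (pieces (map_slicing lab T)) = pieces T" by (simp add: comp_def lab_def)
  then have "distinct (map fst (pieces (map_slicing lab T)))" "fst ` set (pieces (map_slicing lab T)) = dom P"
    using T(1,2) by (simp_all only: set_map[symmetric])
  ultimately show ?thesis by blast
qed

lemma plan_ok_scale:
  assumes "plan_ok \<epsilon> (\<lambda>d a. s d a / N) (k, T, w, h)" "0 < N"
  shows "plan_ok \<epsilon> s (k, T, N * w, N * h)"
proof -
  have e: "extent s d T = N * extent (\<lambda>d a. s d a / N) d T" for d
  proof -
    have "extent (\<lambda>d a. N * (s d a / N)) d T = N * extent (\<lambda>d a. s d a / N) d T"
      using assms(2) by (intro extent_scale) simp
    then show ?thesis using assms(2) by simp
  qed
  have "s True a \<le> \<epsilon> * (N * w) \<and> s False a \<le> \<epsilon> * (N * h)"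
    if "s True a / N \<le> \<epsilon> * w \<and> s False a / N \<le> \<epsilon> * h" for a
    using that assms(2) by (simp add: field_simps)
  then show ?thesis using assms unfolding plan_ok_def prod.case e
    by (cases k) (auto intro: mult_left_mono)
qed

text \<open>Dividing all sizes by the side of the knapsack leads to the unit square and makes
  \<open>K\<close> a function of \<epsilon> alone. The plans are scaled back afterwards, which
  respects the \<open>Area\<close> condition because it is a ratio.\<close>

lemma container_packing_of_feasible:
  assumes "0 < \<epsilon>" "\<epsilon> \<le> 1"
  shows "\<exists>K. \<forall>G P. valid_instance G \<longrightarrow> feasible G P \<longrightarrow>
    (\<exists>Q. guillotine_container_packed \<epsilon> K G Q \<and> (1 - 4 * \<epsilon>) * real (profit P) \<le> real (profit Q))"
proof -
  obtain K where K: "\<And>s T. turnable s \<Longrightarrow> (\<forall>a\<in>set (pieces T). \<forall>d. 0 < s d a) \<Longrightarrow>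
    distinct (map fst (pieces T)) \<Longrightarrow> (\<forall>d. extent s d T \<le> 1) \<Longrightarrow>
    (\<exists>C. (\<forall>c\<in>set (pieces C). plan_ok \<epsilon> s c) \<and> (\<forall>d. extent plan_size d C \<le> 1) \<and> length (pieces C) \<le> K \<and>
      distinct (map fst (all_contents C)) \<and> fst ` set (all_contents C) \<subseteq> fst ` set (pieces T) \<and>
      (1 - 4 * \<epsilon>) * real (length (pieces T)) \<le> real (length (all_contents C)))"
    using container_packing_of_slicing[OF assms] by metis
  have "\<exists>Q. guillotine_container_packed \<epsilon> K G Q \<and> (1 - 4 * \<epsilon>) * real (profit P) \<le> real (profit Q)"
    if G: "valid_instance G" and P: "feasible G P" for G P
  proof -
    define N where "N = real (side G)"
    have N: "0 < N" using G by (simp add: valid_instance_def N_def)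
    define s where "s d a = item_size G d a / N" for d a
    obtain T where T: "distinct (map fst (pieces T))" "fst ` set (pieces T) = dom P"
      "\<forall>d. extent (item_size G) d T \<le> N"
      using feasible_imp_slicing[OF G P] by (auto simp: N_def)
    have items: "dom P \<subseteq> items G" using P by (simp add: feasible_def)
    have turn: "turnable s" by (auto simp: turnable_def s_def item_size_flip)
    have pos: "\<forall>a\<in>set (pieces T). \<forall>d. 0 < s d a"
    proof (intro ballI allI)
      fix a d assume "a \<in> set (pieces T)"
      then have "fst a \<in> items G" using T(2) items by blast
      then show "0 < s d a" using G N by (auto simp: s_def valid_instance_def item_size_def placed_size_def)
    qed
    have "extent s d T \<le> 1" for d
    proof -
      have "extent (\<lambda>d a. 1 / N * item_size G d a) d T = 1 / N * extent (item_size G) d T"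
        using N by (intro extent_scale) simp
      then have "extent s d T = extent (item_size G) d T / N" by (simp add: s_def[abs_def])
      then show ?thesis using T(3) N by simp
    qed
    with K[OF turn pos T(1)] obtain C where C: "\<forall>c\<in>set (pieces C). plan_ok \<epsilon> s c"
      "\<forall>d. extent plan_size d C \<le> 1" "length (pieces C) \<le> K" "distinct (map fst (all_contents C))"
      "fst ` set (all_contents C) \<subseteq> fst ` set (pieces T)"
      "(1 - 4 * \<epsilon>) * real (length (pieces T)) \<le> real (length (all_contents C))" by blast
    define g :: "(nat \<times> bool) plan \<Rightarrow> (nat \<times> bool) plan" where "g = (\<lambda>(k, T, w, h). (k, T, N * w, N * h))"
    have size: "plan_size d (g c) = N * plan_size d c" for d c
      by (cases c) (simp add: g_def plan_size_def)
    have contents: "contents (g c) = contents c" for c by (cases c) (simp add: g_def contents_def)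
    define D where "D = map_slicing g C"
    have ac: "all_contents D = all_contents C"
      by (simp add: D_def all_contents_def comp_def contents)
    have "\<exists>Q. guillotine_container_packed \<epsilon> K G Q \<and> profit Q = length (all_contents D)"
    proof (rule container_slicing_imp_packed[OF assms(1) G])
      fix c assume "c \<in> set (pieces D)"
      then obtain c' where c': "c' \<in> set (pieces C)" "c = g c'" by (auto simp: D_def)
      obtain k T w h where "c' = (k, T, w, h)" by (cases c')
      then show "plan_ok \<epsilon> (item_size G) c"
        using C(1) c' plan_ok_scale[of \<epsilon> "item_size G" N k T w h] N by (auto simp: g_def s_def[abs_def])
    next
      fix d
      have "extent plan_size d D = N * extent plan_size d C"
        unfolding D_def extent_map size using N by (intro extent_scale) simp
      then show "extent plan_size d D \<le> real (side G)"
        using C(2) N mult_left_mono[of "extent plan_size d C" 1 N] by (simp add: N_def)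
    next
      show "distinct (map fst (all_contents D))" using C(4) ac by simp
      show "fst ` set (all_contents D) \<subseteq> items G" using C(5) T(2) items ac by auto
      show "length (pieces D) \<le> K" using C(3) by (simp add: D_def)
    qed
    then obtain Q where Q: "guillotine_container_packed \<epsilon> K G Q" "profit Q = length (all_contents D)" by blast
    have "profit P = length (pieces T)"
      unfolding profit_def T(2)[symmetric] using T(1) by (metis distinct_card length_map list.set_map)
    then show ?thesis using Q C(6) ac by auto
  qed
  then show ?thesis by blast
qed

theorem mainTheorem9:
  "\<exists>c>0. \<exists>K :: real \<Rightarrow> nat. \<forall>\<epsilon>>0. \<forall>G OPT APX.
     valid_instance G \<longrightarrow>
     is_arg_max profit (feasible G) OPT \<longrightarrow>
     is_arg_max profit (guillotine_container_packed \<epsilon> (K \<epsilon>) G) APX \<longrightarrow>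
     real (profit APX) \<ge> (4 / 5 - c * \<epsilon>) * real (profit OPT)"
proof -
  have "\<forall>\<epsilon>. \<exists>K. 0 < \<epsilon> \<longrightarrow> \<epsilon> \<le> 1 \<longrightarrow> (\<forall>G P. valid_instance G \<longrightarrow> feasible G P \<longrightarrow>
    (\<exists>Q. guillotine_container_packed \<epsilon> K G Q \<and> (1 - 4 * \<epsilon>) * real (profit P) \<le> real (profit Q)))"
    using container_packing_of_feasible by blast
  then obtain K where K: "\<And>\<epsilon> G P. 0 < \<epsilon> \<Longrightarrow> \<epsilon> \<le> 1 \<Longrightarrow> valid_instance G \<Longrightarrow> feasible G P \<Longrightarrow>
    (\<exists>Q. guillotine_container_packed \<epsilon> (K \<epsilon>) G Q \<and> (1 - 4 * \<epsilon>) * real (profit P) \<le> real (profit Q))"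
    by metis
  have "(4 / 5 - 4 * \<epsilon>) * real (profit OPT) \<le> real (profit APX)"
    if \<epsilon>: "0 < \<epsilon>" and G: "valid_instance G" and OPT: "is_arg_max profit (feasible G) OPT"
      and APX: "is_arg_max profit (guillotine_container_packed \<epsilon> (K \<epsilon>) G) APX" for \<epsilon> G OPT APX
  proof (cases "\<epsilon> \<le> 1")
    case True
    have "feasible G OPT" using OPT by (simp add: is_arg_max_def)
    then obtain Q where Q: "guillotine_container_packed \<epsilon> (K \<epsilon>) G Q"
      "(1 - 4 * \<epsilon>) * real (profit OPT) \<le> real (profit Q)" using K[OF \<epsilon> True G] by blast
    have "profit Q \<le> profit APX" using APX Q(1) by (auto simp: is_arg_max_def not_less)
    \<comment> \<open>The comparison obtained above has the factor
      \<open>1 - 4 * \<epsilon>\<close>, from which the claimed one follows by monotonicity.\<close>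
    moreover have "(4 / 5 - 4 * \<epsilon>) * real (profit OPT) \<le> (1 - 4 * \<epsilon>) * real (profit OPT)"
      by (intro mult_right_mono) auto
    ultimately show ?thesis using Q(2) by linarith
  next
    case False
    \<comment> \<open>Beyond \<open>\<epsilon> = 1\<close> the factor is negative and the bound
      trivial.\<close>
    then have "(4 / 5 - 4 * \<epsilon>) * real (profit OPT) \<le> 0" by (intro mult_nonpos_nonneg) auto
    then show ?thesis by (meson of_nat_0_le_iff order_trans)
  qed
  then show ?thesis by (intro exI[of _ 4] conjI exI[of _ K]) auto
qed

end
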